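(* Let $f(u,v)>0$, $\nu(u,v)$, $\lambda_1(u,v)$, $\mu_1(u,v)\neq0$, $\lambda_2(u,v)\neq0$ be five smooth functions, defined in a domain $\mathcal{D}\subset\mathbb{R}^2$, and satisfying the conditions (i) $(\lambda_2)_u+\nu_v+(\ln f^2)_u\lambda_2=0$; (ii) $(\mu_1)_v+(\ln f^2)_v\mu_1-\frac{\nu^2-\lambda_1\lambda_2}{\lambda_2\mu_1}\bigl(\nu_u+(\lambda_1)_v+(\ln f^2)_v\lambda_1\bigr)=0$; (iii) $\frac{2ff_{uv}-2f_uf_v}{f^4}-(\nu^2-\lambda_1\lambda_2)=0$; (iv) $\lambda_2\bigl(\nu_{uu}+(\lambda_1)_{uv}+(\lambda_1)_u(\ln f^2)_v+\lambda_1(\ln f^2)_{uv}\bigr)+\nu\bigl(\nu_{uv}+(\lambda_1)_{vv}+(\lambda_1)_v(\ln f^2)_v+\lambda_1(\ln f^2)_{vv}\bigr)+f^2\mu_1^2\lambda_2^2-\bigl(\nu_u+(\lambda_1)_v+\lambda_1(\ln f^2)_v\bigr)\bigl(\lambda_2(\ln|\mu_1|)_u+\nu_v-\nu(\ln|\mu_1|)_v-\nu(\ln|\lambda_2|)_v\bigr)=0$. If $\{x_0,y_0,(n_1)_0,(n_2)_0\}$ is a pseudo-orthonormal frame at a point $p_0\in\mathbb{R}^4_1$, then there exists a subdomain $\mathcal{D}_0\subset\mathcal{D}$ and a unique timelike surface of second type $\mathcal{M}^2: z=z(u,v)$, $(u,v)\in\mathcal{D}_0$, parametrized by isotropic parameters,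 such that $\mathcal{M}^2$ passes through $p_0$ and $\{x_0,y_0,(n_1)_0,(n_2)_0\}$ is the geometric frame of $\mathcal{M}^2$ at $p_0$.
   Context: $\mathbb{R}^4_1$ is the four-dimensional Minkowski space with the flat metric $\langle\cdot,\cdot\rangle=dx_1^2+dx_2^2+dx_3^2-dx_4^2$. All considerations are local and all functions are $C^\infty$; subscripts $u,v$ on functions denote partial derivatives (e.g. $(\lambda_1)_u=\partial\lambda_1/\partial u$). A pseudo-orthonormal frame is a basis $\{x,y,n_1,n_2\}$ of $\mathbb{R}^4_1$ with $\langle x,x\rangle=\langle y,y\rangle=0$, $\langle x,y\rangle=-1$, $\langle n_1,n_1\rangle=\langle n_2,n_2\rangle=1$, and $\langle n_1,n_2\rangle=\langle x,n_i\rangle=\langle y,n_i\rangle=0$ for $i=1,2$. A surface $\mathcal{M}^2: z=z(u,v)$ in $\mathbb{R}^4_1$ is an immersion of a domain of $\mathbb{R}^2$; it is timelike if the restriction of $\langle\cdot,\cdot\rangle$ to each tangent space is indefinite. The parameters $(u,v)$ are isotropic if $\langle z_u,z_u\rangle=0$, $\langle z_v,z_v\rangle=0$, $\langle z_u,z_v\rangle=-f^2(u,v)$ for a positive function $f$. Let $\sigma$ be the second fundamental tensor and $H=\frac12\operatorname{tr}\sigma$ the mean curvature vector field. Only surfaces free of minimal points ($H\neq0$ at all points) are considered. Geometric frame field: for such a timelike surface in isotropic parameters put $x=z_u/f$, $y=z_v/f$, so that $H=-\sigma(x,y)$; let $n_1$ be the unit normal vector field collinear with $H$, $H=\nu n_1$,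 $\nu=\|H\|$; let $n_2$ be a unit normal vector field such that $\{n_1,n_2\}$ is an orthonormal frame field of the normal bundle ($n_2$ is determined up to sign). Then $\{x,y,n_1,n_2\}$ is called the geometric frame field of the surface, and one has $\sigma(x,x)=\lambda_1n_1+\mu_1n_2$, $\sigma(x,y)=-\nu n_1$, $\sigma(y,y)=\lambda_2n_1+\mu_2n_2$ with smooth functions $\lambda_1,\mu_1,\lambda_2,\mu_2$ of the surface. A timelike surface is of second type if $\mu_1\neq0$, $\mu_2=0$ and $\lambda_2\neq0$.
   Formalization: In (iv) the last factor is corrected to λ2(ln|μ1|)_u − ν_v + ν(ln|μ1|)_v + ν(ln|λ2|)_v, since the printed signs contradict the Ricci equation; ν>0 is assumed, and f, ν, λ1, μ1, λ2 are taken to be the geometric functions of the surface. *)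

theory Defs
  imports "HOL-Analysis.Analysis"
begin

definition plane_domain :: "(real \<times> real) set \<Rightarrow> bool" where
  "plane_domain D \<longleftrightarrow> open D \<and> connected D \<and> D \<noteq> {}"

definition du :: "(real \<times> real \<Rightarrow> 'a::real_normed_vector) \<Rightarrow> real \<times> real \<Rightarrow> 'a" where
  "du g p = vector_derivative (\<lambda>t. g (t, snd p)) (at (fst p))"

definition dv :: "(real \<times> real \<Rightarrow> 'a::real_normed_vector) \<Rightarrow> real \<times> real \<Rightarrow> 'a" where
  "dv g p = vector_derivative (\<lambda>t. g (fst p, t)) (at (snd p))"

primrec Ck_on :: "nat \<Rightarrow> (real \<times> real) set \<Rightarrow> (real \<times> real \<Rightarrow> 'a::real_normed_vector) \<Rightarrow> bool" where
  "Ck_on 0 D g \<longleftrightarrow> continuous_on D g"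
| "Ck_on (Suc k) D g \<longleftrightarrow> g differentiable_on D \<and> Ck_on k D (du g) \<and> Ck_on k D (dv g)"

(* Only meaningful for open D. *)
definition Cinf_on :: "(real \<times> real) set \<Rightarrow> (real \<times> real \<Rightarrow> 'a::real_normed_vector) \<Rightarrow> bool" where
  "Cinf_on D g \<longleftrightarrow> (\<forall>k. Ck_on k D g)"

(* The numeral 4 of the index type 4 is its fourth element (it coincides with 0). *)
definition mink :: "real^4 \<Rightarrow> real^4 \<Rightarrow> real" where
  "mink a b = a $ 1 * b $ 1 + a $ 2 * b $ 2 + a $ 3 * b $ 3 - a $ 4 * b $ 4"

(* Used only for non-timelike vectors, such as the normal vectors of a timelike surface. *)
definition mink_norm :: "real^4 \<Rightarrow> real" where
  "mink_norm a = sqrt (mink a a)"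

definition pseudo_orthonormal_frame ::
    "real^4 \<Rightarrow> real^4 \<Rightarrow> real^4 \<Rightarrow> real^4 \<Rightarrow> bool" where
  "pseudo_orthonormal_frame x y n1 n2 \<longleftrightarrow>
     independent {x, y, n1, n2} \<and> span {x, y, n1, n2} = UNIV \<and>
     mink x x = 0 \<and> mink y y = 0 \<and> mink x y = -1 \<and>
     mink n1 n1 = 1 \<and> mink n2 n2 = 1 \<and> mink n1 n2 = 0 \<and>
     mink x n1 = 0 \<and> mink x n2 = 0 \<and> mink y n1 = 0 \<and> mink y n2 = 0"

type_synonym surface = "real \<times> real \<Rightarrow> real^4"

definition tangent_space :: "surface \<Rightarrow> real \<times> real \<Rightarrow> (real^4) set" where
  "tangent_space z p = span {du z p, dv z p}"

definition is_normal :: "surface \<Rightarrow> real \<times> real \<Rightarrow> real^4 \<Rightarrow> bool" where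
  "is_normal z p w \<longleftrightarrow> (\<forall>X\<in>tangent_space z p. mink w X = 0)"

definition immersed_surface :: "(real \<times> real) set \<Rightarrow> surface \<Rightarrow> bool" where
  "immersed_surface D z \<longleftrightarrow> plane_domain D \<and> Cinf_on D z \<and>
     (\<forall>p\<in>D. \<forall>a b. a *\<^sub>R du z p + b *\<^sub>R dv z p = 0 \<longrightarrow> a = 0 \<and> b = 0)"

definition timelike_surface :: "(real \<times> real) set \<Rightarrow> surface \<Rightarrow> bool" where
  "timelike_surface D z \<longleftrightarrow> immersed_surface D z \<and>
     (\<forall>p\<in>D. (\<exists>X\<in>tangent_space z p. mink X X > 0) \<and> (\<exists>Y\<in>tangent_space z p. mink Y Y < 0))"

definition isotropic_parameters ::
    "(real \<times> real) set \<Rightarrow> surface \<Rightarrow> (real \<times> real \<Rightarrow> real) \<Rightarrow> bool" where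
  "isotropic_parameters D z f \<longleftrightarrow>
     (\<forall>p\<in>D. f p > 0 \<and> mink (du z p) (du z p) = 0 \<and> mink (dv z p) (dv z p) = 0 \<and>
            mink (du z p) (dv z p) = - ((f p)^2))"

(* The component normal to the surface; well defined where the induced metric is nondegenerate. *)
definition normal_part :: "surface \<Rightarrow> real \<times> real \<Rightarrow> real^4 \<Rightarrow> real^4" where
  "normal_part z p X = (THE w. is_normal z p w \<and> X - w \<in> tangent_space z p)"

(* sigma(X,Y) is the normal part of the flat derivative of Y in direction X: for tangent vectors
   X = a z_u + b z_v and Y = c z_u + d z_v it is the normal part of
   a c z_uu + (a d + b c) z_uv + b d z_vv. *)
definition second_fund ::
    "surface \<Rightarrow> real \<times> real \<Rightarrow> real^4 \<Rightarrow> real^4 \<Rightarrow> real^4" where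
  "second_fund z p X Y = (THE w. \<exists>a b c d.
     X = a *\<^sub>R du z p + b *\<^sub>R dv z p \<and> Y = c *\<^sub>R du z p + d *\<^sub>R dv z p \<and>
     w = normal_part z p
           ((a * c) *\<^sub>R du (du z) p + (a * d + b * c) *\<^sub>R dv (du z) p + (b * d) *\<^sub>R dv (dv z) p))"

(* H = (1/2) tr sigma, the trace being taken with the inverse of the first fundamental form
   E = <z_u,z_u>, F = <z_u,z_v>, G = <z_v,z_v>. *)
definition mean_curvature :: "surface \<Rightarrow> real \<times> real \<Rightarrow> real^4" where
  "mean_curvature z p =
     (let E = mink (du z p) (du z p); F = mink (du z p) (dv z p); G = mink (dv z p) (dv z p)
      in (1 / (2 * (E * G - F^2))) *\<^sub>R
           (G *\<^sub>R second_fund z p (du z p) (du z p)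
            - (2 * F) *\<^sub>R second_fund z p (du z p) (dv z p)
            + E *\<^sub>R second_fund z p (dv z p) (dv z p)))"

definition geometric_frame_field ::
    "(real \<times> real) set \<Rightarrow> surface \<Rightarrow> (real \<times> real \<Rightarrow> real) \<Rightarrow>
     surface \<Rightarrow> surface \<Rightarrow> surface \<Rightarrow> surface \<Rightarrow> bool" where
  "geometric_frame_field D z f x y n1 n2 \<longleftrightarrow>
     Cinf_on D n1 \<and> Cinf_on D n2 \<and>
     (\<forall>p\<in>D. mean_curvature z p \<noteq> 0 \<and>
        x p = (1 / f p) *\<^sub>R du z p \<and> y p = (1 / f p) *\<^sub>R dv z p \<and>
        is_normal z p (n1 p) \<and> is_normal z p (n2 p) \<and>
        mink (n1 p) (n1 p) = 1 \<and> mink (n2 p) (n2 p) = 1 \<and> mink (n1 p) (n2 p) = 0 \<and>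
        mean_curvature z p = mink_norm (mean_curvature z p) *\<^sub>R n1 p)"

definition geometric_functions ::
    "(real \<times> real) set \<Rightarrow> surface \<Rightarrow> surface \<Rightarrow> surface \<Rightarrow> surface \<Rightarrow> surface \<Rightarrow>
     (real \<times> real \<Rightarrow> real) \<Rightarrow> (real \<times> real \<Rightarrow> real) \<Rightarrow> (real \<times> real \<Rightarrow> real) \<Rightarrow>
     (real \<times> real \<Rightarrow> real) \<Rightarrow> (real \<times> real \<Rightarrow> real) \<Rightarrow> bool" where
  "geometric_functions D z x y n1 n2 nu lam1 mu1 lam2 mu2 \<longleftrightarrow>
     (\<forall>p\<in>D. nu p = mink_norm (mean_curvature z p) \<and>
        second_fund z p (x p) (x p) = lam1 p *\<^sub>R n1 p + mu1 p *\<^sub>R n2 p \<and>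
        second_fund z p (x p) (y p) = - (nu p *\<^sub>R n1 p) \<and>
        second_fund z p (y p) (y p) = lam2 p *\<^sub>R n1 p + mu2 p *\<^sub>R n2 p)"

definition second_type :: "(real \<times> real) set \<Rightarrow> surface \<Rightarrow> bool" where
  "second_type D z \<longleftrightarrow>
     (\<exists>f x y n1 n2 nu lam1 mu1 lam2 mu2.
        isotropic_parameters D z f \<and> geometric_frame_field D z f x y n1 n2 \<and>
        geometric_functions D z x y n1 n2 nu lam1 mu1 lam2 mu2 \<and>
        (\<forall>p\<in>D. mu1 p \<noteq> 0 \<and> mu2 p = 0 \<and> lam2 p \<noteq> 0))"

abbreviation ln_sq :: "(real \<times> real \<Rightarrow> real) \<Rightarrow> real \<times> real \<Rightarrow> real" where
  "ln_sq g \<equiv> (\<lambda>p. ln ((g p)^2))"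

abbreviation ln_abs :: "(real \<times> real \<Rightarrow> real) \<Rightarrow> real \<times> real \<Rightarrow> real" where
  "ln_abs g \<equiv> (\<lambda>p. ln \<bar>g p\<bar>)"

(* z is a timelike surface of second type in isotropic parameters whose invariants are the given
   functions (second invariant mu_2 = 0), with z(q0) = p0 and the given geometric frame there. *)
definition realizes_data ::
    "(real \<times> real) set \<Rightarrow> (real \<times> real \<Rightarrow> real) \<Rightarrow> (real \<times> real \<Rightarrow> real) \<Rightarrow>
     (real \<times> real \<Rightarrow> real) \<Rightarrow> (real \<times> real \<Rightarrow> real) \<Rightarrow> (real \<times> real \<Rightarrow> real) \<Rightarrow>
     real \<times> real \<Rightarrow> real^4 \<Rightarrow> real^4 \<Rightarrow> real^4 \<Rightarrow> real^4 \<Rightarrow> real^4 \<Rightarrow> surface \<Rightarrow> bool" where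
  "realizes_data D f nu lam1 mu1 lam2 q0 p0 x0 y0 n10 n20 z \<longleftrightarrow>
     timelike_surface D z \<and> second_type D z \<and> isotropic_parameters D z f \<and> z q0 = p0 \<and>
     (\<exists>x y n1 n2. geometric_frame_field D z f x y n1 n2 \<and>
        geometric_functions D z x y n1 n2 nu lam1 mu1 lam2 (\<lambda>_. 0) \<and>
        x q0 = x0 \<and> y q0 = y0 \<and> n1 q0 = n10 \<and> n2 q0 = n20)"

end

(* Fundamental theorem of surface theory. The invariants determine matrices M, N such that the moving
   frame F = (x, y, n1, n2), written as a matrix of rows, satisfies F_u = M F and F_v = N F; the
   coefficients of the normal connection are solved from the Codazzi equations, which is possible because
   mu1 and lambda2 do not vanish. Conditions (i)-(iv) say exactly that M_v + M N = N_u + N M, so the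
   linear total system is solvable near q0 for every initial frame. The Gram matrix of F is preserved
   because M and N are skew for it, and z_u = f x, z_v = f y is closed. Conversely the frame of any
   surface with these invariants solves the same system, hence uniqueness. *)
theory Submission
  imports Defs
begin

text \<open>The obstacle is regularity. The fixed-point argument yields a frame that is merely
  continuous and solves only one of the two equations, so the other one has to be extracted from
  compatibility, and smoothness follows afterwards from the system itself. The square is small
  because the contraction estimate needs side times coefficient bound at most 1/4. Its interior is
  convex, so uniqueness and preservation of the Gram matrix both reduce to a Gronwall estimate along
  segments from \<open>q0\<close>, and existence and uniqueness hold on the same domain. The
  compatibility equation has sixteen entries, but its two sides differ by a matrix that is again
  skew for the null Gram matrix, so six scalar equations remain: one Gauss, four Codazzi, one Ricci.
  Two of the Codazzi equations define the normal connection; the other four equations are (i)-(iv).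
  Positivity of \<open>nu\<close> belongs to the data since it is the length of the nonzero vector
  field H.\<close>

section \<open>Oriented integrals and fixed points\<close>

text \<open>The integral from \<open>a\<close> to \<open>x\<close>, pulled back to \<open>{0..1}\<close>: no case distinction on the sign of
  \<open>x - a\<close> is needed, and parameters enter only through the integrand.\<close>

definition oint :: "(real \<Rightarrow> 'a::banach) \<Rightarrow> real \<Rightarrow> real \<Rightarrow> 'a" where
  "oint h a x = (x - a) *\<^sub>R integral {0..1} (\<lambda>r. h (a + r * (x - a)))"

lemma segment_in_interval:
  fixes a x l r s :: real
  assumes "a \<in> {l..r}" "x \<in> {l..r}" "s \<in> {0..1}"
  shows "a + s * (x - a) \<in> {l..r}"
proof -
  have "(1 - s) *\<^sub>R a + s *\<^sub>R x \<in> {l..r}"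
    using assms by (intro convexD[OF convex_real_interval(5)]) auto
  then show ?thesis by (simp add: algebra_simps)
qed

lemma oint_self [simp]: "oint h a a = 0"
  by (simp add: oint_def)

lemma oint_cong:
  assumes "a \<in> {l..r}" "x \<in> {l..r}" "\<And>t. t \<in> {l..r} \<Longrightarrow> h t = k t"
  shows "oint h a x = oint k a x"
  unfolding oint_def
  by (intro arg_cong[where f = "(*\<^sub>R) (x - a)"] integral_cong assms(3) segment_in_interval assms)

lemma continuous_on_segment:
  fixes h :: "real \<Rightarrow> 'a::banach"
  assumes "continuous_on {l..r} h" "a \<in> {l..r}" "x \<in> {l..r}"
  shows "continuous_on {0..1} (\<lambda>s. h (a + s * (x - a)))"
  by (rule continuous_on_compose2[OF assms(1)])
     (auto intro!: continuous_intros segment_in_interval[OF assms(2,3), simplified])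

lemma oint_FTC:
  fixes H :: "real \<Rightarrow> 'a::banach"
  assumes "a \<in> {l..r}" "x \<in> {l..r}"
    and H: "\<And>t. t \<in> {l..r} \<Longrightarrow> (H has_vector_derivative h t) (at t within {l..r})"
  shows "oint h a x = H x - H a"
proof -
  have "((\<lambda>s. H (a + s * (x - a))) has_vector_derivative (x - a) *\<^sub>R h (a + s * (x - a)))
      (at s within {0..1})" if "s \<in> {0..1}" for s
  proof -
    have "((\<lambda>s. a + s * (x - a)) has_vector_derivative (x - a)) (at s within {0..1})"
      by (auto intro!: derivative_eq_intros simp: has_vector_derivative_def)
    moreover have "(H has_vector_derivative h (a + s * (x - a)))
        (at (a + s * (x - a)) within (\<lambda>s. a + s * (x - a)) ` {0..1})"
      using H[OF segment_in_interval[OF assms(1,2) that]] segment_in_interval[OF assms(1,2)]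
      by (auto intro: has_vector_derivative_within_subset)
    ultimately show ?thesis
      using vector_diff_chain_within[of "\<lambda>s. a + s * (x - a)" "x - a" s "{0..1}" H] by (simp add: o_def)
  qed
  then have I: "((\<lambda>s. (x - a) *\<^sub>R h (a + s * (x - a))) has_integral H x - H a) {0..1}"
    using fundamental_theorem_of_calculus[of 0 1 "\<lambda>s. H (a + s * (x - a))"] by simp
  then show ?thesis
    unfolding oint_def by (simp flip: integral_cmul add: integral_unique)
qed

lemma oint_has_vector_derivative:
  fixes h :: "real \<Rightarrow> 'a::banach"
  assumes "a \<in> {l..r}" "x \<in> {l..r}" "continuous_on {l..r} h"
  shows "(oint h a has_vector_derivative h x) (at x within {l..r})"
proof -
  define H where "H y = integral {l..y} h" for y
  have H: "(H has_vector_derivative h t) (at t within {l..r})" if "t \<in> {l..r}" for t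
    unfolding H_def by (rule integral_has_vector_derivative[OF assms(3) that])
  have eq: "oint h a y = H y - H a" if "y \<in> {l..r}" for y
    by (rule oint_FTC[OF assms(1) that H])
  have "((\<lambda>y. H y - H a) has_vector_derivative h x) (at x within {l..r})"
    using H[OF assms(2)] by (auto intro!: derivative_eq_intros)
  from has_vector_derivative_transform[OF assms(2) _ this] show ?thesis
    using eq by simp
qed

lemma oint_diff:
  fixes h k :: "real \<Rightarrow> 'a::banach"
  assumes "a \<in> {l..r}" "x \<in> {l..r}" "continuous_on {l..r} h" "continuous_on {l..r} k"
  shows "oint (\<lambda>t. h t - k t) a x = oint h a x - oint k a x"
  unfolding oint_def
  by (subst integral_diff)
     (auto intro!: integrable_continuous_interval continuous_on_segment[OF assms(3) assms(1,2)]
       continuous_on_segment[OF assms(4) assms(1,2)] simp: scaleR_right_diff_distrib)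

lemma norm_oint_le:
  fixes h :: "real \<Rightarrow> 'a::banach"
  assumes "a \<in> {l..r}" "x \<in> {l..r}" "continuous_on {l..r} h"
    and B: "\<And>t. t \<in> {l..r} \<Longrightarrow> norm (h t) \<le> B"
  shows "norm (oint h a x) \<le> \<bar>x - a\<bar> * B"
proof -
  have "norm (integral {0..1} (\<lambda>s. h (a + s * (x - a)))) \<le> B * (1 - 0)"
    by (rule integral_bound) (use assms in \<open>auto intro!: continuous_on_segment[OF assms(3)] B segment_in_interval[OF assms(1,2), simplified]\<close>)
  then show ?thesis
    by (auto simp: oint_def intro!: mult_left_mono)
qed

text \<open>The pullback has moved the endpoint into the integrand, so joint continuity in parameter
  and endpoint is continuity of one parameter integral over the fixed interval
  \<open>{0..1}\<close>.\<close>

lemma continuous_on_oint: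
  fixes k :: "'p::topological_space \<Rightarrow> real \<Rightarrow> 'a::banach"
  assumes k: "continuous_on (T \<times> {l..r}) (\<lambda>(p, t). k p t)" and a: "a \<in> {l..r}"
  shows "continuous_on (T \<times> {l..r}) (\<lambda>(p, x). oint (k p) a x)"
proof -
  have "continuous_on ((T \<times> {l..r}) \<times> cbox 0 1) (\<lambda>(q, s). k (fst q) (a + s * (snd q - a)))"
    unfolding split_beta
    by (rule continuous_on_compose2[OF k, where f = "\<lambda>q. (fst (fst q), a + snd q * (snd (fst q) - a))",
          simplified])
       (auto intro!: continuous_intros simp: segment_in_interval[OF a, simplified])
  then have "continuous_on (T \<times> {l..r}) (\<lambda>q. integral (cbox 0 1) (\<lambda>s. k (fst q) (a + s * (snd q - a))))"
    by (rule integral_continuous_on_param)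
  then show ?thesis
    unfolding oint_def split_beta by (auto intro!: continuous_intros)
qed

lemma oint_leibniz:
  fixes k k' :: "real \<Rightarrow> real \<Rightarrow> 'a::banach"
  assumes "a \<in> {l..r}" "x \<in> {l..r}" "convex V" "v \<in> V"
    and d: "\<And>v t. v \<in> V \<Longrightarrow> t \<in> {l..r} \<Longrightarrow> ((\<lambda>v. k v t) has_vector_derivative k' v t) (at v within V)"
    and c: "\<And>v. v \<in> V \<Longrightarrow> continuous_on {l..r} (k v)"
    and c': "continuous_on (V \<times> {l..r}) (\<lambda>(v, t). k' v t)"
  shows "((\<lambda>v. oint (k v) a x) has_vector_derivative oint (k' v) a x) (at v within V)"
proof -
  have "((\<lambda>v. integral (cbox 0 1) (\<lambda>s. k v (a + s * (x - a)))) has_vector_derivative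
      integral (cbox 0 1) (\<lambda>s. k' v (a + s * (x - a)))) (at v within V)"
  proof (rule leibniz_rule_vector_derivative[OF _ _ _ \<open>v \<in> V\<close> \<open>convex V\<close>])
    show "((\<lambda>v. k v (a + t * (x - a))) has_vector_derivative k' v (a + t * (x - a))) (at v within V)"
      if "v \<in> V" "t \<in> cbox 0 1" for v t
      using d segment_in_interval[OF assms(1,2)] that by simp
    show "(\<lambda>s. k v (a + s * (x - a))) integrable_on cbox 0 1" if "v \<in> V" for v
      using continuous_on_segment[OF c[OF that] assms(1,2)] by (simp add: integrable_continuous_interval)
    show "continuous_on (V \<times> cbox 0 1) (\<lambda>(v, s). k' v (a + s * (x - a)))"
      unfolding split_beta
      by (rule continuous_on_compose2[OF c', where f = "\<lambda>q. (fst q, a + snd q * (x - a))", simplified])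
         (auto intro!: continuous_intros simp: segment_in_interval[OF assms(1,2), simplified])
  qed
  then show ?thesis
    unfolding oint_def by (auto intro!: derivative_eq_intros)
qed

text \<open>Banach's theorem for operators on continuous functions of a box. To reach a complete
  metric space that is a type, such functions are extended to bounded continuous functions on the
  whole space by precomposition with \<open>clamp\<close>. The bound \<open>e\<close> plays the part
  of the sup distance; the factor 1/2 is what two integrals with factor 1/4 each will leave.\<close>

lemma contraction_on_cbox:
  fixes \<Phi> :: "('a::euclidean_space \<Rightarrow> 'b::banach) \<Rightarrow> 'a \<Rightarrow> 'b"
  assumes ne: "cbox a b \<noteq> {}"
    and cont: "\<And>g. continuous_on (cbox a b) g \<Longrightarrow> continuous_on (cbox a b) (\<Phi> g)"
    and contr: "\<And>g h e. continuous_on (cbox a b) g \<Longrightarrow> continuous_on (cbox a b) h \<Longrightarrow>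
      (\<And>p. p \<in> cbox a b \<Longrightarrow> norm (g p - h p) \<le> e) \<Longrightarrow>
      (\<And>p. p \<in> cbox a b \<Longrightarrow> norm (\<Phi> g p - \<Phi> h p) \<le> e / 2)"
  obtains g where "continuous_on (cbox a b) g" "\<And>p. p \<in> cbox a b \<Longrightarrow> \<Phi> g p = g p"
proof -
  have "\<exists>h::'a \<Rightarrow>\<^sub>C 'b. \<forall>x. apply_bcontfun h x = \<Phi> (apply_bcontfun g) (clamp a b x)" for g :: "'a \<Rightarrow>\<^sub>C 'b"
    by (rule continuous_on_cbox_bcontfunE[OF cont[OF continuous_on_apply_bcontfun[of _ g]]]) metis
  then obtain T :: "('a \<Rightarrow>\<^sub>C 'b) \<Rightarrow> ('a \<Rightarrow>\<^sub>C 'b)"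
    where T: "\<And>g x. apply_bcontfun (T g) x = \<Phi> (apply_bcontfun g) (clamp a b x)"
    by metis
  have cl: "clamp a b x \<in> cbox a b" for x
    using ne by (auto intro!: clamp_in_interval simp: box_ne_empty)
  have "dist (T g) (T h) \<le> (1 / 2) * dist g h" for g h
  proof (rule dist_bound)
    fix x
    show "dist (T g x) (T h x) \<le> (1 / 2) * dist g h"
      using contr[of g h "dist g h" "clamp a b x"] cl dist_bounded[of g _ h]
      by (simp add: T dist_norm)
  qed
  then obtain g where "T g = g"
    using banach_fix_type[of "1 / 2" T] by auto
  then have "\<Phi> g p = g p" if "p \<in> cbox a b" for p
    using T[of g p] that by (metis clamp_cancel_cbox)
  then show ?thesis
    using that[of g] by auto
qed

section \<open>Linear total differential systems\<close>

lemma bounded_bilinear_matrix_matrix_mult: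
  "bounded_bilinear ((**) :: real^'n^'m \<Rightarrow> real^'p^'n \<Rightarrow> real^'p^'m)"
proof -
  have "bilinear ((**) :: real^'n^'m \<Rightarrow> real^'p^'n \<Rightarrow> real^'p^'m)"
    by (auto simp: bilinear_def linear_iff vec_eq_iff matrix_matrix_mult_def sum_distrib_left
        sum.distrib algebra_simps)
  then show ?thesis by (simp add: bilinear_conv_bounded_bilinear)
qed

lemmas has_vector_derivative_matrix_mult =
  bounded_bilinear.has_vector_derivative[OF bounded_bilinear_matrix_matrix_mult]

lemmas continuous_on_matrix_mult [continuous_intros] =
  bounded_bilinear.continuous_on[OF bounded_bilinear_matrix_matrix_mult]

lemmas matrix_mult_diff_right = bounded_bilinear.diff_right[OF bounded_bilinear_matrix_matrix_mult]

lemma continuous_on_slices: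
  assumes "continuous_on (I \<times> J) g"
  shows "v \<in> J \<Longrightarrow> continuous_on I (\<lambda>u. g (u, v))" "u \<in> I \<Longrightarrow> continuous_on J (\<lambda>v. g (u, v))"
  by (auto intro!: continuous_on_compose2[OF assms] continuous_intros)

text \<open>The fixed point below solves the \<open>v\<close>-equation by construction. Its error in the integrated
  \<open>u\<close>-equation satisfies a homogeneous integro-differential equation in \<open>v\<close> with vanishing initial
  value, so no differentiation of the fixed point in the parameter \<open>u\<close> is needed.\<close>

lemma linear_total_system_rectangle:
  fixes M M' N N' :: "real \<times> real \<Rightarrow> real^'n^'n" and F0 :: "real^'m^'n"
  assumes base: "u0 \<in> {a..b}" "v0 \<in> {c..d}"
    and cont: "continuous_on ({a..b} \<times> {c..d}) M" "continuous_on ({a..b} \<times> {c..d}) M'"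
      "continuous_on ({a..b} \<times> {c..d}) N" "continuous_on ({a..b} \<times> {c..d}) N'"
    and dM: "\<And>u v. u \<in> {a..b} \<Longrightarrow> v \<in> {c..d} \<Longrightarrow>
      ((\<lambda>v. M (u, v)) has_vector_derivative M' (u, v)) (at v within {c..d})"
    and dN: "\<And>u v. u \<in> {a..b} \<Longrightarrow> v \<in> {c..d} \<Longrightarrow>
      ((\<lambda>u. N (u, v)) has_vector_derivative N' (u, v)) (at u within {a..b})"
    and compat: "\<And>p. p \<in> {a..b} \<times> {c..d} \<Longrightarrow> M' p + M p ** N p = N' p + N p ** M p"
    and bound: "\<And>p (X :: real^'m^'n). p \<in> {a..b} \<times> {c..d} \<Longrightarrow> norm (M p ** X) \<le> C * norm X"
      "\<And>p (X :: real^'m^'n). p \<in> {a..b} \<times> {c..d} \<Longrightarrow> norm (N p ** X) \<le> C * norm X"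
      "\<And>p (X :: real^'m^'n). p \<in> {a..b} \<times> {c..d} \<Longrightarrow> norm (N' p ** X) \<le> C * norm X"
    and small: "b - a \<le> \<epsilon>" "d - c \<le> \<epsilon>" "\<epsilon> * C \<le> 1 / 4" "\<epsilon> \<le> 1" "C \<ge> 0"
  obtains F where "continuous_on ({a..b} \<times> {c..d}) F" "F (u0, v0) = F0"
    "\<And>u v. u \<in> {a..b} \<Longrightarrow> v \<in> {c..d} \<Longrightarrow>
      ((\<lambda>u. F (u, v)) has_vector_derivative M (u, v) ** F (u, v)) (at u within {a..b})"
    "\<And>u v. u \<in> {a..b} \<Longrightarrow> v \<in> {c..d} \<Longrightarrow>
      ((\<lambda>v. F (u, v)) has_vector_derivative N (u, v) ** F (u, v)) (at v within {c..d})"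
proof -
  define S where "S = {a..b} \<times> {c..d}"
  have S_cbox: "S = cbox (a, c) (b, d)" by (simp add: S_def cbox_Pair_eq)
  have len: "\<bar>u - u0\<bar> \<le> \<epsilon>" "\<bar>v - v0\<bar> \<le> \<epsilon>" if "u \<in> {a..b}" "v \<in> {c..d}" for u v
    using that base small by auto
  have "\<epsilon> \<ge> 0" using base small by auto
  note contS = cont[folded S_def]
  note sl = continuous_on_slices[where I = "{a..b}" and J = "{c..d}", folded S_def]
  \<comment> \<open>Integration along a path from the base point: the u-equation on the line
    \<open>v = v0\<close> only, then the v-equation at fixed u. A fixed point therefore satisfies
    the v-equation everywhere, while the u-equation is built in on that line alone.\<close>
  define \<Phi> :: "(real \<times> real \<Rightarrow> real^'m^'n) \<Rightarrow> real \<times> real \<Rightarrow> real^'m^'n" where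
    "\<Phi> g p = F0 + oint (\<lambda>s. M (s, v0) ** g (s, v0)) u0 (fst p)
      + oint (\<lambda>t. N (fst p, t) ** g (fst p, t)) v0 (snd p)" for g p
  have cont_u: "continuous_on S (\<lambda>p. oint (\<lambda>s. h (s, snd p)) u0 (fst p))"
    if "continuous_on S h" for h :: "real \<times> real \<Rightarrow> real^'m^'n"
  proof -
    have "continuous_on ({c..d} \<times> {a..b}) (\<lambda>(v, u). oint (\<lambda>s. h (s, v)) u0 u)"
      using that base unfolding S_def
      by (intro continuous_on_oint)
         (auto simp: split_beta intro!: continuous_on_compose2[OF that[unfolded S_def]] continuous_intros)
    then have "continuous_on S (\<lambda>p. (\<lambda>(v, u). oint (\<lambda>s. h (s, v)) u0 u) (snd p, fst p))"
      by (rule continuous_on_compose2) (auto simp: S_def intro!: continuous_intros)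
    then show ?thesis by simp
  qed
  have cont_v: "continuous_on S (\<lambda>p. oint (\<lambda>t. h (fst p, t)) v0 (snd p))"
    if "continuous_on S h" for h :: "real \<times> real \<Rightarrow> real^'m^'n"
    using continuous_on_oint[of "{a..b}" c d "\<lambda>u t. h (u, t)" v0] that base
    by (simp add: S_def split_beta)
  have cont_\<Phi>: "continuous_on S (\<Phi> g)" if g: "continuous_on S g" for g
  proof -
    have "continuous_on S (\<lambda>p. oint (\<lambda>s. M (s, v0) ** g (s, v0)) u0 (fst p))"
    proof (rule continuous_on_compose2[where f = fst and t = "{a..b}"])
      show "continuous_on {a..b} (oint (\<lambda>s. M (s, v0) ** g (s, v0)) u0)"
        by (rule continuous_on_vector_derivative)
           (rule oint_has_vector_derivative[OF base(1) _
              sl(1)[OF continuous_on_matrix_mult[OF contS(1) g] base(2)]])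
    qed (auto simp: S_def intro!: continuous_intros)
    then show ?thesis
      unfolding \<Phi>_def by (intro continuous_intros cont_v contS g)
  qed
  \<comment> \<open>With \<open>\<epsilon> * C \<le> 1 / 4\<close> each of the two integrals in
    \<open>\<Phi>\<close> contributes at most e/4, hence the contraction factor 1/2; the same bound
    closes the estimate of the defect \<open>E\<close> at the end.\<close>
  have small_le: "x * (C * e) \<le> e / 4" if "0 \<le> e" "0 \<le> x" "x \<le> \<epsilon>" for x e
  proof -
    have "x * (C * e) \<le> \<epsilon> * (C * e)" using that small by (intro mult_right_mono) auto
    also have "\<dots> \<le> (1 / 4) * e" unfolding mult.assoc[symmetric] using that small by (intro mult_right_mono) auto
    finally show ?thesis by simp
  qed
  have bnd: "norm (A p ** X) \<le> C * e" if "norm X \<le> e" "p \<in> S" "A \<in> {M, N, N'}"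
    for A p e and X :: "real^'m^'n"
  proof -
    have "norm (A p ** X) \<le> C * norm X" using bound that by (auto simp: S_def)
    also have "\<dots> \<le> C * e" using that small by (intro mult_left_mono) auto
    finally show ?thesis .
  qed
  obtain F where F: "continuous_on S F" "\<And>p. p \<in> S \<Longrightarrow> \<Phi> F p = F p"
  proof (rule contraction_on_cbox[of "(a, c)" "(b, d)" \<Phi>, folded S_cbox])
    show "S \<noteq> {}" using base by (auto simp: S_def)
    fix g h :: "real \<times> real \<Rightarrow> real^'m^'n" and e p
    assume g: "continuous_on S g" and h: "continuous_on S h"
      and e: "\<And>p. p \<in> S \<Longrightarrow> norm (g p - h p) \<le> e" and p: "p \<in> S"
    have "e \<ge> 0" using e[OF p] norm_ge_zero order_trans by blast
    note cM = continuous_on_matrix_mult[OF contS(1) g] continuous_on_matrix_mult[OF contS(1) h]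
    note cN = continuous_on_matrix_mult[OF contS(3) g] continuous_on_matrix_mult[OF contS(3) h]
    have p': "fst p \<in> {a..b}" "snd p \<in> {c..d}" using p by (auto simp: S_def)
    have "norm (oint (\<lambda>s. M (s, v0) ** g (s, v0) - M (s, v0) ** h (s, v0)) u0 (fst p)) \<le> \<bar>fst p - u0\<bar> * (C * e)"
      using base
      by (intro norm_oint_le[OF base(1) p'(1)] continuous_on_diff
            sl(1)[OF cM(1) base(2)] sl(1)[OF cM(2) base(2)])
         (auto intro!: bnd e simp: S_def simp flip: matrix_mult_diff_right)
    also have "\<dots> \<le> e / 4"
      using len[OF p'] \<open>e \<ge> 0\<close> by (intro small_le) auto
    finally have 1: "norm (oint (\<lambda>s. M (s, v0) ** g (s, v0) - M (s, v0) ** h (s, v0)) u0 (fst p)) \<le> e / 4" .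
    have "norm (oint (\<lambda>t. N (fst p, t) ** g (fst p, t) - N (fst p, t) ** h (fst p, t)) v0 (snd p))
        \<le> \<bar>snd p - v0\<bar> * (C * e)"
      using p'
      by (intro norm_oint_le[OF base(2) p'(2)] continuous_on_diff
            sl(2)[OF cN(1) p'(1)] sl(2)[OF cN(2) p'(1)])
         (auto intro!: bnd e simp: S_def simp flip: matrix_mult_diff_right)
    also have "\<dots> \<le> e / 4"
      using len[OF p'] \<open>e \<ge> 0\<close> by (intro small_le) auto
    finally have 2: "norm (oint (\<lambda>t. N (fst p, t) ** g (fst p, t) - N (fst p, t) ** h (fst p, t)) v0 (snd p)) \<le> e / 4" .
    have "\<Phi> g p - \<Phi> h p = oint (\<lambda>s. M (s, v0) ** g (s, v0) - M (s, v0) ** h (s, v0)) u0 (fst p)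
        + oint (\<lambda>t. N (fst p, t) ** g (fst p, t) - N (fst p, t) ** h (fst p, t)) v0 (snd p)"
      unfolding \<Phi>_def
      by (simp add: oint_diff[OF base(1) p'(1) sl(1)[OF cM(1) base(2)] sl(1)[OF cM(2) base(2)]]
          oint_diff[OF base(2) p'(2) sl(2)[OF cN(1) p'(1)] sl(2)[OF cN(2) p'(1)]])
    then show "norm (\<Phi> g p - \<Phi> h p) \<le> e / 2"
      using 1 2 by (simp only:) (rule norm_triangle_le, linarith)
  qed (use cont_\<Phi> in auto)
  note cMF = continuous_on_matrix_mult[OF contS(1) F(1)]
  note cNF = continuous_on_matrix_mult[OF contS(3) F(1)]
  have F_v: "((\<lambda>v. F (u, v)) has_vector_derivative N (u, v) ** F (u, v)) (at v within {c..d})"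
    if uv: "u \<in> {a..b}" "v \<in> {c..d}" for u v
  proof -
    have "((\<lambda>v. \<Phi> F (u, v)) has_vector_derivative N (u, v) ** F (u, v)) (at v within {c..d})"
      unfolding \<Phi>_def
      using oint_has_vector_derivative[OF base(2) uv(2) sl(2)[OF cNF uv(1)]]
      by (auto intro!: derivative_eq_intros)
    from has_vector_derivative_transform[OF uv(2) _ this] show ?thesis
      using F(2) uv by (auto simp: S_def)
  qed
  have F00: "F (u0, v0) = F0"
    using F(2)[of "(u0, v0)"] base by (simp add: S_def \<Phi>_def)
  \<comment> \<open>\<open>W\<close> integrates the u-equation away from the line
    \<open>u = u0\<close>, where it agrees with \<open>F\<close>. The u-equation for
    \<open>F\<close> holds once the defect \<open>E = F - W\<close> vanishes.\<close>
  define W where "W p = F (u0, snd p) + oint (\<lambda>s. M (s, snd p) ** F (s, snd p)) u0 (fst p)" for p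
  define E where "E p = F p - W p" for p
  have W_u: "((\<lambda>u. W (u, v)) has_vector_derivative M (u, v) ** F (u, v)) (at u within {a..b})"
    if uv: "u \<in> {a..b}" "v \<in> {c..d}" for u v
    unfolding W_def
    using oint_has_vector_derivative[OF base(1) uv(1) sl(1)[OF cMF uv(2)]]
    by (auto intro!: derivative_eq_intros)
  have W0: "W (u0, v) = F (u0, v)" for v
    by (simp add: W_def)
  have cW: "continuous_on S W"
    unfolding W_def using cont_u[OF cMF] base
    by (auto intro!: continuous_on_add continuous_on_compose2[OF F(1), where f = "\<lambda>p. (u0, snd p)"] continuous_intros
        simp: S_def)
  have cE: "continuous_on S E"
    unfolding E_def by (intro continuous_intros F cW)
  have E_init: "E (u, v0) = 0" if u: "u \<in> {a..b}" for u
    using F(2)[of "(u, v0)"] F(2)[of "(u0, v0)"] base u by (simp add: S_def \<Phi>_def E_def W_def)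
  \<comment> \<open>Here compatibility enters. Since \<open>W_u = M F\<close>, it rewrites the
    integrand \<open>(M F)_v\<close> as \<open>(N W)_u + N' E\<close>. Integration gives W_v as N W
    plus the integral of N' E, so only \<open>E\<close> is left in the equation for E_v.\<close>
  have E_v: "((\<lambda>v. E (u, v)) has_vector_derivative
      N (u, v) ** E (u, v) - oint (\<lambda>s. N' (s, v) ** E (s, v)) u0 u) (at v within {c..d})"
    if uv: "u \<in> {a..b}" "v \<in> {c..d}" for u v
  proof -
    have "((\<lambda>v. oint (\<lambda>s. M (s, v) ** F (s, v)) u0 u) has_vector_derivative
        oint (\<lambda>s. M (s, v) ** (N (s, v) ** F (s, v)) + M' (s, v) ** F (s, v)) u0 u) (at v within {c..d})"
    proof (rule oint_leibniz[OF base(1) uv(1) _ uv(2)])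
      show "((\<lambda>v. M (t, v) ** F (t, v)) has_vector_derivative
          M (t, v) ** (N (t, v) ** F (t, v)) + M' (t, v) ** F (t, v)) (at v within {c..d})"
        if "v \<in> {c..d}" "t \<in> {a..b}" for v t
        using that by (intro has_vector_derivative_matrix_mult dM F_v)
      show "continuous_on {a..b} (\<lambda>s. M (s, v) ** F (s, v))" if "v \<in> {c..d}" for v
        using that by (rule sl(1)[OF cMF])
      have "continuous_on S (\<lambda>p. M p ** (N p ** F p) + M' p ** F p)"
        by (intro continuous_intros contS F)
      then have "continuous_on ({c..d} \<times> {a..b})
          (\<lambda>q. (\<lambda>p. M p ** (N p ** F p) + M' p ** F p) (snd q, fst q))"
        by (rule continuous_on_compose2) (auto simp: S_def intro!: continuous_intros)
      then show "continuous_on ({c..d} \<times> {a..b})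
          (\<lambda>(v, t). M (t, v) ** (N (t, v) ** F (t, v)) + M' (t, v) ** F (t, v))"
        by (simp add: split_beta)
    qed auto
    \<comment> \<open>The sum is written as a difference with a double minus so that
      \<open>oint_diff\<close> applies.\<close>
    moreover have "oint (\<lambda>s. M (s, v) ** (N (s, v) ** F (s, v)) + M' (s, v) ** F (s, v)) u0 u =
        oint (\<lambda>s. (N (s, v) ** (M (s, v) ** F (s, v)) + N' (s, v) ** W (s, v)) - (- (N' (s, v) ** E (s, v)))) u0 u"
    proof (rule oint_cong[OF base(1) uv(1)])
      fix s assume s: "s \<in> {a..b}"
      have "(M' (s, v) + M (s, v) ** N (s, v)) ** F (s, v) = (N' (s, v) + N (s, v) ** M (s, v)) ** F (s, v)"
        using compat s uv by simp
      then show "M (s, v) ** (N (s, v) ** F (s, v)) + M' (s, v) ** F (s, v) =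
          N (s, v) ** (M (s, v) ** F (s, v)) + N' (s, v) ** W (s, v) - (- (N' (s, v) ** E (s, v)))"
        by (simp add: E_def matrix_mult_diff_right bounded_bilinear.add_left[OF bounded_bilinear_matrix_matrix_mult] matrix_mul_assoc add.commute)
    qed
    moreover have "\<dots> = oint (\<lambda>s. N (s, v) ** (M (s, v) ** F (s, v)) + N' (s, v) ** W (s, v)) u0 u
        - oint (\<lambda>s. - (N' (s, v) ** E (s, v))) u0 u"
      by (intro oint_diff[OF base(1) uv(1)] continuous_intros sl(1)[OF _ uv(2)] contS F(1) cW cE)
    moreover have "oint (\<lambda>s. - (N' (s, v) ** E (s, v))) u0 u = - oint (\<lambda>s. N' (s, v) ** E (s, v)) u0 u"
      by (simp add: oint_def)
    moreover have "oint (\<lambda>s. N (s, v) ** (M (s, v) ** F (s, v)) + N' (s, v) ** W (s, v)) u0 u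
        = N (u, v) ** W (u, v) - N (u0, v) ** W (u0, v)"
      using uv by (intro oint_FTC[OF base(1) uv(1)] has_vector_derivative_matrix_mult dN W_u)
    ultimately have "((\<lambda>v. W (u, v)) has_vector_derivative
        N (u0, v) ** F (u0, v) + ((N (u, v) ** W (u, v) - N (u0, v) ** F (u0, v))
          + oint (\<lambda>s. N' (s, v) ** E (s, v)) u0 u)) (at v within {c..d})"
      unfolding W_def fst_conv snd_conv
      using F_v[OF base(1) uv(2)] by (auto intro!: derivative_eq_intros simp: W_def)
    with F_v[OF uv] show ?thesis
      unfolding E_def by (auto intro!: derivative_eq_intros simp: matrix_mult_diff_right)
  qed
  \<comment> \<open>The defect is estimated at a maximum point of its norm: there \<open>E\<close>
    is the integral of its v-derivative from \<open>v0\<close>, where it vanishes, and smallness of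
    the square bounds its norm by half of the maximum.\<close>
  have "compact S" by (simp add: S_cbox)
  moreover have "S \<noteq> {}" using base by (auto simp: S_def)
  ultimately obtain q where q: "q \<in> S" "\<And>p. p \<in> S \<Longrightarrow> norm (E p) \<le> norm (E q)"
    using continuous_attains_sup[of S "\<lambda>p. norm (E p)"] cE continuous_on_norm by blast
  define e where "e = norm (E q)"
  obtain u v where uv: "q = (u, v)" "u \<in> {a..b}" "v \<in> {c..d}" using q(1) by (auto simp: S_def)
  have cE': "continuous_on S (\<lambda>p. oint (\<lambda>s. N' (s, snd p) ** E (s, snd p)) u0 (fst p))"
    by (intro cont_u continuous_intros contS cE)
  have "norm (N (u, t) ** E (u, t) - oint (\<lambda>s. N' (s, t) ** E (s, t)) u0 u) \<le> C * e + \<epsilon> * (C * e)"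
    if t: "t \<in> {c..d}" for t
  proof -
    have "norm (oint (\<lambda>s. N' (s, t) ** E (s, t)) u0 u) \<le> \<bar>u - u0\<bar> * (C * e)"
      using uv t q(2)
      by (intro norm_oint_le[OF base(1) uv(2)] continuous_intros sl(1)[OF _ t] contS cE)
         (auto intro!: bnd simp: S_def e_def)
    also have "\<dots> \<le> \<epsilon> * (C * e)"
      using len[OF uv(2,3)] small by (intro mult_right_mono) (auto simp: e_def)
    finally show ?thesis
      using bnd[of "E (u, t)" e "(u, t)" N] q(2)[of "(u, t)"] uv t
        norm_triangle_ineq4[of "N (u, t) ** E (u, t)" "oint (\<lambda>s. N' (s, t) ** E (s, t)) u0 u"]
      by (auto simp: S_def e_def)
  qed
  then have "norm (oint (\<lambda>t. N (u, t) ** E (u, t) - oint (\<lambda>s. N' (s, t) ** E (s, t)) u0 u) v0 v)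
      \<le> \<bar>v - v0\<bar> * (C * e + \<epsilon> * (C * e))"
    using sl(2)[OF cE' uv(2)]
    by (intro norm_oint_le[OF base(2) uv(3)] continuous_intros sl(2)[OF _ uv(2)] contS cE) auto
  moreover have "oint (\<lambda>t. N (u, t) ** E (u, t) - oint (\<lambda>s. N' (s, t) ** E (s, t)) u0 u) v0 v = E (u, v) - E (u, v0)"
    using uv by (intro oint_FTC[OF base(2) uv(3)] E_v)
  ultimately have "e \<le> \<bar>v - v0\<bar> * (C * e + \<epsilon> * (C * e))"
    using E_init[OF uv(2)] by (simp add: e_def uv)
  \<comment> \<open>\<open>\<epsilon> \<le> 1\<close> absorbs the inner integral into a second
    \<open>C * e\<close>.\<close>
  also have "\<dots> \<le> \<bar>v - v0\<bar> * (C * (2 * e))"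
  proof (rule mult_left_mono)
    have "\<epsilon> * (C * e) \<le> 1 * (C * e)" using small by (intro mult_right_mono) (auto simp: e_def)
    then show "C * e + \<epsilon> * (C * e) \<le> C * (2 * e)" by simp
  qed auto
  also have "\<dots> \<le> (2 * e) / 4"
    using len[OF uv(2,3)] by (intro small_le) (auto simp: e_def)
  finally have "e = 0" using norm_ge_zero[of "E q"] by (simp add: e_def)
  then have FW: "F p = W p" if "p \<in> S" for p
    using q(2)[OF that] by (simp add: e_def E_def)
  have F_u: "((\<lambda>u. F (u, v)) has_vector_derivative M (u, v) ** F (u, v)) (at u within {a..b})"
    if uv: "u \<in> {a..b}" "v \<in> {c..d}" for u v
    using has_vector_derivative_transform[OF uv(1) _ W_u[OF uv], of "\<lambda>u. F (u, v)"] FW uv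
    by (auto simp: S_def)
  show ?thesis
    by (rule that[OF F(1)[unfolded S_def] F00 F_u F_v])
qed

section \<open>Partial derivatives and smooth functions of two variables\<close>

lemma square_in_open:
  fixes D :: "(real \<times> real) set"
  assumes "open D" "(u0, v0) \<in> D" "e > 0"
  obtains r where "0 < r" "r \<le> e" "{u0 - r..u0 + r} \<times> {v0 - r..v0 + r} \<subseteq> D"
proof -
  obtain A B where AB: "open A" "open B" "(u0, v0) \<in> A \<times> B" "A \<times> B \<subseteq> D"
    using open_prod_elim[OF assms(1,2)] by metis
  obtain r1 where r1: "r1 > 0" "cball u0 r1 \<subseteq> A" using AB open_contains_cball by blast
  obtain r2 where r2: "r2 > 0" "cball v0 r2 \<subseteq> B" using AB open_contains_cball by blast
  define r where "r = min e (min r1 r2)"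
  have "{u0 - r..u0 + r} \<subseteq> A" "{v0 - r..v0 + r} \<subseteq> B"
    using r1(2) r2(2) by (auto simp: cball_eq_atLeastAtMost r_def min_def subset_iff split: if_splits)
  then have "{u0 - r..u0 + r} \<times> {v0 - r..v0 + r} \<subseteq> D" using AB(4) by blast
  then show ?thesis
    using that[of r] r1 r2 assms by (simp add: r_def)
qed

lemma has_vector_derivative_slices:
  assumes "g differentiable (at p)"
  shows "((\<lambda>t. g (t, snd p)) has_vector_derivative du g p) (at (fst p))"
    "((\<lambda>t. g (fst p, t)) has_vector_derivative dv g p) (at (snd p))"
proof -
  obtain g' where g': "(g has_derivative g') (at (fst p, snd p))"
    using assms by (auto simp: differentiable_def)
  have "((\<lambda>t. g (t, snd p)) has_derivative (\<lambda>h. g' (h, 0))) (at (fst p))"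
    by (rule has_derivative_compose[where f = "\<lambda>t. (t, snd p)" and f' = "\<lambda>h. (h, 0)", OF _ g'])
       (auto intro!: derivative_eq_intros)
  then show "((\<lambda>t. g (t, snd p)) has_vector_derivative du g p) (at (fst p))"
    unfolding du_def vector_derivative_works[symmetric] by (rule differentiableI)
  have "((\<lambda>t. g (fst p, t)) has_derivative (\<lambda>h. g' (0, h))) (at (snd p))"
    by (rule has_derivative_compose[where f = "\<lambda>t. (fst p, t)" and f' = "\<lambda>h. (0, h)", OF _ g'])
       (auto intro!: derivative_eq_intros)
  then show "((\<lambda>t. g (fst p, t)) has_vector_derivative dv g p) (at (snd p))"
    unfolding dv_def vector_derivative_works[symmetric] by (rule differentiableI)
qed

lemma du_eqI: "((\<lambda>t. g (t, snd p)) has_vector_derivative d) (at (fst p)) \<Longrightarrow> du g p = d"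
  unfolding du_def by (rule vector_derivative_at)

lemma dv_eqI: "((\<lambda>t. g (fst p, t)) has_vector_derivative d) (at (snd p)) \<Longrightarrow> dv g p = d"
  unfolding dv_def by (rule vector_derivative_at)

lemma eventually_slices:
  fixes p :: "'a::topological_space \<times> 'b::topological_space"
  assumes "open D" "p \<in> D"
  shows "\<forall>\<^sub>F t in nhds (fst p). (t, snd p) \<in> D" "\<forall>\<^sub>F t in nhds (snd p). (fst p, t) \<in> D"
proof -
  obtain A B where AB: "open A" "open B" "p \<in> A \<times> B" "A \<times> B \<subseteq> D"
    using open_prod_elim[OF assms] by metis
  show "\<forall>\<^sub>F t in nhds (fst p). (t, snd p) \<in> D"
    unfolding eventually_nhds using AB by (intro exI[of _ A]) auto
  show "\<forall>\<^sub>F t in nhds (snd p). (fst p, t) \<in> D"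
    unfolding eventually_nhds using AB by (intro exI[of _ B]) auto
qed

lemma du_dv_cong:
  assumes "open D" "p \<in> D" "\<And>q. q \<in> D \<Longrightarrow> g q = h q"
  shows "du g p = du h p" "dv g p = dv h p"
proof -
  show "du g p = du h p"
    unfolding du_def
    by (intro vector_derivative_cong_eq eventually_mono[OF eventually_slices(1)[OF assms(1,2)]])
       (auto simp: assms)
  show "dv g p = dv h p"
    unfolding dv_def
    by (intro vector_derivative_cong_eq eventually_mono[OF eventually_slices(2)[OF assms(1,2)]])
       (auto simp: assms)
qed

text \<open>Bridge from partial derivatives to the total differentiability demanded by
  \<open>Ck_on (Suc k)\<close>; it also supplies the chain rule along segments for the Gronwall
  argument.\<close>

lemma has_derivative_of_continuous_partials:
  fixes g :: "real \<times> real \<Rightarrow> 'a::real_normed_vector"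
  assumes D: "open D" "p \<in> D"
    and u: "\<And>q. q \<in> D \<Longrightarrow> ((\<lambda>t. g (t, snd q)) has_vector_derivative gu q) (at (fst q))"
    and v: "\<And>q. q \<in> D \<Longrightarrow> ((\<lambda>t. g (fst q, t)) has_vector_derivative gv q) (at (snd q))"
    and c: "continuous_on D gv"
  shows "(g has_derivative (\<lambda>h. fst h *\<^sub>R gu p + snd h *\<^sub>R gv p)) (at p)"
proof -
  obtain r where r: "0 < r" "{fst p - r..fst p + r} \<times> {snd p - r..snd p + r} \<subseteq> D"
    by (rule square_in_open[OF D(1), of "fst p" "snd p" 1]) (use D(2) in auto)
  define X where "X = {fst p - r<..<fst p + r}"
  define Y where "Y = {snd p - r<..<snd p + r}"
  have XY: "open X" "open Y" "convex Y" "fst p \<in> X" "snd p \<in> Y" "X \<times> Y \<subseteq> D"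
    using r by (auto simp: X_def Y_def)
  \<comment> \<open>The vector \<open>gv q\<close> is recast as the linear map that scales it,
    because \<open>has_derivative_partialsI\<close> expects an operator-valued partial
    derivative.\<close>
  define B :: "'a \<Rightarrow> real \<Rightarrow>\<^sub>L 'a" where "B = blinfun_scaleR_left"
  have B: "blinfun_apply (B x) = (\<lambda>h. h *\<^sub>R x)" for x
    by (simp add: B_def blinfun_scaleR_left.rep_eq fun_eq_iff)
  have "((\<lambda>(x, y). g (x, y)) has_derivative (\<lambda>(tx, ty). tx *\<^sub>R gu p + blinfun_apply (B (gv (fst p, snd p))) ty))
      (at (fst p, snd p) within X \<times> Y)"
  proof (rule has_derivative_partialsI[where fy = "\<lambda>x y. B (gv (x, y))"])
    show "((\<lambda>x. g (x, snd p)) has_derivative (\<lambda>tx. tx *\<^sub>R gu p)) (at (fst p) within X)"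
      using u[OF D(2)] by (auto simp: has_vector_derivative_def intro: has_derivative_at_withinI)
    show "((\<lambda>y. g (x, y)) has_derivative blinfun_apply (B (gv (x, y)))) (at y within Y)"
      if "x \<in> X" "y \<in> Y" for x y
      using v[of "(x, y)"] that XY(6) unfolding B
      by (auto simp: has_vector_derivative_def intro: has_derivative_at_withinI)
    have "continuous_on (X \<times> Y) (\<lambda>p. B (gv p))"
      unfolding B_def by (intro continuous_intros continuous_on_subset[OF c XY(6)])
    then show "continuous (at (fst p, snd p) within X \<times> Y) (\<lambda>(x, y). B (gv (x, y)))"
      using XY(4,5) unfolding continuous_on_eq_continuous_within by (cases p) (auto simp: case_prod_unfold)
  qed (use XY in auto)
  moreover have "at (fst p, snd p) within X \<times> Y = at p"
    using XY at_within_open[OF _ open_Times[OF XY(1,2)], of p] by (simp add: mem_Times_iff)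
  ultimately show ?thesis
    by (simp add: case_prod_unfold B)
qed

section \<open>Closure properties of the classes \<open>Ck_on\<close> and
  \<open>Cinf_on\<close>\<close>

lemma Ck_on_SucD: "Ck_on (Suc k) D g \<Longrightarrow> Ck_on k D g"
proof (induction k arbitrary: g)
  case (Suc k)
  then show ?case using Ck_on.simps(2)[of "Suc k"] Ck_on.simps(2)[of k] by metis
qed (simp add: differentiable_imp_continuous_on)

lemma Ck_on_continuous: "Ck_on k D g \<Longrightarrow> continuous_on D g"
  by (cases k) (simp_all add: differentiable_imp_continuous_on)

text \<open>\<open>du\<close> and \<open>dv\<close> do not refer to the domain, so they are
  literally the same functions on the smaller set.\<close>

lemma Ck_on_subset: "Ck_on k D g \<Longrightarrow> D' \<subseteq> D \<Longrightarrow> Ck_on k D' g"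
  by (induction k arbitrary: g) (simp_all add: continuous_on_subset differentiable_on_subset[of _ D D'])

lemma Ck_on_cong:
  assumes "open D" "\<And>q. q \<in> D \<Longrightarrow> g q = h q" "Ck_on k D g"
  shows "Ck_on k D h"
  using assms(2,3)
proof (induction k arbitrary: g h)
  case 0
  then show ?case by (simp cong: continuous_on_cong)
next
  case (Suc k)
  have "h differentiable_on D"
    using Suc.prems by (auto simp: differentiable_on_def intro: differentiable_transform_within[where d = 1])
  moreover have "du g q = du h q" "dv g q = dv h q" if "q \<in> D" for q
    by (rule du_dv_cong[OF assms(1) that Suc.prems(1)]; simp)+
  ultimately show ?case
    using Suc.prems Suc.IH[of "du g" "du h"] Suc.IH[of "dv g" "dv h"] by auto
qed

lemma Ck_on_SucE:
  assumes "open D" "Ck_on (Suc k) D g" "p \<in> D"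
  shows "((\<lambda>t. g (t, snd p)) has_vector_derivative du g p) (at (fst p))"
    "((\<lambda>t. g (fst p, t)) has_vector_derivative dv g p) (at (snd p))"
  using has_vector_derivative_slices[of g p] assms by (simp_all add: differentiable_on_eq_differentiable_at)

text \<open>Replaces \<open>du\<close> and \<open>dv\<close> by explicit formulas valid on
  \<open>D\<close>. The closure properties below share one pattern: name the partial derivatives by
  a differentiation rule and apply the induction hypothesis to them.\<close>

lemma Ck_on_SucI:
  assumes "open D"
    and "\<And>p. p \<in> D \<Longrightarrow> ((\<lambda>t. g (t, snd p)) has_vector_derivative gu p) (at (fst p))"
    and "\<And>p. p \<in> D \<Longrightarrow> ((\<lambda>t. g (fst p, t)) has_vector_derivative gv p) (at (snd p))"
    and "Ck_on k D gu" "Ck_on k D gv"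
  shows "Ck_on (Suc k) D g"
proof -
  have "g differentiable_on D"
    using has_derivative_of_continuous_partials[OF assms(1) _ assms(2,3) Ck_on_continuous[OF assms(5)]]
    by (auto simp: differentiable_on_eq_differentiable_at[OF assms(1)] differentiable_def)
  moreover have "gu p = du g p" "gv p = dv g p" if "p \<in> D" for p
    using assms(2,3)[OF that] by (auto dest: du_eqI dv_eqI)
  ultimately show ?thesis
    using Ck_on_cong[OF assms(1) _ assms(4), of "du g"] Ck_on_cong[OF assms(1) _ assms(5), of "dv g"]
    by simp
qed

lemma Ck_on_const: "open D \<Longrightarrow> Ck_on k D (\<lambda>_. c)"
proof (induction k arbitrary: c)
  case (Suc k)
  show ?case
    by (rule Ck_on_SucI[where gu = "\<lambda>_. 0" and gv = "\<lambda>_. 0"]) (use Suc in auto)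
qed simp

lemma Ck_on_bounded_linear:
  assumes "bounded_linear L" "open D" "Ck_on k D g"
  shows "Ck_on k D (\<lambda>p. L (g p))"
  using assms(3)
proof (induction k arbitrary: g)
  case 0
  then show ?case using assms(1) by (simp add: bounded_linear.continuous_on)
next
  case (Suc k)
  show ?case
    using Suc by (intro Ck_on_SucI[where gu = "\<lambda>p. L (du g p)" and gv = "\<lambda>p. L (dv g p)"] assms(2)
       bounded_linear.has_vector_derivative[OF assms(1)] Ck_on_SucE[OF assms(2) Suc.prems]) auto
qed

lemma Ck_on_add:
  assumes "open D" "Ck_on k D g" "Ck_on k D h"
  shows "Ck_on k D (\<lambda>p. g p + h p)"
  using assms(2,3)
proof (induction k arbitrary: g h)
  case 0
  then show ?case by (simp add: continuous_on_add)
next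
  case (Suc k)
  show ?case
    using Suc by (intro Ck_on_SucI[where gu = "\<lambda>p. du g p + du h p" and gv = "\<lambda>p. dv g p + dv h p"] assms(1)
       has_vector_derivative_add Ck_on_SucE[OF assms(1) Suc.prems(1)] Ck_on_SucE[OF assms(1) Suc.prems(2)]) auto
qed

lemma Ck_on_bounded_bilinear:
  assumes "bounded_bilinear B" "open D" "Ck_on k D g" "Ck_on k D h"
  shows "Ck_on k D (\<lambda>p. B (g p) (h p))"
  using assms(3,4)
proof (induction k arbitrary: g h)
  case 0
  then show ?case using assms(1) by (simp add: bounded_bilinear.continuous_on)
next
  case (Suc k)
  have "Ck_on k D g" "Ck_on k D h" using Suc.prems by (auto dest: Ck_on_SucD simp del: Ck_on.simps)
  with Suc have "Ck_on k D (\<lambda>p. B (g p) (du h p) + B (du g p) (h p))"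
    "Ck_on k D (\<lambda>p. B (g p) (dv h p) + B (dv g p) (h p))"
    by (auto intro!: Ck_on_add assms(2))
  then show ?case
    using bounded_bilinear.has_vector_derivative[OF assms(1)
        Ck_on_SucE(1)[OF assms(2) Suc.prems(1)] Ck_on_SucE(1)[OF assms(2) Suc.prems(2)]]
      bounded_bilinear.has_vector_derivative[OF assms(1)
        Ck_on_SucE(2)[OF assms(2) Suc.prems(1)] Ck_on_SucE(2)[OF assms(2) Suc.prems(2)]]
    by (intro Ck_on_SucI[where gu = "\<lambda>p. B (g p) (du h p) + B (du g p) (h p)"
          and gv = "\<lambda>p. B (g p) (dv h p) + B (dv g p) (h p)", OF assms(2)]) simp_all
qed

lemmas Ck_on_scaleR = Ck_on_bounded_bilinear[OF bounded_bilinear_scaleR]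

lemma Ck_on_mult:
  fixes g h :: "real \<times> real \<Rightarrow> real"
  shows "open D \<Longrightarrow> Ck_on k D g \<Longrightarrow> Ck_on k D h \<Longrightarrow> Ck_on k D (\<lambda>p. g p * h p)"
  by (rule Ck_on_bounded_bilinear[OF bounded_bilinear_mult])

lemma Ck_on_inverse:
  fixes g :: "real \<times> real \<Rightarrow> real"
  assumes "open D" "Ck_on k D g" "\<And>p. p \<in> D \<Longrightarrow> g p \<noteq> 0"
  shows "Ck_on k D (\<lambda>p. inverse (g p))"
  using assms(2)
proof (induction k)
  case 0
  then show ?case using assms by (simp add: continuous_on_inverse)
next
  case (Suc k)
  have inv: "Ck_on k D (\<lambda>p. inverse (g p))"
    using Suc by (auto dest: Ck_on_SucD simp del: Ck_on.simps)
  \<comment> \<open>The derivative of 1/g is a product in which 1/g occurs undifferentiated, so its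
    regularity at level \<open>k\<close> is enough for level \<open>Suc k\<close>.\<close>
  have "Ck_on k D (\<lambda>p. (-1) * (inverse (g p) * h p * inverse (g p)))" if "Ck_on k D h" for h
    by (intro Ck_on_mult Ck_on_const assms(1) inv that)
  moreover have *: "((\<lambda>t. inverse (\<phi> t)) has_vector_derivative (-1) * (inverse (\<phi> t) * d * inverse (\<phi> t))) (at t)"
    if "(\<phi> has_vector_derivative d) (at t)" "\<phi> t \<noteq> 0" for \<phi> :: "real \<Rightarrow> real" and d t
    using DERIV_inverse_fun[of \<phi> d t UNIV] that
    by (simp add: power2_eq_square mult_ac flip: has_real_derivative_iff_has_vector_derivative)
  ultimately have "Ck_on k D (\<lambda>p. (-1) * (inverse (g p) * du g p * inverse (g p)))"
    "Ck_on k D (\<lambda>p. (-1) * (inverse (g p) * dv g p * inverse (g p)))"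
    using Suc.prems by auto
  then show ?case
    using *[OF Ck_on_SucE(1)[OF assms(1) Suc.prems]] *[OF Ck_on_SucE(2)[OF assms(1) Suc.prems]] assms(3)
    by (intro Ck_on_SucI[where gu = "\<lambda>p. (-1) * (inverse (g p) * du g p * inverse (g p))"
          and gv = "\<lambda>p. (-1) * (inverse (g p) * dv g p * inverse (g p))", OF assms(1)]) auto
qed

lemma Cinf_on_imp_Ck_on: "Cinf_on D g \<Longrightarrow> Ck_on k D g"
  by (simp add: Cinf_on_def)

lemma Cinf_on_continuous: "Cinf_on D g \<Longrightarrow> continuous_on D g"
  by (rule Ck_on_continuous[OF Cinf_on_imp_Ck_on[where k = 0]])

lemma Cinf_on_subset: "Cinf_on D g \<Longrightarrow> D' \<subseteq> D \<Longrightarrow> Cinf_on D' g"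
  unfolding Cinf_on_def using Ck_on_subset[of _ D g D'] by metis

lemma Cinf_on_cong: "open D \<Longrightarrow> (\<And>q. q \<in> D \<Longrightarrow> g q = h q) \<Longrightarrow> Cinf_on D g \<Longrightarrow> Cinf_on D h"
  unfolding Cinf_on_def by (intro allI, rule Ck_on_cong[of D g h]) auto

lemma Cinf_on_partials:
  assumes "open D" "Cinf_on D g" "p \<in> D"
  shows "((\<lambda>t. g (t, snd p)) has_vector_derivative du g p) (at (fst p))"
    "((\<lambda>t. g (fst p, t)) has_vector_derivative dv g p) (at (snd p))"
  using Ck_on_SucE[OF assms(1) Cinf_on_imp_Ck_on[OF assms(2)] assms(3)] by auto

lemma Cinf_on_I:
  assumes "open D"
    and "\<And>p. p \<in> D \<Longrightarrow> ((\<lambda>t. g (t, snd p)) has_vector_derivative gu p) (at (fst p))"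
    and "\<And>p. p \<in> D \<Longrightarrow> ((\<lambda>t. g (fst p, t)) has_vector_derivative gv p) (at (snd p))"
    and "Cinf_on D gu" "Cinf_on D gv"
  shows "Cinf_on D g"
proof -
  have "Ck_on (Suc k) D g" for k
    using assms by (intro Ck_on_SucI[OF assms(1-3)]) (auto simp: Cinf_on_def)
  then show ?thesis
    unfolding Cinf_on_def by (blast intro: Ck_on_SucD)
qed

named_theorems smooth_intros

lemma Cinf_on_bounded_linear:
  "bounded_linear L \<Longrightarrow> open D \<Longrightarrow> Cinf_on D g \<Longrightarrow> Cinf_on D (\<lambda>p. L (g p))"
  by (simp add: Cinf_on_def Ck_on_bounded_linear)

lemma Cinf_on_du [smooth_intros]: "Cinf_on D g \<Longrightarrow> Cinf_on D (du g)"
  and Cinf_on_dv [smooth_intros]: "Cinf_on D g \<Longrightarrow> Cinf_on D (dv g)"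
  using Ck_on.simps(2)[of _ D g] by (simp_all add: Cinf_on_def)

lemma Cinf_on_const [smooth_intros]: "open D \<Longrightarrow> Cinf_on D (\<lambda>_. c)"
  by (simp add: Cinf_on_def Ck_on_const)

lemma Cinf_on_add [smooth_intros]:
  "open D \<Longrightarrow> Cinf_on D g \<Longrightarrow> Cinf_on D h \<Longrightarrow> Cinf_on D (\<lambda>p. g p + h p)"
  by (simp add: Cinf_on_def Ck_on_add)

lemma Cinf_on_minus [smooth_intros]:
  "open D \<Longrightarrow> Cinf_on D g \<Longrightarrow> Cinf_on D (\<lambda>p. - g p)"
  by (simp add: Cinf_on_def Ck_on_bounded_linear[OF bounded_linear_minus[OF bounded_linear_ident]])

lemma Cinf_on_scaleR [smooth_intros]:
  "open D \<Longrightarrow> Cinf_on D g \<Longrightarrow> Cinf_on D h \<Longrightarrow> Cinf_on D (\<lambda>p. g p *\<^sub>R h p)"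
  by (simp add: Cinf_on_def Ck_on_scaleR)

lemma Cinf_on_mult [smooth_intros]:
  fixes g h :: "real \<times> real \<Rightarrow> real"
  shows "open D \<Longrightarrow> Cinf_on D g \<Longrightarrow> Cinf_on D h \<Longrightarrow> Cinf_on D (\<lambda>p. g p * h p)"
  by (simp add: Cinf_on_def Ck_on_mult)

lemma Cinf_on_divide [smooth_intros]:
  fixes g h :: "real \<times> real \<Rightarrow> real"
  shows "open D \<Longrightarrow> Cinf_on D g \<Longrightarrow> Cinf_on D h \<Longrightarrow> (\<And>p. p \<in> D \<Longrightarrow> h p \<noteq> 0) \<Longrightarrow>
    Cinf_on D (\<lambda>p. g p / h p)"
  unfolding divide_inverse by (simp add: Cinf_on_def Ck_on_mult Ck_on_inverse)

text \<open>Symmetry of mixed partials by integration: write g as an integral of its u-derivative,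
  differentiate under the integral sign in v, then remove the integral by differentiating in
  u.\<close>

lemma dv_du_commute:
  fixes g :: "real \<times> real \<Rightarrow> 'a::banach"
  assumes D: "open D" and g: "Cinf_on D g" and p: "p \<in> D"
  shows "dv (du g) p = du (dv g) p"
proof -
  obtain u v where uv: "p = (u, v)" by (cases p)
  obtain r where r: "0 < r" "{u - r..u + r} \<times> {v - r..v + r} \<subseteq> D"
    by (rule square_in_open[OF D, of u v 1]) (use p uv in auto)
  define I where "I = {u - r..u + r}"
  define J where "J = {v - r..v + r}"
  have IJ: "u \<in> I" "v \<in> J" "u \<in> interior I" "v \<in> interior J" "I \<times> J \<subseteq> D" "convex J"
    using r by (auto simp: I_def J_def interior_atLeastAtMost_real)
  have sm: "Cinf_on D (du g)" "Cinf_on D (dv g)" "Cinf_on D (dv (du g))"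
    by (intro smooth_intros g)+
  note sl = continuous_on_slices[OF continuous_on_subset[OF Cinf_on_continuous IJ(5)]]
  have "oint (\<lambda>s. du g (s, y)) u x = g (x, y) - g (u, y)" if "x \<in> I" "y \<in> J" for x y
  proof (rule oint_FTC[of u "u - r" "u + r", folded I_def])
    show "((\<lambda>s. g (s, y)) has_vector_derivative du g (t, y)) (at t within I)" if "t \<in> I" for t
      using Cinf_on_partials(1)[OF D g, of "(t, y)"] that \<open>y \<in> J\<close> IJ(5)
      by (auto intro: has_vector_derivative_at_within)
  qed (use IJ that in auto)
  then have eq: "g (x, y) = g (u, y) + oint (\<lambda>s. du g (s, y)) u x" if "x \<in> I" "y \<in> J" for x y
    using that by simp
  have v_at: "at y within J = at y" if "y \<in> interior J" for y
    using that by (rule at_within_interior)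
  have dv_eq: "dv g (x, v) = dv g (u, v) + oint (\<lambda>s. dv (du g) (s, v)) u x" if x: "x \<in> I" for x
  proof -
    have "((\<lambda>y. oint (\<lambda>s. du g (s, y)) u x) has_vector_derivative oint (\<lambda>s. dv (du g) (s, v)) u x)
        (at v within J)"
    proof (rule oint_leibniz[of u "u - r" "u + r", folded I_def])
      show "((\<lambda>y. du g (t, y)) has_vector_derivative dv (du g) (t, y)) (at y within J)"
        if "y \<in> J" "t \<in> I" for y t
        using Cinf_on_partials(2)[OF D sm(1), of "(t, y)"] that IJ
        by (auto intro: has_vector_derivative_at_within)
      have "continuous_on (J \<times> I) (\<lambda>q. dv (du g) (snd q, fst q))"
        by (rule continuous_on_compose2[OF Cinf_on_continuous[OF sm(3)]])
           (use IJ in \<open>auto intro!: continuous_intros\<close>)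
      then show "continuous_on (J \<times> I) (\<lambda>(y, t). dv (du g) (t, y))"
        by (simp add: split_beta)
    qed (use IJ x sl(1)[OF sm(1)] in auto)
    then have "((\<lambda>y. g (u, y) + oint (\<lambda>s. du g (s, y)) u x) has_vector_derivative
        dv g (u, v) + oint (\<lambda>s. dv (du g) (s, v)) u x) (at v within J)"
      using Cinf_on_partials(2)[OF D g, of "(u, v)"] p uv
      by (auto intro!: derivative_eq_intros intro: has_vector_derivative_at_within)
    from has_vector_derivative_transform[OF IJ(2) _ this, of "\<lambda>y. g (x, y)"] eq[OF x]
    have "((\<lambda>y. g (x, y)) has_vector_derivative
        dv g (u, v) + oint (\<lambda>s. dv (du g) (s, v)) u x) (at v within J)" by simp
    then show ?thesis
      by (intro dv_eqI) (simp add: v_at IJ)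
  qed
  have "((\<lambda>x. dv g (u, v) + oint (\<lambda>s. dv (du g) (s, v)) u x) has_vector_derivative dv (du g) (u, v))
      (at u within I)"
    using oint_has_vector_derivative[of u "u - r" "u + r" u "\<lambda>s. dv (du g) (s, v)"] sl(1)[OF sm(3) IJ(2)] IJ
    by (auto simp: I_def intro!: derivative_eq_intros)
  from has_vector_derivative_transform[OF IJ(1) _ this, of "\<lambda>x. dv g (x, v)"] dv_eq
  have "((\<lambda>x. dv g (x, v)) has_vector_derivative dv (du g) (u, v)) (at u within I)"
    by simp
  then show ?thesis
    by (intro du_eqI[symmetric]) (simp add: uv at_within_interior[OF IJ(3)])
qed

section \<open>Potentials, a Gronwall estimate and the local theory of total systems\<close>

text \<open>Poincare lemma on a rectangle. Closedness is encoded by a common continuous derivative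
  \<open>R\<close> of both coefficients, which is the mixed derivative of the potential.\<close>

lemma potential_on_rectangle:
  fixes P Q R :: "real \<times> real \<Rightarrow> 'a::banach"
  assumes base: "u0 \<in> {a..b}" "v0 \<in> {c..d}"
    and cont: "continuous_on ({a..b} \<times> {c..d}) P" "continuous_on ({a..b} \<times> {c..d}) Q"
      "continuous_on ({a..b} \<times> {c..d}) R"
    and dP: "\<And>u v. u \<in> {a..b} \<Longrightarrow> v \<in> {c..d} \<Longrightarrow>
      ((\<lambda>v. P (u, v)) has_vector_derivative R (u, v)) (at v within {c..d})"
    and dQ: "\<And>u v. u \<in> {a..b} \<Longrightarrow> v \<in> {c..d} \<Longrightarrow>
      ((\<lambda>u. Q (u, v)) has_vector_derivative R (u, v)) (at u within {a..b})"
  obtains z where "z (u0, v0) = z0"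
    "\<And>u v. u \<in> {a..b} \<Longrightarrow> v \<in> {c..d} \<Longrightarrow>
      ((\<lambda>u. z (u, v)) has_vector_derivative P (u, v)) (at u within {a..b})"
    "\<And>u v. u \<in> {a..b} \<Longrightarrow> v \<in> {c..d} \<Longrightarrow>
      ((\<lambda>v. z (u, v)) has_vector_derivative Q (u, v)) (at v within {c..d})"
proof -
  define z where "z p = z0 + oint (\<lambda>s. P (s, v0)) u0 (fst p) + oint (\<lambda>t. Q (fst p, t)) v0 (snd p)" for p
  note sl = continuous_on_slices[where I = "{a..b}" and J = "{c..d}"]
  have "((\<lambda>v. z (u, v)) has_vector_derivative Q (u, v)) (at v within {c..d})"
    if uv: "u \<in> {a..b}" "v \<in> {c..d}" for u v
    unfolding z_def using oint_has_vector_derivative[OF base(2) uv(2) sl(2)[OF cont(2) uv(1)]]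
    by (auto intro!: derivative_eq_intros)
  moreover have "((\<lambda>u. z (u, v)) has_vector_derivative P (u, v)) (at u within {a..b})"
    if uv: "u \<in> {a..b}" "v \<in> {c..d}" for u v
  proof -
    have "((\<lambda>u. oint (\<lambda>t. Q (u, t)) v0 v) has_vector_derivative oint (\<lambda>t. R (u, t)) v0 v) (at u within {a..b})"
      using cont(3) by (intro oint_leibniz[OF base(2) uv(2) _ uv(1)] dQ sl(2)[OF cont(2)]) auto
    \<comment> \<open>Closedness turns the u-derivative of the vertical integral into
      \<open>P (u, v) - P (u, v0)\<close>, which completes the contribution \<open>P (u, v0)\<close>
      of the horizontal one.\<close>
    moreover have "oint (\<lambda>t. R (u, t)) v0 v = P (u, v) - P (u, v0)"
      using uv by (intro oint_FTC[OF base(2) uv(2)] dP)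
    ultimately show ?thesis
      unfolding z_def using oint_has_vector_derivative[OF base(1) uv(1) sl(1)[OF cont(1) base(2)]]
      by (auto intro!: derivative_eq_intros)
  qed
  moreover have "z (u0, v0) = z0" by (simp add: z_def)
  ultimately show ?thesis using that[of z] by auto
qed

text \<open>Gronwall along the segment from \<open>q0\<close> to \<open>p\<close>: the function
  |g|^2 exp(-2Ct) starts at 0 and cannot increase. The inner product makes |g|^2 differentiable also
  where g vanishes.\<close>

lemma vanishing_of_linear_bound:
  fixes g :: "real \<times> real \<Rightarrow> 'a::real_inner"
  assumes D: "open D" "convex D" "q0 \<in> D" "g q0 = 0"
    and u: "\<And>q. q \<in> D \<Longrightarrow> ((\<lambda>t. g (t, snd q)) has_vector_derivative gu q) (at (fst q))"
    and v: "\<And>q. q \<in> D \<Longrightarrow> ((\<lambda>t. g (fst q, t)) has_vector_derivative gv q) (at (snd q))"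
    and cv: "continuous_on D gv" and cc: "continuous_on D \<gamma>"
    and bu: "\<And>q. q \<in> D \<Longrightarrow> norm (gu q) \<le> \<gamma> q * norm (g q)"
    and bv: "\<And>q. q \<in> D \<Longrightarrow> norm (gv q) \<le> \<gamma> q * norm (g q)"
    and p: "p \<in> D"
  shows "g p = 0"
proof -
  define h where "h = p - q0"
  define l where "l t = q0 + t *\<^sub>R h" for t :: real
  have lD: "l t \<in> D" if "t \<in> {0..1}" for t
    using convexD[OF D(2,3) p, of "1 - t" t] that by (simp add: l_def h_def algebra_simps)
  define g' where "g' q = fst h *\<^sub>R gu q + snd h *\<^sub>R gv q" for q
  have gl: "((\<lambda>t. g (l t)) has_vector_derivative g' (l t)) (at t)" if "t \<in> {0..1}" for t
  proof -
    have "(l has_derivative (\<lambda>s. s *\<^sub>R h)) (at t)"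
      unfolding l_def by (auto intro!: derivative_eq_intros)
    from has_derivative_compose[OF this has_derivative_of_continuous_partials[OF D(1) lD[OF that] u v cv]]
    show ?thesis by (simp add: has_vector_derivative_def g'_def algebra_simps)
  qed
  have cl: "continuous_on {0..1} (\<lambda>t. \<gamma> (l t))"
    by (rule continuous_on_compose2[OF cc]) (auto simp: l_def intro!: continuous_intros lD[unfolded l_def])
  \<comment> \<open>On the open set \<open>D\<close> the continuous function \<open>\<gamma>\<close>
    may be unbounded; on the compact segment it is bounded.\<close>
  obtain K where K: "\<And>t. t \<in> {0..1} \<Longrightarrow> \<bar>\<gamma> (l t)\<bar> \<le> K"
    using compact_imp_bounded[OF compact_continuous_image[OF cl]] unfolding bounded_iff
    by (auto simp del: atLeastAtMost_iff)
  define C where "C = (\<bar>fst h\<bar> + \<bar>snd h\<bar>) * K"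
  have g'_le: "norm (g' (l t)) \<le> C * norm (g (l t))" if "t \<in> {0..1}" for t
  proof -
    have *: "\<gamma> (l t) * norm (g (l t)) \<le> K * norm (g (l t))"
      using K[OF that] by (intro mult_right_mono) auto
    have "norm (g' (l t)) \<le> \<bar>fst h\<bar> * norm (gu (l t)) + \<bar>snd h\<bar> * norm (gv (l t))"
      unfolding g'_def using norm_triangle_ineq[of "fst h *\<^sub>R gu (l t)" "snd h *\<^sub>R gv (l t)"] by simp
    also have "\<dots> \<le> \<bar>fst h\<bar> * (K * norm (g (l t))) + \<bar>snd h\<bar> * (K * norm (g (l t)))"
      using bu[OF lD[OF that]] bv[OF lD[OF that]] *
      by (intro add_mono mult_left_mono) auto
    finally show ?thesis by (simp add: C_def algebra_simps)
  qed
  define \<phi> where "\<phi> t = (g (l t) \<bullet> g (l t)) * exp (- (2 * C * t))" for t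
  have "\<phi> 1 \<le> \<phi> 0"
  proof (rule DERIV_nonpos_imp_nonincreasing[of 0 1 \<phi>])
    fix t :: real assume t: "0 \<le> t" "t \<le> 1"
    then have t': "t \<in> {0..1}" by simp
    have "((\<lambda>t. g (l t)) has_derivative (\<lambda>s. s *\<^sub>R g' (l t))) (at t)"
      using gl[OF t'] by (simp add: has_vector_derivative_def)
    from has_derivative_inner[OF this this]
    have "((\<lambda>t. g (l t) \<bullet> g (l t)) has_field_derivative 2 * (g (l t) \<bullet> g' (l t))) (at t)"
      unfolding has_field_derivative_def by (rule has_derivative_eq_rhs) (simp add: fun_eq_iff inner_commute)
    then have "(\<phi> has_field_derivative
        2 * (g (l t) \<bullet> g' (l t)) * exp (- (2 * C * t)) - 2 * C * exp (- (2 * C * t)) * (g (l t) \<bullet> g (l t))) (at t)"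
      unfolding \<phi>_def by (auto intro!: derivative_eq_intros)
    moreover have "g (l t) \<bullet> g' (l t) \<le> C * (g (l t) \<bullet> g (l t))"
    proof -
      have "g (l t) \<bullet> g' (l t) \<le> norm (g (l t)) * norm (g' (l t))" by (rule norm_cauchy_schwarz)
      also have "\<dots> \<le> norm (g (l t)) * (C * norm (g (l t)))"
        using g'_le[OF t'] by (intro mult_left_mono) auto
      finally show ?thesis by (simp add: dot_square_norm power2_eq_square algebra_simps)
    qed
    then have "(g (l t) \<bullet> g' (l t)) * exp (- (2 * C * t)) \<le> C * (g (l t) \<bullet> g (l t)) * exp (- (2 * C * t))"
      by (intro mult_right_mono) auto
    ultimately show "\<exists>y. (\<phi> has_real_derivative y) (at t) \<and> y \<le> 0"
      by (intro exI conjI) (assumption, simp add: algebra_simps)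
  qed simp
  then have "(g (l 1) \<bullet> g (l 1)) * exp (- (2 * C)) \<le> 0"
    using D(4) by (simp add: \<phi>_def l_def)
  then have "g (l 1) \<bullet> g (l 1) \<le> 0"
    by (simp add: mult_le_0_iff)
  then have "g (l 1) = 0" by (metis inner_gt_zero_iff linorder_not_less)
  then show ?thesis by (simp add: l_def h_def)
qed

lemma linear_total_system_local:
  fixes M N :: "real \<times> real \<Rightarrow> real^'n^'n" and F0 :: "real^'m^'n"
  assumes D: "open D" "(u0, v0) \<in> D" and sm: "Cinf_on D M" "Cinf_on D N"
    and compat: "\<And>p. p \<in> D \<Longrightarrow> dv M p + M p ** N p = du N p + N p ** M p"
  obtains r F where "0 < r" "{u0 - r..u0 + r} \<times> {v0 - r..v0 + r} \<subseteq> D"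
    "continuous_on ({u0 - r..u0 + r} \<times> {v0 - r..v0 + r}) F" "F (u0, v0) = F0"
    "\<And>u v. u \<in> {u0 - r..u0 + r} \<Longrightarrow> v \<in> {v0 - r..v0 + r} \<Longrightarrow>
      ((\<lambda>u. F (u, v)) has_vector_derivative M (u, v) ** F (u, v)) (at u within {u0 - r..u0 + r})"
    "\<And>u v. u \<in> {u0 - r..u0 + r} \<Longrightarrow> v \<in> {v0 - r..v0 + r} \<Longrightarrow>
      ((\<lambda>v. F (u, v)) has_vector_derivative N (u, v) ** F (u, v)) (at v within {v0 - r..v0 + r})"
proof -
  obtain R where R: "0 < R" "{u0 - R..u0 + R} \<times> {v0 - R..v0 + R} \<subseteq> D"
    by (rule square_in_open[OF D, of 1]) auto
  define S where "S = {u0 - R..u0 + R} \<times> {v0 - R..v0 + R}"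
  have "compact S" unfolding S_def by (intro compact_Times compact_Icc)
  have "\<exists>B. \<forall>p\<in>S. norm (g p) \<le> B" if "Cinf_on D g" for g :: "real \<times> real \<Rightarrow> real^'n^'n"
    using compact_imp_bounded[OF compact_continuous_image[OF
        continuous_on_subset[OF Cinf_on_continuous[OF that]] \<open>compact S\<close>]] R(2)
    by (auto simp: bounded_iff S_def)
  then obtain B1 B2 B3 where B: "\<And>p. p \<in> S \<Longrightarrow> norm (M p) \<le> B1" "\<And>p. p \<in> S \<Longrightarrow> norm (N p) \<le> B2"
    "\<And>p. p \<in> S \<Longrightarrow> norm (du N p) \<le> B3"
    using sm Cinf_on_du[OF sm(2)] by metis
  obtain K where K: "K > 0" "\<And>(X :: real^'n^'n) (Y :: real^'m^'n). norm (X ** Y) \<le> norm X * norm Y * K"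
    using bounded_bilinear.pos_bounded[OF bounded_bilinear_matrix_matrix_mult] by metis
  define C where "C = (\<bar>B1\<bar> + \<bar>B2\<bar> + \<bar>B3\<bar>) * K"
  have "C \<ge> 0" using K by (simp add: C_def)
  have bound: "norm (X ** Y) \<le> C * norm Y" if "norm X \<le> \<bar>B1\<bar> + \<bar>B2\<bar> + \<bar>B3\<bar>" for X :: "real^'n^'n" and Y :: "real^'m^'n"
  proof -
    have "norm X * (norm Y * K) \<le> (\<bar>B1\<bar> + \<bar>B2\<bar> + \<bar>B3\<bar>) * (norm Y * K)"
      using that K by (intro mult_right_mono) auto
    then show ?thesis using K(2)[of X Y] by (simp add: C_def mult_ac)
  qed
  \<comment> \<open>The side of the new square is \<open>\<epsilon> = 2 * r\<close>. The three terms
    keep it inside \<open>S\<close>, where the bounds hold, give \<open>\<epsilon> \<le> 1\<close>,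
    and give \<open>\<epsilon> * C \<le> 1 / 4\<close>; the summand 1 next to \<open>C\<close>
    covers the case \<open>C = 0\<close>.\<close>
  define r where "r = min R (min (1 / 2) (1 / (8 * (C + 1))))"
  have r: "0 < r" "r \<le> R"
    using R \<open>C \<ge> 0\<close> by (auto simp: r_def)
  have r1: "2 * r \<le> 1" unfolding r_def by linarith
  have "2 * r * C \<le> 2 * (1 / (8 * (C + 1))) * C"
    using \<open>C \<ge> 0\<close> by (intro mult_right_mono) (auto simp: r_def)
  also have "\<dots> \<le> 1 / 4" using \<open>C \<ge> 0\<close> by (simp add: divide_simps)
  finally have rC: "2 * r * C \<le> 1 / 4" .
  define I where "I = {u0 - r..u0 + r}"
  define J where "J = {v0 - r..v0 + r}"
  have IJS: "I \<times> J \<subseteq> S" using r by (auto simp: I_def J_def S_def)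
  then have IJD: "I \<times> J \<subseteq> D" using R(2) by (auto simp: S_def)
  have cont: "continuous_on (I \<times> J) g" if "Cinf_on D g" for g :: "real \<times> real \<Rightarrow> real^'n^'n"
    by (rule continuous_on_subset[OF Cinf_on_continuous[OF that] IJD])
  obtain F where "continuous_on (I \<times> J) F" "F (u0, v0) = F0"
    "\<And>u v. u \<in> I \<Longrightarrow> v \<in> J \<Longrightarrow> ((\<lambda>u. F (u, v)) has_vector_derivative M (u, v) ** F (u, v)) (at u within I)"
    "\<And>u v. u \<in> I \<Longrightarrow> v \<in> J \<Longrightarrow> ((\<lambda>v. F (u, v)) has_vector_derivative N (u, v) ** F (u, v)) (at v within J)"
  proof (rule linear_total_system_rectangle[of u0 "u0 - r" "u0 + r" v0 "v0 - r" "v0 + r" M "dv M" N "du N" C "2 * r" F0,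
        folded I_def J_def])
    show "((\<lambda>v. M (u, v)) has_vector_derivative dv M (u, v)) (at v within J)" if "u \<in> I" "v \<in> J" for u v
      using Cinf_on_partials(2)[OF D(1) sm(1), of "(u, v)"] that IJD
      by (auto intro: has_vector_derivative_at_within)
    show "((\<lambda>u. N (u, v)) has_vector_derivative du N (u, v)) (at u within I)" if "u \<in> I" "v \<in> J" for u v
      using Cinf_on_partials(1)[OF D(1) sm(2), of "(u, v)"] that IJD
      by (auto intro: has_vector_derivative_at_within)
    fix p assume p: "p \<in> I \<times> J"
    then have pS: "p \<in> S" using IJS by blast
    show "dv M p + M p ** N p = du N p + N p ** M p" using compat p IJD by auto
    fix X :: "real^'m^'n"
    show "norm (M p ** X) \<le> C * norm X" "norm (N p ** X) \<le> C * norm X" "norm (du N p ** X) \<le> C * norm X"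
      using B(1)[OF pS] B(2)[OF pS] B(3)[OF pS] by (auto intro!: bound)
  qed (use r r1 rC \<open>C \<ge> 0\<close> in \<open>auto simp: I_def J_def intro!: cont[unfolded I_def J_def] sm smooth_intros\<close>)
  then show ?thesis
    using that[of r F] r(1) IJD by (simp add: I_def J_def)
qed

text \<open>Bootstrapping: if \<open>F\<close> is of class k, so are the products with
  \<open>M\<close> and \<open>N\<close>, which are its partial derivatives; hence \<open>F\<close>
  is of class k + 1. Continuity starts the induction.\<close>

lemma Cinf_on_linear_system:
  fixes M N :: "real \<times> real \<Rightarrow> real^'n^'n" and F :: "real \<times> real \<Rightarrow> real^'m^'n"
  assumes D: "open D" and sm: "Cinf_on D M" "Cinf_on D N" and c: "continuous_on D F"
    and u: "\<And>q. q \<in> D \<Longrightarrow> ((\<lambda>t. F (t, snd q)) has_vector_derivative M q ** F q) (at (fst q))"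
    and v: "\<And>q. q \<in> D \<Longrightarrow> ((\<lambda>t. F (fst q, t)) has_vector_derivative N q ** F q) (at (snd q))"
  shows "Cinf_on D F"
proof -
  have "Ck_on k D F" for k
  proof (induction k)
    case (Suc k)
    have "Ck_on k D (\<lambda>q. M q ** F q)" "Ck_on k D (\<lambda>q. N q ** F q)"
      by (intro Ck_on_bounded_bilinear[OF bounded_bilinear_matrix_matrix_mult D] Suc Cinf_on_imp_Ck_on sm)+
    with u v show ?case
      by (rule Ck_on_SucI[where gu = "\<lambda>q. M q ** F q" and gv = "\<lambda>q. N q ** F q", OF D])
  qed (use c in simp)
  then show ?thesis by (simp add: Cinf_on_def)
qed

text \<open>The difference of two solutions solves the same homogeneous system, so its partial
  derivatives are bounded by its own norm times a continuous function.\<close>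

lemma linear_system_unique:
  fixes M N :: "real \<times> real \<Rightarrow> real^'n^'n" and F G :: "real \<times> real \<Rightarrow> real^'m^'n"
  assumes D: "open D" "convex D" "q0 \<in> D" and sm: "Cinf_on D M" "Cinf_on D N" "Cinf_on D F" "Cinf_on D G"
    and F: "\<And>q. q \<in> D \<Longrightarrow> du F q = M q ** F q" "\<And>q. q \<in> D \<Longrightarrow> dv F q = N q ** F q"
    and G: "\<And>q. q \<in> D \<Longrightarrow> du G q = M q ** G q" "\<And>q. q \<in> D \<Longrightarrow> dv G q = N q ** G q"
    and init: "F q0 = G q0" and p: "p \<in> D"
  shows "F p = G p"
proof -
  define E where "E q = F q - G q" for q
  obtain K where K: "K > 0" "\<And>(X :: real^'n^'n) (Y :: real^'m^'n). norm (X ** Y) \<le> norm X * norm Y * K"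
    using bounded_bilinear.pos_bounded[OF bounded_bilinear_matrix_matrix_mult] by metis
  have "E p = 0"
  proof (rule vanishing_of_linear_bound[OF D, where gu = "\<lambda>q. M q ** E q" and gv = "\<lambda>q. N q ** E q"
        and \<gamma> = "\<lambda>q. (norm (M q) + norm (N q)) * K"])
    show "E q0 = 0" using init by (simp add: E_def)
    show "((\<lambda>t. E (t, snd q)) has_vector_derivative M q ** E q) (at (fst q))"
      "((\<lambda>t. E (fst q, t)) has_vector_derivative N q ** E q) (at (snd q))" if "q \<in> D" for q
      using has_vector_derivative_diff[OF Cinf_on_partials(1)[OF D(1) sm(3) that] Cinf_on_partials(1)[OF D(1) sm(4) that]]
        has_vector_derivative_diff[OF Cinf_on_partials(2)[OF D(1) sm(3) that] Cinf_on_partials(2)[OF D(1) sm(4) that]]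
        F G that
      by (simp_all add: E_def matrix_mult_diff_right)
    show "continuous_on D (\<lambda>q. N q ** E q)"
      unfolding E_def by (intro continuous_intros Cinf_on_continuous sm)
    show "continuous_on D (\<lambda>q. (norm (M q) + norm (N q)) * K)"
      by (intro continuous_intros Cinf_on_continuous sm)
    fix q
    show "norm (M q ** E q) \<le> (norm (M q) + norm (N q)) * K * norm (E q)"
      by (rule order_trans[OF K(2)]) (use K(1) in \<open>simp add: algebra_simps\<close>)
    show "norm (N q ** E q) \<le> (norm (M q) + norm (N q)) * K * norm (E q)"
      by (rule order_trans[OF K(2)]) (use K(1) in \<open>simp add: algebra_simps\<close>)
  qed (rule p)
  then show ?thesis by (simp add: E_def)
qed

lemma equal_of_equal_partials:
  fixes g h :: "real \<times> real \<Rightarrow> 'a::real_inner"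
  assumes D: "open D" "convex D" "q0 \<in> D" and sm: "Cinf_on D g" "Cinf_on D h"
    and eq: "\<And>q. q \<in> D \<Longrightarrow> du g q = du h q" "\<And>q. q \<in> D \<Longrightarrow> dv g q = dv h q"
    and init: "g q0 = h q0" and p: "p \<in> D"
  shows "g p = h p"
proof -
  have "g p - h p = 0"
  proof (rule vanishing_of_linear_bound[OF D, where gu = "\<lambda>_. 0" and gv = "\<lambda>_. 0" and \<gamma> = "\<lambda>_. 0"])
    show "((\<lambda>t. g (t, snd q) - h (t, snd q)) has_vector_derivative 0) (at (fst q))"
      "((\<lambda>t. g (fst q, t) - h (fst q, t)) has_vector_derivative 0) (at (snd q))" if "q \<in> D" for q
      using has_vector_derivative_diff[OF Cinf_on_partials(1)[OF D(1) sm(1) that] Cinf_on_partials(1)[OF D(1) sm(2) that]]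
        has_vector_derivative_diff[OF Cinf_on_partials(2)[OF D(1) sm(1) that] Cinf_on_partials(2)[OF D(1) sm(2) that]]
        eq that
      by simp_all
  qed (use init p in auto)
  then show ?thesis by simp
qed

section \<open>Differentiation rules for \<open>du\<close> and \<open>dv\<close>\<close>

lemma has_derivative_slices_real:
  fixes g :: "real \<times> real \<Rightarrow> real"
  assumes "open D" "Cinf_on D g" "p \<in> D"
  shows "((\<lambda>t. g (t, snd p)) has_real_derivative du g p) (at (fst p))"
    "((\<lambda>t. g (fst p, t)) has_real_derivative dv g p) (at (snd p))"
  using Cinf_on_partials[OF assms] by (simp_all add: has_real_derivative_iff_has_vector_derivative)

lemma du_dv_minus:
  assumes "open D" "Cinf_on D g" "p \<in> D"
  shows "du (\<lambda>q. - g q) p = - du g p" "dv (\<lambda>q. - g q) p = - dv g p"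
  using has_vector_derivative_minus[OF Cinf_on_partials(1)[OF assms]]
    has_vector_derivative_minus[OF Cinf_on_partials(2)[OF assms]]
  by (auto intro: du_eqI dv_eqI)

lemma du_dv_add:
  assumes "open D" "Cinf_on D g" "Cinf_on D h" "p \<in> D"
  shows "du (\<lambda>q. g q + h q) p = du g p + du h p" "dv (\<lambda>q. g q + h q) p = dv g p + dv h p"
  using has_vector_derivative_add[OF Cinf_on_partials(1)[OF assms(1,2,4)] Cinf_on_partials(1)[OF assms(1,3,4)]]
    has_vector_derivative_add[OF Cinf_on_partials(2)[OF assms(1,2,4)] Cinf_on_partials(2)[OF assms(1,3,4)]]
  by (auto intro: du_eqI dv_eqI)

lemma du_dv_mult:
  fixes g h :: "real \<times> real \<Rightarrow> real"
  assumes "open D" "Cinf_on D g" "Cinf_on D h" "p \<in> D"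
  shows "du (\<lambda>q. g q * h q) p = g p * du h p + du g p * h p"
    "dv (\<lambda>q. g q * h q) p = g p * dv h p + dv g p * h p"
  using has_vector_derivative_mult[OF Cinf_on_partials(1)[OF assms(1,2,4)] Cinf_on_partials(1)[OF assms(1,3,4)]]
    has_vector_derivative_mult[OF Cinf_on_partials(2)[OF assms(1,2,4)] Cinf_on_partials(2)[OF assms(1,3,4)]]
  by (auto intro: du_eqI dv_eqI)

lemma du_dv_scaleR:
  assumes "open D" "Cinf_on D g" "Cinf_on D h" "p \<in> D"
  shows "du (\<lambda>q. g q *\<^sub>R h q) p = g p *\<^sub>R du h p + du g p *\<^sub>R h p"
    "dv (\<lambda>q. g q *\<^sub>R h q) p = g p *\<^sub>R dv h p + dv g p *\<^sub>R h p"
  using has_vector_derivative_scaleR[OF has_derivative_slices_real(1)[OF assms(1,2,4)] Cinf_on_partials(1)[OF assms(1,3,4)]]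
    has_vector_derivative_scaleR[OF has_derivative_slices_real(2)[OF assms(1,2,4)] Cinf_on_partials(2)[OF assms(1,3,4)]]
  by (auto intro: du_eqI dv_eqI)

lemma du_dv_divide:
  fixes g h :: "real \<times> real \<Rightarrow> real"
  assumes "open D" "Cinf_on D g" "Cinf_on D h" "p \<in> D" "h p \<noteq> 0"
  shows "du (\<lambda>q. g q / h q) p = (du g p * h p - g p * du h p) / (h p)\<^sup>2"
    "dv (\<lambda>q. g q / h q) p = (dv g p * h p - g p * dv h p) / (h p)\<^sup>2"
  using DERIV_divide[OF has_derivative_slices_real(1)[OF assms(1,2,4)] has_derivative_slices_real(1)[OF assms(1,3,4)]]
    DERIV_divide[OF has_derivative_slices_real(2)[OF assms(1,2,4)] has_derivative_slices_real(2)[OF assms(1,3,4)]]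
    assms(5)
  by (auto intro!: du_eqI dv_eqI simp: power2_eq_square simp flip: has_real_derivative_iff_has_vector_derivative)

lemma has_real_derivative_ln_sq:
  fixes \<phi> :: "real \<Rightarrow> real"
  assumes "(\<phi> has_real_derivative d) (at t)" "\<phi> t \<noteq> 0"
  shows "((\<lambda>t. ln ((\<phi> t)\<^sup>2)) has_real_derivative 2 * d / \<phi> t) (at t)"
proof -
  have "((\<lambda>t. (\<phi> t)\<^sup>2) has_real_derivative 2 * \<phi> t * d) (at t)"
    using assms by (auto intro!: derivative_eq_intros)
  moreover have "0 < (\<phi> t)\<^sup>2" using assms by simp
  ultimately have "((\<lambda>t. ln ((\<phi> t)\<^sup>2)) has_real_derivative inverse ((\<phi> t)\<^sup>2) * (2 * \<phi> t * d)) (at t)"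
    using DERIV_chain'[OF _ DERIV_ln] by blast
  then show ?thesis
    using assms(2) by (simp add: power2_eq_square divide_simps)
qed

lemma has_real_derivative_ln_abs:
  fixes \<phi> :: "real \<Rightarrow> real"
  assumes "(\<phi> has_real_derivative d) (at t)" "\<phi> t \<noteq> 0"
  shows "((\<lambda>t. ln \<bar>\<phi> t\<bar>) has_real_derivative d / \<phi> t) (at t)"
proof -
  \<comment> \<open>The logarithm of a square needs no case distinction on the sign, so ln|x| is
    treated as half of it.\<close>
  have "ln (x\<^sup>2) / 2 = ln \<bar>x\<bar>" for x :: real
    using ln_realpow[of "\<bar>x\<bar>" 2] by (cases "x = 0") simp_all
  then show ?thesis
    using DERIV_cdivide[OF has_real_derivative_ln_sq[OF assms], of 2] by simp
qed

lemma du_dv_ln_sq: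
  assumes "open D" "Cinf_on D g" "p \<in> D" "g p \<noteq> 0"
  shows "du (ln_sq g) p = 2 * du g p / g p" "dv (ln_sq g) p = 2 * dv g p / g p"
  using has_real_derivative_ln_sq[OF has_derivative_slices_real(1)[OF assms(1-3)]]
    has_real_derivative_ln_sq[OF has_derivative_slices_real(2)[OF assms(1-3)]] assms(4)
  by (auto intro!: du_eqI dv_eqI simp flip: has_real_derivative_iff_has_vector_derivative)

lemma du_dv_ln_abs:
  assumes "open D" "Cinf_on D g" "p \<in> D" "g p \<noteq> 0"
  shows "du (ln_abs g) p = du g p / g p" "dv (ln_abs g) p = dv g p / g p"
  using has_real_derivative_ln_abs[OF has_derivative_slices_real(1)[OF assms(1-3)]]
    has_real_derivative_ln_abs[OF has_derivative_slices_real(2)[OF assms(1-3)]] assms(4)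
  by (auto intro!: du_eqI dv_eqI simp flip: has_real_derivative_iff_has_vector_derivative)

section \<open>Minkowski geometry of surfaces\<close>

text \<open>One constructor for vectors and, nested, for matrices given by rows. A frame becomes the
  matrix with its vectors as rows, on which a connection matrix acts from the left.\<close>

definition vec4 :: "'a \<Rightarrow> 'a \<Rightarrow> 'a \<Rightarrow> 'a \<Rightarrow> 'a^4" where
  "vec4 a b c d = (\<chi> i. if i = 1 then a else if i = 2 then b else if i = 3 then c else d)"

lemma vec4_nth [simp]:
  "vec4 a b c d $ 1 = a" "vec4 a b c d $ 2 = b" "vec4 a b c d $ 3 = c" "vec4 a b c d $ 4 = d"
  by (simp_all add: vec4_def)

lemma vec4_eta: "vec4 (X $ 1) (X $ 2) (X $ 3) (X $ 4) = X"
  by (simp add: vec_eq_iff forall_4)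

lemma vec4_eq_iff [simp]: "vec4 a b c d = vec4 a' b' c' d' \<longleftrightarrow> a = a' \<and> b = b' \<and> c = c' \<and> d = d'"
  by (auto simp: vec_eq_iff forall_4)

text \<open>Each summand is linear in a single entry, which reduces derivatives and smoothness of
  \<open>vec4\<close> to sums and bounded linear maps.\<close>

lemma vec4_split:
  fixes a :: "'a::monoid_add"
  shows "vec4 a b c d = vec4 a 0 0 0 + (vec4 0 b 0 0 + (vec4 0 0 c 0 + vec4 0 0 0 d))"
  by (simp add: vec_eq_iff forall_4)

lemma bounded_linear_vec4:
  "bounded_linear (\<lambda>x::'a::euclidean_space. vec4 x 0 0 0)"
  "bounded_linear (\<lambda>x::'a. vec4 0 x 0 0)"
  "bounded_linear (\<lambda>x::'a. vec4 0 0 x 0)"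
  "bounded_linear (\<lambda>x::'a. vec4 0 0 0 x)"
  unfolding linear_conv_bounded_linear[symmetric]
  by (auto intro!: linearI simp: vec_eq_iff forall_4)

lemma has_vector_derivative_vec4:
  fixes a b c d :: "real \<Rightarrow> 'a::euclidean_space"
  assumes "(a has_vector_derivative a') F" "(b has_vector_derivative b') F"
    "(c has_vector_derivative c') F" "(d has_vector_derivative d') F"
  shows "((\<lambda>t. vec4 (a t) (b t) (c t) (d t)) has_vector_derivative vec4 a' b' c' d') F"
  by (subst (1 2) vec4_split)
     (intro has_vector_derivative_add assms
       bounded_linear_vec4(1)[THEN bounded_linear.has_vector_derivative]
       bounded_linear_vec4(2)[THEN bounded_linear.has_vector_derivative]
       bounded_linear_vec4(3)[THEN bounded_linear.has_vector_derivative]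
       bounded_linear_vec4(4)[THEN bounded_linear.has_vector_derivative])

lemma Cinf_on_vec4 [smooth_intros]:
  fixes a b c d :: "real \<times> real \<Rightarrow> 'a::euclidean_space"
  assumes "open D" "Cinf_on D a" "Cinf_on D b" "Cinf_on D c" "Cinf_on D d"
  shows "Cinf_on D (\<lambda>p. vec4 (a p) (b p) (c p) (d p))"
  by (subst vec4_split)
     (intro Cinf_on_add assms bounded_linear_vec4[THEN Cinf_on_bounded_linear])

lemma bounded_bilinear_mink: "bounded_bilinear mink"
proof -
  have "bilinear mink"
    by (auto simp: bilinear_def mink_def algebra_simps intro!: linearI)
  then show ?thesis by (simp add: bilinear_conv_bounded_bilinear)
qed

lemmas mink_simps = bounded_bilinear.add_left[OF bounded_bilinear_mink]
  bounded_bilinear.add_right[OF bounded_bilinear_mink]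
  bounded_bilinear.diff_left[OF bounded_bilinear_mink]
  bounded_bilinear.diff_right[OF bounded_bilinear_mink]
  bounded_bilinear.minus_left[OF bounded_bilinear_mink]
  bounded_bilinear.minus_right[OF bounded_bilinear_mink]
  bounded_bilinear.scaleR_left[OF bounded_bilinear_mink]
  bounded_bilinear.scaleR_right[OF bounded_bilinear_mink]
  bounded_bilinear.zero_left[OF bounded_bilinear_mink]
  bounded_bilinear.zero_right[OF bounded_bilinear_mink]

lemma mink_commute: "mink a b = mink b a"
  by (simp add: mink_def mult.commute)

lemma du_dv_mink:
  assumes "open D" "Cinf_on D g" "Cinf_on D h" "p \<in> D"
  shows "du (\<lambda>q. mink (g q) (h q)) p = mink (g p) (du h p) + mink (du g p) (h p)"
    "dv (\<lambda>q. mink (g q) (h q)) p = mink (g p) (dv h p) + mink (dv g p) (h p)"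
  using bounded_bilinear.has_vector_derivative[OF bounded_bilinear_mink
      Cinf_on_partials(1)[OF assms(1,2,4)] Cinf_on_partials(1)[OF assms(1,3,4)]]
    bounded_bilinear.has_vector_derivative[OF bounded_bilinear_mink
      Cinf_on_partials(2)[OF assms(1,2,4)] Cinf_on_partials(2)[OF assms(1,3,4)]]
  by (auto intro: du_eqI dv_eqI)

text \<open>The metric relations of \<open>pseudo_orthonormal_frame\<close>: the information carried
  by the Gram matrix and propagated by the total system.\<close>

definition null_frame :: "real^4 \<Rightarrow> real^4 \<Rightarrow> real^4 \<Rightarrow> real^4 \<Rightarrow> bool" where
  "null_frame x y n1 n2 \<longleftrightarrow>
     mink x x = 0 \<and> mink y y = 0 \<and> mink x y = -1 \<and> mink n1 n1 = 1 \<and> mink n2 n2 = 1 \<and>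
     mink n1 n2 = 0 \<and> mink x n1 = 0 \<and> mink x n2 = 0 \<and> mink y n1 = 0 \<and> mink y n2 = 0"

definition mink_form :: "real^4^4" where
  "mink_form = vec4 (vec4 1 0 0 0) (vec4 0 1 0 0) (vec4 0 0 1 0) (vec4 0 0 0 (-1))"

definition null_gram :: "real^4^4" where
  "null_gram = vec4 (vec4 0 (-1) 0 0) (vec4 (-1) 0 0 0) (vec4 0 0 1 0) (vec4 0 0 0 1)"

definition gram :: "real^4^4 \<Rightarrow> real^4^4" where
  "gram F = F ** (mink_form ** transpose F)"

lemma mat_4: "mat c = vec4 (vec4 c 0 0 0) (vec4 0 c 0 0) (vec4 0 0 c 0) (vec4 0 0 0 (c::real))"
  by (simp add: vec_eq_iff forall_4 mat_def)

lemma gram_nth: "gram F $ i $ j = mink (F $ i) (F $ j)"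
  by (simp add: gram_def matrix_matrix_mult_def sum_4 mink_form_def transpose_def mink_def)

lemma null_frame_iff_gram: "null_frame x y n1 n2 \<longleftrightarrow> gram (vec4 x y n1 n2) = null_gram"
  by (auto simp: vec_eq_iff forall_4 null_frame_def gram_nth null_gram_def mink_commute[of y x]
      mink_commute[of n1 x] mink_commute[of n2 x] mink_commute[of n1 y] mink_commute[of n2 y]
      mink_commute[of n2 n1])

lemma null_gram_involution: "null_gram ** null_gram = mat 1"
  by (simp add: vec_eq_iff forall_4 mat_4 matrix_matrix_mult_def sum_4 null_gram_def)

text \<open>Since \<open>null_gram\<close> is its own inverse, \<open>mink_form ** transpose F ** null_gram\<close> is a right, hence
  also a left inverse of the frame matrix \<open>F\<close>.\<close>

lemma null_frame_expand:
  assumes "null_frame x y n1 n2"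
  shows "X = (- mink X y) *\<^sub>R x + (- mink X x) *\<^sub>R y + mink X n1 *\<^sub>R n1 + mink X n2 *\<^sub>R n2"
proof -
  define F where "F = vec4 x y n1 n2"
  have "F ** ((mink_form ** transpose F) ** null_gram) = mat 1"
    using assms unfolding null_frame_iff_gram gram_def F_def[symmetric]
    by (simp add: matrix_mul_assoc null_gram_involution)
  then have inv: "((mink_form ** transpose F) ** null_gram) ** F = mat 1"
    by (simp add: matrix_left_right_inverse)
  \<comment> \<open>The row \<open>X\<close> times \<open>mink_form ** transpose F\<close> lists its
    products with the frame vectors; \<open>null_gram\<close> then exchanges the entries for x and y
    and reverses their signs, as <x, y> = -1 requires.\<close>
  have "X = X v* (((mink_form ** transpose F) ** null_gram) ** F)"
    by (simp add: inv)
  also have "\<dots> = (- mink X y) *\<^sub>R x + (- mink X x) *\<^sub>R y + mink X n1 *\<^sub>R n1 + mink X n2 *\<^sub>R n2"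
    by (simp add: vec_eq_iff forall_4 vector_matrix_mult_def matrix_matrix_mult_def sum_4 mink_form_def
        null_gram_def transpose_def F_def mink_def) (simp add: algebra_simps)
  finally show ?thesis .
qed

section \<open>Normal projection and second fundamental form in isotropic parameters\<close>

lemma tangent_space_iff: "X \<in> tangent_space z p \<longleftrightarrow> (\<exists>a b. X = a *\<^sub>R du z p + b *\<^sub>R dv z p)"
  by (simp add: tangent_space_def span_insert span_singleton image_iff diff_eq_eq add.commute)

lemma is_normal_iff: "is_normal z p w \<longleftrightarrow> mink w (du z p) = 0 \<and> mink w (dv z p) = 0"
proof
  assume "is_normal z p w"
  then show "mink w (du z p) = 0 \<and> mink w (dv z p) = 0"
    by (simp add: is_normal_def tangent_space_def span_base)
next
  assume "mink w (du z p) = 0 \<and> mink w (dv z p) = 0"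
  then show "is_normal z p w"
    by (auto simp: is_normal_def tangent_space_iff mink_simps)
qed

text \<open>The pointwise content of \<open>isotropic_parameters\<close>; it makes the descriptions in
  \<open>normal_part\<close> and \<open>second_fund\<close> definite.\<close>

definition isotropic_at :: "surface \<Rightarrow> real \<times> real \<Rightarrow> real \<Rightarrow> bool" where
  "isotropic_at z p k \<longleftrightarrow> k > 0 \<and> mink (du z p) (du z p) = 0 \<and> mink (dv z p) (dv z p) = 0 \<and>
     mink (du z p) (dv z p) = - (k\<^sup>2)"

text \<open>Pairing with \<open>dv z p\<close> isolates the coefficient of \<open>du z p\<close> up
  to the factor -k^2, and vice versa.\<close>

lemma isotropic_at_cancel:
  assumes "isotropic_at z p k" "a *\<^sub>R du z p + b *\<^sub>R dv z p = c *\<^sub>R du z p + d *\<^sub>R dv z p"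
  shows "a = c \<and> b = d"
proof -
  have "mink (a *\<^sub>R du z p + b *\<^sub>R dv z p) X = mink (c *\<^sub>R du z p + d *\<^sub>R dv z p) X" for X
    using assms(2) by simp
  from this[of "du z p"] this[of "dv z p"] show ?thesis
    using assms(1) by (simp add: isotropic_at_def mink_simps mink_commute[of "dv z p" "du z p"])
qed

lemma normal_part_eqI:
  assumes iso: "isotropic_at z p k" and "mink n (du z p) = 0" "mink n (dv z p) = 0"
    and X: "X = a *\<^sub>R du z p + b *\<^sub>R dv z p + n"
  shows "normal_part z p X = n"
  unfolding normal_part_def
proof (rule the_equality)
  show "is_normal z p n \<and> X - n \<in> tangent_space z p"
    using assms by (auto simp: is_normal_iff tangent_space_iff)
  fix w assume w: "is_normal z p w \<and> X - w \<in> tangent_space z p"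
  then obtain c d where "X - w = c *\<^sub>R du z p + d *\<^sub>R dv z p" by (auto simp: tangent_space_iff)
  then have eq: "w = (a - c) *\<^sub>R du z p + (b - d) *\<^sub>R dv z p + n"
    by (simp add: X algebra_simps)
  have "mink w (du z p) = 0" "mink w (dv z p) = 0" using w by (auto simp: is_normal_iff)
  \<comment> \<open>A vector both tangent and normal is zero: its products with z_u and z_v are -k^2
    times its coefficients.\<close>
  then have "a - c = 0 \<and> b - d = 0"
    unfolding eq using assms(1-3)
    by (simp add: isotropic_at_def mink_simps mink_commute[of "dv z p" "du z p"])
  then show "w = n" by (simp add: eq)
qed

lemma normal_part_decomp:
  assumes "isotropic_at z p k"
  shows "X = (- mink X (dv z p) / k\<^sup>2) *\<^sub>R du z p + (- mink X (du z p) / k\<^sup>2) *\<^sub>R dv z p + normal_part z p X"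
proof -
  define n where "n = X + (mink X (dv z p) / k\<^sup>2) *\<^sub>R du z p + (mink X (du z p) / k\<^sup>2) *\<^sub>R dv z p"
  have X: "X = (- mink X (dv z p) / k\<^sup>2) *\<^sub>R du z p + (- mink X (du z p) / k\<^sup>2) *\<^sub>R dv z p + n"
    by (simp add: n_def)
  have "mink n (du z p) = 0" "mink n (dv z p) = 0"
    using assms by (auto simp: n_def isotropic_at_def mink_simps mink_commute[of "dv z p" "du z p"])
  from normal_part_eqI[OF assms this X] X show ?thesis by simp
qed

text \<open>\<open>second_fund\<close> describes a vector through all coordinate representations of
  its arguments; \<open>isotropic_at_cancel\<close> makes these coordinates unique, so the
  description is definite.\<close>

lemma second_fund_eq:
  assumes "isotropic_at z p k"
  shows "second_fund z p (a *\<^sub>R du z p + b *\<^sub>R dv z p) (c *\<^sub>R du z p + d *\<^sub>R dv z p) =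
    normal_part z p ((a * c) *\<^sub>R du (du z) p + (a * d + b * c) *\<^sub>R dv (du z) p + (b * d) *\<^sub>R dv (dv z) p)"
  unfolding second_fund_def
  by (rule the_equality) (blast, blast dest: isotropic_at_cancel[OF assms])

lemma normal_part_scaleR:
  assumes "isotropic_at z p k"
  shows "normal_part z p (c *\<^sub>R X) = c *\<^sub>R normal_part z p X"
proof -
  have *: "mink (normal_part z p X) (du z p) = 0 \<and> mink (normal_part z p X) (dv z p) = 0"
  proof -
    have "normal_part z p X = X - (- mink X (dv z p) / k\<^sup>2) *\<^sub>R du z p - (- mink X (du z p) / k\<^sup>2) *\<^sub>R dv z p"
      using normal_part_decomp[OF assms, of X] by (simp add: algebra_simps)
    then show ?thesis
      using assms by (auto simp: isotropic_at_def mink_simps mink_commute[of "dv z p" "du z p"])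
  qed
  obtain a b where X: "X = a *\<^sub>R du z p + b *\<^sub>R dv z p + normal_part z p X"
    using normal_part_decomp[OF assms] by blast
  have "c *\<^sub>R X = (c * a) *\<^sub>R du z p + (c * b) *\<^sub>R dv z p + c *\<^sub>R normal_part z p X"
    by (subst (1) X) (simp add: scaleR_add_right)
  with * show ?thesis
    by (intro normal_part_eqI[OF assms]) (auto simp: mink_simps)
qed

lemma second_fund_partials:
  assumes "isotropic_at z p k"
  shows "second_fund z p (du z p) (du z p) = normal_part z p (du (du z) p)"
    "second_fund z p (du z p) (dv z p) = normal_part z p (dv (du z) p)"
    "second_fund z p (dv z p) (dv z p) = normal_part z p (dv (dv z) p)"
  using second_fund_eq[OF assms, of 1 0 1 0] second_fund_eq[OF assms, of 1 0 0 1]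
    second_fund_eq[OF assms, of 0 1 0 1] by simp_all

lemma second_fund_normalized:
  assumes "isotropic_at z p k"
  shows "second_fund z p ((1 / k) *\<^sub>R du z p) ((1 / k) *\<^sub>R du z p) = (1 / k\<^sup>2) *\<^sub>R normal_part z p (du (du z) p)"
    "second_fund z p ((1 / k) *\<^sub>R du z p) ((1 / k) *\<^sub>R dv z p) = (1 / k\<^sup>2) *\<^sub>R normal_part z p (dv (du z) p)"
    "second_fund z p ((1 / k) *\<^sub>R dv z p) ((1 / k) *\<^sub>R dv z p) = (1 / k\<^sup>2) *\<^sub>R normal_part z p (dv (dv z) p)"
  using second_fund_eq[OF assms, of "1 / k" 0 "1 / k" 0] second_fund_eq[OF assms, of "1 / k" 0 0 "1 / k"]
    second_fund_eq[OF assms, of 0 "1 / k" 0 "1 / k"]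
  by (simp_all add: power2_eq_square flip: normal_part_scaleR[OF assms])

text \<open>With E = G = 0 and F = -k^2 only the mixed term survives, with factor 2 k^2 / (-2
  k^4).\<close>

lemma mean_curvature_eq:
  assumes "isotropic_at z p k"
  shows "mean_curvature z p = (- 1 / k\<^sup>2) *\<^sub>R normal_part z p (dv (du z) p)"
  using assms
  by (simp add: mean_curvature_def Let_def isotropic_at_def second_fund_partials[OF assms] power2_eq_square)

section \<open>Connection matrices\<close>

text \<open>The general matrix that infinitesimally preserves \<open>null_gram\<close>, a
  six-parameter family. The parameter \<open>a\<close> is the tangential connection,
  \<open>l\<close>, \<open>m\<close> and \<open>k\<close>, \<open>h\<close> are the normal
  components of the derivatives of x and y, and \<open>b\<close> is the normal connection; the rest
  of the rows of n1 and n2 is forced.\<close>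

definition skew :: "real \<Rightarrow> real \<Rightarrow> real \<Rightarrow> real \<Rightarrow> real \<Rightarrow> real \<Rightarrow> real^4^4" where
  "skew a l m k h b = vec4 (vec4 a 0 l m) (vec4 0 (- a) k h) (vec4 k l 0 b) (vec4 h m (- b) 0)"

lemma skew_mult:
  "skew a l m k h b ** vec4 x y n1 n2 =
    vec4 (a *\<^sub>R x + l *\<^sub>R n1 + m *\<^sub>R n2) (k *\<^sub>R n1 + h *\<^sub>R n2 - a *\<^sub>R y)
      (k *\<^sub>R x + l *\<^sub>R y + b *\<^sub>R n2) (h *\<^sub>R x + m *\<^sub>R y - b *\<^sub>R n1)"
  by (simp add: vec_eq_iff forall_4 matrix_matrix_mult_def sum_4 skew_def)

lemma skew_null_gram: "skew a l m k h b ** null_gram + null_gram ** transpose (skew a l m k h b) = 0"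
  by (simp add: vec_eq_iff forall_4 matrix_matrix_mult_def sum_4 skew_def null_gram_def transpose_def)

lemma Cinf_on_skew [smooth_intros]:
  "open D \<Longrightarrow> Cinf_on D a \<Longrightarrow> Cinf_on D l \<Longrightarrow> Cinf_on D m \<Longrightarrow> Cinf_on D k \<Longrightarrow> Cinf_on D h \<Longrightarrow> Cinf_on D b \<Longrightarrow>
    Cinf_on D (\<lambda>p. skew (a p) (l p) (m p) (k p) (h p) (b p))"
  unfolding skew_def by (intro smooth_intros)

lemma du_dv_skew:
  assumes "open D" "p \<in> D" "Cinf_on D a" "Cinf_on D l" "Cinf_on D m" "Cinf_on D k" "Cinf_on D h" "Cinf_on D b"
  shows "du (\<lambda>p. skew (a p) (l p) (m p) (k p) (h p) (b p)) p =
      skew (du a p) (du l p) (du m p) (du k p) (du h p) (du b p)"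
    "dv (\<lambda>p. skew (a p) (l p) (m p) (k p) (h p) (b p)) p =
      skew (dv a p) (dv l p) (dv m p) (dv k p) (dv h p) (dv b p)"
  unfolding skew_def
  by (rule du_eqI dv_eqI,
      intro has_vector_derivative_vec4 has_vector_derivative_minus has_vector_derivative_const
        Cinf_on_partials[OF assms(1) _ assms(2)] assms)+

text \<open>Commutators of matrices of this shape have this shape again, so the sixteen entries
  reduce to one equation per parameter: Gauss for \<open>a\<close>, Codazzi for \<open>l\<close>,
  \<open>m\<close>, \<open>k\<close>, \<open>h\<close>, and Ricci for \<open>b\<close>.\<close>

lemma skew_compatible:
  assumes "a1' + l1 * k2 + m1 * h2 = a2' + l2 * k1 + m2 * h1"
    "l1' + a1 * l2 - m1 * b2 = l2' + a2 * l1 - m2 * b1"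
    "m1' + a1 * m2 + l1 * b2 = m2' + a2 * m1 + l2 * b1"
    "k1' - a1 * k2 - h1 * b2 = k2' - a2 * k1 - h2 * b1"
    "h1' - a1 * h2 + k1 * b2 = h2' - a2 * h1 + k2 * b1"
    "b1' + k1 * m2 + l1 * h2 = b2' + k2 * m1 + l2 * h1"
  shows "skew a1' l1' m1' k1' h1' b1' + skew a1 l1 m1 k1 h1 b1 ** skew a2 l2 m2 k2 h2 b2 =
    skew a2' l2' m2' k2' h2' b2' + skew a2 l2 m2 k2 h2 b2 ** skew a1 l1 m1 k1 h1 b1"
  using assms
  by (simp add: vec_eq_iff forall_4 matrix_matrix_mult_def sum_4 skew_def) (simp add: algebra_simps)

lemma bounded_bilinear_congruence:
  "bounded_bilinear (\<lambda>(S :: real^'n^'n) X. S ** X + X ** transpose S)"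
proof -
  have "bilinear (\<lambda>(S :: real^'n^'n) X. S ** X + X ** transpose S)"
    by (auto simp: bilinear_def linear_iff vec_eq_iff matrix_matrix_mult_def transpose_def sum_distrib_left
        sum.distrib algebra_simps)
  then show ?thesis by (simp add: bilinear_conv_bounded_bilinear)
qed

text \<open>The Gram matrix X of a solution satisfies X_u = M X + X M^T, and likewise with
  \<open>N\<close> in v. By skewness \<open>null_gram\<close> is a constant solution, so the
  difference solves the same linear system with initial value zero.\<close>

lemma gram_preserved:
  fixes M N F :: "real \<times> real \<Rightarrow> real^4^4"
  assumes D: "open D" "convex D" "q0 \<in> D" and sm: "Cinf_on D M" "Cinf_on D N" and c: "continuous_on D F"
    and u: "\<And>q. q \<in> D \<Longrightarrow> ((\<lambda>t. F (t, snd q)) has_vector_derivative M q ** F q) (at (fst q))"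
    and v: "\<And>q. q \<in> D \<Longrightarrow> ((\<lambda>t. F (fst q, t)) has_vector_derivative N q ** F q) (at (snd q))"
    and skew: "\<And>q. q \<in> D \<Longrightarrow> M q ** null_gram + null_gram ** transpose (M q) = 0"
      "\<And>q. q \<in> D \<Longrightarrow> N q ** null_gram + null_gram ** transpose (N q) = 0"
    and init: "gram (F q0) = null_gram" and p: "p \<in> D"
  shows "gram (F p) = null_gram"
proof -
  define P where "P S X = S ** X + X ** transpose S" for S X :: "real^4^4"
  note P = bounded_bilinear_congruence[where 'n = 4, folded P_def]
  define G where "G q = gram (F q) - null_gram" for q
  have deriv: "((\<lambda>t. gram (\<phi> t) - null_gram) has_vector_derivative P S (gram (\<phi> t) - null_gram)) (at t)"
    if "(\<phi> has_vector_derivative S ** \<phi> t) (at t)" "S ** null_gram + null_gram ** transpose S = 0"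
    for \<phi> t S
  proof -
    have tr: "bounded_linear (\<lambda>X :: real^4^4. mink_form ** transpose X)"
      unfolding linear_conv_bounded_linear[symmetric]
      by (rule linearI) (simp_all add: vec_eq_iff matrix_matrix_mult_def transpose_def sum.distrib
          sum_distrib_left algebra_simps)
    have "((\<lambda>t. gram (\<phi> t) - null_gram) has_vector_derivative
        \<phi> t ** (mink_form ** transpose (S ** \<phi> t)) + (S ** \<phi> t) ** (mink_form ** transpose (\<phi> t)) - 0) (at t)"
      unfolding gram_def
      by (intro has_vector_derivative_diff has_vector_derivative_matrix_mult has_vector_derivative_const
          bounded_linear.has_vector_derivative[OF tr] that)
    moreover have "\<phi> t ** (mink_form ** transpose (S ** \<phi> t)) + (S ** \<phi> t) ** (mink_form ** transpose (\<phi> t)) - 0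
        = P S (gram (\<phi> t))"
      by (simp add: P_def gram_def matrix_transpose_mul matrix_mul_assoc add.commute)
    moreover have "P S null_gram = 0" using that(2) by (simp add: P_def)
    ultimately show ?thesis
      by (simp add: bounded_bilinear.diff_right[OF P])
  qed
  have cG: "continuous_on D G"
  proof -
    have tr: "bounded_linear (transpose :: real^4^4 \<Rightarrow> real^4^4)"
      unfolding linear_conv_bounded_linear[symmetric]
      by (rule linearI) (simp_all add: vec_eq_iff transpose_def)
    show ?thesis
      unfolding G_def gram_def
      by (intro continuous_intros c bounded_linear.continuous_on[OF tr])
  qed
  obtain K where K: "K > 0" "\<And>S X. norm (P S X) \<le> norm S * norm X * K"
    using bounded_bilinear.pos_bounded[OF P] by metis
  have "G p = 0"
  proof (rule vanishing_of_linear_bound[OF D, where gu = "\<lambda>q. P (M q) (G q)" and gv = "\<lambda>q. P (N q) (G q)"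
        and \<gamma> = "\<lambda>q. (norm (M q) + norm (N q)) * K"])
    show "G q0 = 0" using init by (simp add: G_def)
    show "((\<lambda>t. G (t, snd q)) has_vector_derivative P (M q) (G q)) (at (fst q))"
      "((\<lambda>t. G (fst q, t)) has_vector_derivative P (N q) (G q)) (at (snd q))" if "q \<in> D" for q
      using deriv[of "\<lambda>t. F (t, snd q)" "M q" "fst q"] deriv[of "\<lambda>t. F (fst q, t)" "N q" "snd q"]
        u v skew that
      by (auto simp: G_def)
    show "continuous_on D (\<lambda>q. P (N q) (G q))"
      by (intro bounded_bilinear.continuous_on[OF P] Cinf_on_continuous sm cG)
    show "continuous_on D (\<lambda>q. (norm (M q) + norm (N q)) * K)"
      by (intro continuous_intros Cinf_on_continuous sm)
    fix q
    show "norm (P (M q) (G q)) \<le> (norm (M q) + norm (N q)) * K * norm (G q)"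
      by (rule order_trans[OF K(2)]) (use K(1) in \<open>simp add: algebra_simps\<close>)
    show "norm (P (N q) (G q)) \<le> (norm (M q) + norm (N q)) * K * norm (G q)"
      by (rule order_trans[OF K(2)]) (use K(1) in \<open>simp add: algebra_simps\<close>)
  qed (rule p)
  then show ?thesis by (simp add: G_def)
qed

section \<open>From the invariants to connection matrices and to a surface\<close>

text \<open>The n1-component of the Codazzi equation for x equates this expression with mu1 <(n1)_v,
  n2>. The logarithmic derivative (ln f^2)_v is already expanded.\<close>

definition codazzi_term :: "(real \<times> real \<Rightarrow> real) \<Rightarrow> (real \<times> real \<Rightarrow> real) \<Rightarrow> (real \<times> real \<Rightarrow> real) \<Rightarrow>
    real \<times> real \<Rightarrow> real" where
  "codazzi_term f nu lam1 p = du nu p + dv lam1 p + 2 * dv f p / f p * lam1 p"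

text \<open>Conditions (i)-(iv) stay outside: \<open>conn_compatible\<close> takes them at a single
  point, and the locale itself passes to open subsets by \<open>restrict\<close>. Positivity of
  \<open>nu\<close> makes it the length of nu n1 and keeps the mean curvature nonzero.\<close>

locale second_type_data =
  fixes D :: "(real \<times> real) set" and f nu lam1 mu1 lam2 :: "real \<times> real \<Rightarrow> real"
  assumes open_D: "open D"
    and smooth: "Cinf_on D f" "Cinf_on D nu" "Cinf_on D lam1" "Cinf_on D mu1" "Cinf_on D lam2"
    and f_pos: "p \<in> D \<Longrightarrow> f p > 0"
    and nu_pos: "p \<in> D \<Longrightarrow> nu p > 0"
    and mu1_nz: "p \<in> D \<Longrightarrow> mu1 p \<noteq> 0"
    and lam2_nz: "p \<in> D \<Longrightarrow> lam2 p \<noteq> 0"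
begin

text \<open>The normal connection \<open>\<langle>(n1)_u, n2\<rangle>\<close> and \<open>\<langle>(n1)_v, n2\<rangle>\<close>, which the Codazzi equations
  express through the invariants.\<close>

definition "normal_u p = - (nu p * codazzi_term f nu lam1 p / (lam2 p * mu1 p))"
definition "normal_v p = codazzi_term f nu lam1 p / mu1 p"

text \<open>The factors \<open>f\<close> appear since the parameter derivatives are taken along z_u
  = f x and z_v = f y. The zero entries are the n2-components of sigma(x, y) and sigma(y, y); the
  logarithmic derivatives of \<open>f\<close> express that z_uv is normal.\<close>

definition "conn_u p = skew (du f p / f p) (f p * lam1 p) (f p * mu1 p) (- (f p * nu p)) 0 (normal_u p)"
definition "conn_v p = skew (- (dv f p / f p)) (- (f p * nu p)) 0 (f p * lam2 p) 0 (normal_v p)"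

lemma f_nz: "p \<in> D \<Longrightarrow> f p \<noteq> 0"
  using f_pos[of p] by simp

lemma smooth_codazzi_term: "Cinf_on D (codazzi_term f nu lam1)"
proof -
  have "Cinf_on D (\<lambda>p. du nu p + dv lam1 p + 2 * dv f p / f p * lam1 p)"
    by (intro smooth_intros open_D smooth f_nz)
  then show ?thesis by (simp add: codazzi_term_def[abs_def])
qed

lemma smooth_normal: "Cinf_on D normal_u" "Cinf_on D normal_v"
  unfolding normal_u_def[abs_def] normal_v_def[abs_def]
  by (intro smooth_intros open_D smooth smooth_codazzi_term; simp add: mu1_nz lam2_nz)+

lemma smooth_conn: "Cinf_on D conn_u" "Cinf_on D conn_v"
  unfolding conn_u_def[abs_def] conn_v_def[abs_def]
  by (intro smooth_intros open_D smooth smooth_normal f_nz; simp)+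

lemma restrict: "open Q \<Longrightarrow> Q \<subseteq> D \<Longrightarrow> second_type_data Q f nu lam1 mu1 lam2"
  by unfold_locales (use f_pos nu_pos mu1_nz lam2_nz in \<open>blast intro: smooth[THEN Cinf_on_subset]\<close>)+

text \<open>Existence half. The second derivatives of \<open>z\<close> are computed from f x and f
  y, which brings in x_u, x_v and y_v; their normal parts give sigma, from which H and the
  invariants are read off.\<close>

lemma realizes_data_of_frame:
  assumes D: "plane_domain D" "q0 \<in> D"
    and sm: "Cinf_on D x" "Cinf_on D y" "Cinf_on D n1" "Cinf_on D n2"
    and z: "\<And>p. p \<in> D \<Longrightarrow> ((\<lambda>t. z (t, snd p)) has_vector_derivative f p *\<^sub>R x p) (at (fst p))"
      "\<And>p. p \<in> D \<Longrightarrow> ((\<lambda>t. z (fst p, t)) has_vector_derivative f p *\<^sub>R y p) (at (snd p))"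
    and x_u: "\<And>p. p \<in> D \<Longrightarrow> du x p = (du f p / f p) *\<^sub>R x p + (f p * lam1 p) *\<^sub>R n1 p + (f p * mu1 p) *\<^sub>R n2 p"
    and x_v: "\<And>p. p \<in> D \<Longrightarrow> dv x p = - (dv f p / f p) *\<^sub>R x p - (f p * nu p) *\<^sub>R n1 p"
    and y_v: "\<And>p. p \<in> D \<Longrightarrow> dv y p = (dv f p / f p) *\<^sub>R y p + (f p * lam2 p) *\<^sub>R n1 p"
    and fr: "\<And>p. p \<in> D \<Longrightarrow> null_frame (x p) (y p) (n1 p) (n2 p)"
    and init: "z q0 = p0" "x q0 = x0" "y q0 = y0" "n1 q0 = n10" "n2 q0 = n20"
  shows "realizes_data D f nu lam1 mu1 lam2 q0 p0 x0 y0 n10 n20 z"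
proof -
  have du_z: "du z p = f p *\<^sub>R x p" and dv_z: "dv z p = f p *\<^sub>R y p" if "p \<in> D" for p
    using z[OF that] by (auto intro: du_eqI dv_eqI)
  have z_smooth: "Cinf_on D z"
    by (rule Cinf_on_I[OF open_D z]) (simp_all add: Cinf_on_scaleR open_D smooth sm)
  have iso: "isotropic_at z p (f p)" if "p \<in> D" for p
    using fr[OF that] f_pos[OF that]
    by (simp add: isotropic_at_def du_z dv_z that mink_simps null_frame_def power2_eq_square)
  have norm: "mink (n1 p) (du z p) = 0" "mink (n1 p) (dv z p) = 0"
    "mink (n2 p) (du z p) = 0" "mink (n2 p) (dv z p) = 0" if "p \<in> D" for p
    using fr[OF that] by (simp_all add: du_z dv_z that mink_simps null_frame_def mink_commute)
  \<comment> \<open>Tangential part plus normal part, with explicit zero coefficients, to match the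
    premise of \<open>normal_part_eqI\<close>.\<close>
  have z_uu: "du (du z) p = (2 * du f p / f p) *\<^sub>R du z p + 0 *\<^sub>R dv z p
      + (((f p)\<^sup>2 * lam1 p) *\<^sub>R n1 p + ((f p)\<^sup>2 * mu1 p) *\<^sub>R n2 p)"
    and z_uv: "dv (du z) p = 0 *\<^sub>R du z p + 0 *\<^sub>R dv z p + (- ((f p)\<^sup>2 * nu p)) *\<^sub>R n1 p"
    and z_vv: "dv (dv z) p = 0 *\<^sub>R du z p + (2 * dv f p / f p) *\<^sub>R dv z p + ((f p)\<^sup>2 * lam2 p) *\<^sub>R n1 p"
    if p: "p \<in> D" for p
  proof -
    have "du (du z) p = du (\<lambda>q. f q *\<^sub>R x q) p" "dv (du z) p = dv (\<lambda>q. f q *\<^sub>R x q) p"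
      using du_z by (auto intro: du_dv_cong[OF open_D p])
    moreover have "dv (dv z) p = dv (\<lambda>q. f q *\<^sub>R y q) p"
      using dv_z by (auto intro: du_dv_cong[OF open_D p])
    ultimately show "du (du z) p = (2 * du f p / f p) *\<^sub>R du z p + 0 *\<^sub>R dv z p
        + (((f p)\<^sup>2 * lam1 p) *\<^sub>R n1 p + ((f p)\<^sup>2 * mu1 p) *\<^sub>R n2 p)"
      "dv (du z) p = 0 *\<^sub>R du z p + 0 *\<^sub>R dv z p + (- ((f p)\<^sup>2 * nu p)) *\<^sub>R n1 p"
      "dv (dv z) p = 0 *\<^sub>R du z p + (2 * dv f p / f p) *\<^sub>R dv z p + ((f p)\<^sup>2 * lam2 p) *\<^sub>R n1 p"
      using f_nz[OF p]
      by (simp_all add: du_dv_scaleR[OF open_D smooth(1) _ p] sm du_z dv_z x_u x_v y_v p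
          vec_eq_iff power2_eq_square field_simps)
  qed
  have np: "normal_part z p (du (du z) p) = ((f p)\<^sup>2 * lam1 p) *\<^sub>R n1 p + ((f p)\<^sup>2 * mu1 p) *\<^sub>R n2 p"
    "normal_part z p (dv (du z) p) = (- ((f p)\<^sup>2 * nu p)) *\<^sub>R n1 p"
    "normal_part z p (dv (dv z) p) = ((f p)\<^sup>2 * lam2 p) *\<^sub>R n1 p" if p: "p \<in> D" for p
    by (rule normal_part_eqI[OF iso[OF p] _ _ z_uu[OF p]] normal_part_eqI[OF iso[OF p] _ _ z_uv[OF p]]
        normal_part_eqI[OF iso[OF p] _ _ z_vv[OF p]]; simp add: mink_simps norm[OF p])+
  have H: "mean_curvature z p = nu p *\<^sub>R n1 p" if p: "p \<in> D" for p
    using f_nz[OF p] by (simp add: mean_curvature_eq[OF iso[OF p]] np[OF p])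
  have H_norm: "mink_norm (mean_curvature z p) = nu p" if p: "p \<in> D" for p
    using fr[OF p] nu_pos[OF p]
    by (simp add: H[OF p] mink_norm_def mink_simps null_frame_def flip: power2_eq_square)
  have isoD: "isotropic_parameters D z f"
    using iso by (auto simp: isotropic_parameters_def isotropic_at_def)
  have gff: "geometric_frame_field D z f x y n1 n2"
    unfolding geometric_frame_field_def
  proof (rule conjI[OF sm(3)], rule conjI[OF sm(4)], rule ballI)
    fix p assume p: "p \<in> D"
    have "n1 p \<noteq> 0"
      using fr[OF p] by (auto simp: null_frame_def mink_simps)
    then show "mean_curvature z p \<noteq> 0 \<and> x p = (1 / f p) *\<^sub>R du z p \<and> y p = (1 / f p) *\<^sub>R dv z p \<and>
        is_normal z p (n1 p) \<and> is_normal z p (n2 p) \<and>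
        mink (n1 p) (n1 p) = 1 \<and> mink (n2 p) (n2 p) = 1 \<and> mink (n1 p) (n2 p) = 0 \<and>
        mean_curvature z p = mink_norm (mean_curvature z p) *\<^sub>R n1 p"
      using fr[OF p] nu_pos[OF p] f_nz[OF p] norm[OF p]
      by (simp add: H[OF p] H_norm[OF p, unfolded H[OF p]] du_z[OF p] dv_z[OF p] is_normal_iff null_frame_def)
  qed
  have gf: "geometric_functions D z x y n1 n2 nu lam1 mu1 lam2 (\<lambda>_. 0)"
    unfolding geometric_functions_def
  proof (intro ballI conjI)
    fix p assume p: "p \<in> D"
    have xy: "x p = (1 / f p) *\<^sub>R du z p" "y p = (1 / f p) *\<^sub>R dv z p"
      using f_nz[OF p] by (simp_all add: du_z dv_z p)
    show "nu p = mink_norm (mean_curvature z p)" by (simp add: H_norm p)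
    show "second_fund z p (x p) (x p) = lam1 p *\<^sub>R n1 p + mu1 p *\<^sub>R n2 p"
      "second_fund z p (x p) (y p) = - (nu p *\<^sub>R n1 p)"
      "second_fund z p (y p) (y p) = lam2 p *\<^sub>R n1 p + 0 *\<^sub>R n2 p"
      unfolding xy using f_nz[OF p]
      by (simp_all add: second_fund_normalized[OF iso[OF p]] np[OF p] scaleR_add_right)
  qed
  have "timelike_surface D z"
    unfolding timelike_surface_def immersed_surface_def
  proof (intro conjI ballI allI impI)
    fix p assume p: "p \<in> D"
    have *: "mink (du z p) (du z p) = 0" "mink (dv z p) (dv z p) = 0" "mink (du z p) (dv z p) = - ((f p)\<^sup>2)"
      "mink (dv z p) (du z p) = - ((f p)\<^sup>2)"
      using iso[OF p] by (auto simp: isotropic_at_def mink_commute[of "dv z p" "du z p"])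
    \<comment> \<open>These two vectors have squares 2 f^2 and -2 f^2.\<close>
    have "du z p - dv z p \<in> tangent_space z p" "du z p + dv z p \<in> tangent_space z p"
      by (auto simp: tangent_space_def intro: span_add span_diff span_base)
    moreover have "mink (du z p - dv z p) (du z p - dv z p) > 0" "mink (du z p + dv z p) (du z p + dv z p) < 0"
      using f_pos[OF p] by (auto simp: mink_simps *)
    ultimately show "\<exists>X\<in>tangent_space z p. mink X X > 0" "\<exists>Y\<in>tangent_space z p. mink Y Y < 0"
      by blast+
    fix a b assume "a *\<^sub>R du z p + b *\<^sub>R dv z p = 0"
    then show "a = 0" "b = 0"
      using isotropic_at_cancel[OF iso[OF p], of a b 0 0] by auto
  qed (use D z_smooth in auto)
  moreover have "second_type D z"
    unfolding second_type_def using isoD gff gf mu1_nz lam2_nz by blast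
  ultimately show ?thesis
    unfolding realizes_data_def using isoD gff gf init by blast
qed

end

section \<open>From a surface back to the total system\<close>

text \<open>The primed vectors stand for derivatives in either parameter, and \<open>rel\<close>
  lists the ten differentiated Gram relations. Of sixteen inner products they leave six free, the
  parameters of \<open>skew\<close>.\<close>

lemma skew_mult_frame:
  assumes fr: "null_frame x y n1 n2"
    and rel: "mink x' x = 0" "mink y' y = 0" "mink n1' n1 = 0" "mink n2' n2 = 0"
      "mink x y' + mink x' y = 0" "mink x n1' + mink x' n1 = 0" "mink x n2' + mink x' n2 = 0"
      "mink y n1' + mink y' n1 = 0" "mink y n2' + mink y' n2 = 0" "mink n1 n2' + mink n1' n2 = 0"
  shows "vec4 x' y' n1' n2' =
    skew (- mink x' y) (mink x' n1) (mink x' n2) (mink y' n1) (mink y' n2) (mink n1' n2) ** vec4 x y n1 n2"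
proof -
  have c: "mink y' x = - mink x' y" "mink n1' x = - mink x' n1" "mink n2' x = - mink x' n2"
    "mink n1' y = - mink y' n1" "mink n2' y = - mink y' n2" "mink n2' n1 = - mink n1' n2"
    using rel by (simp_all add: eq_neg_iff_add_eq_0 mink_commute)
  show ?thesis
    unfolding skew_mult
    by (subst null_frame_expand[OF fr, of x'], subst null_frame_expand[OF fr, of y'],
        subst null_frame_expand[OF fr, of n1'], subst null_frame_expand[OF fr, of n2'])
       (simp add: c rel)
qed

lemma mink_const_partials:
  assumes "open D" "Cinf_on D g" "Cinf_on D h" "p \<in> D" "\<And>q. q \<in> D \<Longrightarrow> mink (g q) (h q) = c"
  shows "mink (g p) (du h p) + mink (du g p) (h p) = 0" "mink (g p) (dv h p) + mink (dv g p) (h p) = 0"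
proof -
  have "du (\<lambda>q. mink (g q) (h q)) p = du (\<lambda>_. c) p" "dv (\<lambda>q. mink (g q) (h q)) p = dv (\<lambda>_. c) p"
    by (rule du_dv_cong[OF assms(1,4,5)]; simp)+
  moreover have "du (\<lambda>_. c) p = 0" "dv (\<lambda>_. c) p = 0"
    by (auto intro: du_eqI dv_eqI)
  ultimately show "mink (g p) (du h p) + mink (du g p) (h p) = 0" "mink (g p) (dv h p) + mink (dv g p) (h p) = 0"
    by (simp_all add: du_dv_mink[OF assms(1-4)])
qed

lemma mink_normal_part:
  assumes "isotropic_at z p k" "mink n (du z p) = 0" "mink n (dv z p) = 0"
  shows "mink (normal_part z p X) n = mink X n"
proof -
  obtain a b where "X = a *\<^sub>R du z p + b *\<^sub>R dv z p + normal_part z p X"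
    using normal_part_decomp[OF assms(1)] by blast
  then have "mink X n = mink (a *\<^sub>R du z p + b *\<^sub>R dv z p + normal_part z p X) n" by simp
  then show ?thesis
    using assms(2,3) by (simp add: mink_simps mink_commute[of _ n])
qed

context second_type_data
begin

text \<open>Uniqueness half: the surface determines every matrix entry. Isotropy gives the
  tangential entries, the second fundamental form the mixed ones, and symmetry of the mixed partials
  of x and y the normal connection.\<close>

lemma frame_of_realizes_data:
  assumes R: "realizes_data D f nu lam1 mu1 lam2 q0 p0 x0 y0 n10 n20 w" and q0: "q0 \<in> D"
  obtains F where "Cinf_on D F" "F q0 = vec4 x0 y0 n10 n20"
    "\<And>p. p \<in> D \<Longrightarrow> du F p = conn_u p ** F p" "\<And>p. p \<in> D \<Longrightarrow> dv F p = conn_v p ** F p"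
    "\<And>p. p \<in> D \<Longrightarrow> du w p = f p *\<^sub>R F p $ 1" "\<And>p. p \<in> D \<Longrightarrow> dv w p = f p *\<^sub>R F p $ 2"
    "Cinf_on D w" "w q0 = p0"
proof -
  obtain x y n1 n2 where tl: "timelike_surface D w" and iso: "isotropic_parameters D w f" and w0: "w q0 = p0"
    and gff: "geometric_frame_field D w f x y n1 n2"
    and gf: "geometric_functions D w x y n1 n2 nu lam1 mu1 lam2 (\<lambda>_. 0)"
    and init: "x q0 = x0" "y q0 = y0" "n1 q0 = n10" "n2 q0 = n20"
    using R unfolding realizes_data_def by blast
  have w_smooth: "Cinf_on D w"
    using tl by (auto simp: timelike_surface_def immersed_surface_def)
  have isoat: "isotropic_at w p (f p)" if "p \<in> D" for p
    using iso that by (auto simp: isotropic_parameters_def isotropic_at_def)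
  have xy: "x p = (1 / f p) *\<^sub>R du w p" "y p = (1 / f p) *\<^sub>R dv w p" if "p \<in> D" for p
    using gff that by (auto simp: geometric_frame_field_def)
  have du_w: "du w p = f p *\<^sub>R x p" and dv_w: "dv w p = f p *\<^sub>R y p" if "p \<in> D" for p
    using f_nz[OF that] by (simp_all add: xy that)
  have sm: "Cinf_on D n1" "Cinf_on D n2"
    using gff by (auto simp: geometric_frame_field_def)
  have "Cinf_on D (\<lambda>p. (1 / f p) *\<^sub>R du w p)" "Cinf_on D (\<lambda>p. (1 / f p) *\<^sub>R dv w p)"
    by (intro smooth_intros open_D smooth w_smooth f_nz; simp)+
  then have smx: "Cinf_on D x" "Cinf_on D y"
    by (rule_tac [!] Cinf_on_cong[OF open_D, rotated]) (simp_all add: xy)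
  have norm: "mink (n1 p) (du w p) = 0" "mink (n1 p) (dv w p) = 0"
    "mink (n2 p) (du w p) = 0" "mink (n2 p) (dv w p) = 0" if "p \<in> D" for p
    using gff that by (auto simp: geometric_frame_field_def is_normal_iff)
  have fr: "null_frame (x p) (y p) (n1 p) (n2 p)" if "p \<in> D" for p
  proof -
    have "mink (n1 p) (n1 p) = 1" "mink (n2 p) (n2 p) = 1" "mink (n1 p) (n2 p) = 0"
      using gff that by (auto simp: geometric_frame_field_def)
    then show ?thesis
      using isoat[OF that] norm[OF that] f_nz[OF that]
      by (simp add: null_frame_def xy[OF that] mink_simps isotropic_at_def power2_eq_square
          mink_commute[of "du w p" "n1 p"] mink_commute[of "du w p" "n2 p"]
          mink_commute[of "dv w p" "n1 p"] mink_commute[of "dv w p" "n2 p"])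
  qed
  note frD = fr[unfolded null_frame_def]
  have sf: "normal_part w p (du (du w) p) = (f p)\<^sup>2 *\<^sub>R (lam1 p *\<^sub>R n1 p + mu1 p *\<^sub>R n2 p)"
    "normal_part w p (dv (du w) p) = (f p)\<^sup>2 *\<^sub>R (- (nu p *\<^sub>R n1 p))"
    "normal_part w p (dv (dv w) p) = (f p)\<^sup>2 *\<^sub>R (lam2 p *\<^sub>R n1 p)" if p: "p \<in> D" for p
  proof -
    have "second_fund w p (x p) (x p) = lam1 p *\<^sub>R n1 p + mu1 p *\<^sub>R n2 p"
      "second_fund w p (x p) (y p) = - (nu p *\<^sub>R n1 p)"
      "second_fund w p (y p) (y p) = lam2 p *\<^sub>R n1 p"
      using gf p by (auto simp: geometric_functions_def)
    note this[symmetric, unfolded xy[OF p] second_fund_normalized[OF isoat[OF p]]]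
    then show "normal_part w p (du (du w) p) = (f p)\<^sup>2 *\<^sub>R (lam1 p *\<^sub>R n1 p + mu1 p *\<^sub>R n2 p)"
      "normal_part w p (dv (du w) p) = (f p)\<^sup>2 *\<^sub>R (- (nu p *\<^sub>R n1 p))"
      "normal_part w p (dv (dv w) p) = (f p)\<^sup>2 *\<^sub>R (lam2 p *\<^sub>R n1 p)"
      using f_nz[OF p] by simp_all
  qed
  \<comment> \<open>The mixed derivative is recorded twice, through x and through y, so that both
    x_v and y_u can be read off from the same vector.\<close>
  have w2: "du (du w) p = f p *\<^sub>R du x p + du f p *\<^sub>R x p" "dv (du w) p = f p *\<^sub>R dv x p + dv f p *\<^sub>R x p"
    "dv (du w) p = f p *\<^sub>R du y p + du f p *\<^sub>R y p" "dv (dv w) p = f p *\<^sub>R dv y p + dv f p *\<^sub>R y p"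
    if p: "p \<in> D" for p
  proof -
    have "du (du w) p = du (\<lambda>q. f q *\<^sub>R x q) p" "dv (du w) p = dv (\<lambda>q. f q *\<^sub>R x q) p"
      using du_w by (auto intro: du_dv_cong[OF open_D p])
    moreover have "du (dv w) p = du (\<lambda>q. f q *\<^sub>R y q) p" "dv (dv w) p = dv (\<lambda>q. f q *\<^sub>R y q) p"
      using dv_w by (auto intro: du_dv_cong[OF open_D p])
    ultimately show "du (du w) p = f p *\<^sub>R du x p + du f p *\<^sub>R x p" "dv (du w) p = f p *\<^sub>R dv x p + dv f p *\<^sub>R x p"
      "dv (du w) p = f p *\<^sub>R du y p + du f p *\<^sub>R y p" "dv (dv w) p = f p *\<^sub>R dv y p + dv f p *\<^sub>R y p"
      using dv_du_commute[OF open_D w_smooth p]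
      by (simp_all add: du_dv_scaleR[OF open_D smooth(1) _ p] smx)
  qed
  have sff: "mink (du x p) (n1 p) = f p * lam1 p" "mink (du x p) (n2 p) = f p * mu1 p"
    "mink (dv x p) (n1 p) = - (f p * nu p)" "mink (dv x p) (n2 p) = 0"
    "mink (du y p) (n1 p) = - (f p * nu p)" "mink (du y p) (n2 p) = 0"
    "mink (dv y p) (n1 p) = f p * lam2 p" "mink (dv y p) (n2 p) = 0" if p: "p \<in> D" for p
  proof -
    note np1 = mink_normal_part[OF isoat[OF p] norm(1,2)[OF p]]
    note np2 = mink_normal_part[OF isoat[OF p] norm(3,4)[OF p]]
    note fr' = frD[OF p] mink_commute[of "n2 p" "n1 p"]
    have "mink (du (du w) p) (n1 p) = f p * (f p * lam1 p)" "mink (dv (du w) p) (n1 p) = f p * (- (f p * nu p))"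
      "mink (dv (dv w) p) (n1 p) = f p * (f p * lam2 p)"
      using np1[of "du (du w) p"] np1[of "dv (du w) p"] np1[of "dv (dv w) p"] fr'
      by (simp_all add: sf[OF p] mink_simps power2_eq_square)
    moreover have "mink (du (du w) p) (n2 p) = f p * (f p * mu1 p)" "mink (dv (du w) p) (n2 p) = f p * 0"
      "mink (dv (dv w) p) (n2 p) = f p * 0"
      using np2[of "du (du w) p"] np2[of "dv (du w) p"] np2[of "dv (dv w) p"] fr'
      by (simp_all add: sf[OF p] mink_simps power2_eq_square)
    moreover have "mink (du (du w) p) n = f p * mink (du x p) n" "mink (dv (du w) p) n = f p * mink (dv x p) n"
      "mink (dv (du w) p) n = f p * mink (du y p) n" "mink (dv (dv w) p) n = f p * mink (dv y p) n"
      if "n = n1 p \<or> n = n2 p" for n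
    proof -
      have "mink (x p) n = 0" "mink (y p) n = 0" using that fr' by auto
      then show "mink (du (du w) p) n = f p * mink (du x p) n" "mink (dv (dv w) p) n = f p * mink (dv y p) n"
        "mink (dv (du w) p) n = f p * mink (dv x p) n" "mink (dv (du w) p) n = f p * mink (du y p) n"
        using arg_cong[OF w2(2)[OF p], of "\<lambda>X. mink X n"] arg_cong[OF w2(3)[OF p], of "\<lambda>X. mink X n"]
          arg_cong[OF w2(1)[OF p], of "\<lambda>X. mink X n"] arg_cong[OF w2(4)[OF p], of "\<lambda>X. mink X n"]
        by (simp_all only: mink_simps) auto
    qed
    ultimately show "mink (du x p) (n1 p) = f p * lam1 p" "mink (du x p) (n2 p) = f p * mu1 p"
      "mink (dv x p) (n1 p) = - (f p * nu p)" "mink (dv x p) (n2 p) = 0"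
      "mink (du y p) (n1 p) = - (f p * nu p)" "mink (du y p) (n2 p) = 0"
      "mink (dv y p) (n1 p) = f p * lam2 p" "mink (dv y p) (n2 p) = 0"
      using f_nz[OF p] mult_left_cancel[of "f p"] by metis+
  qed
  have rel_u: "mink (x p) (du x p) + mink (du x p) (x p) = 0" "mink (y p) (du y p) + mink (du y p) (y p) = 0"
      "mink (n1 p) (du n1 p) + mink (du n1 p) (n1 p) = 0" "mink (n2 p) (du n2 p) + mink (du n2 p) (n2 p) = 0"
      "mink (x p) (du y p) + mink (du x p) (y p) = 0" "mink (x p) (du n1 p) + mink (du x p) (n1 p) = 0"
      "mink (x p) (du n2 p) + mink (du x p) (n2 p) = 0" "mink (y p) (du n1 p) + mink (du y p) (n1 p) = 0"
      "mink (y p) (du n2 p) + mink (du y p) (n2 p) = 0" "mink (n1 p) (du n2 p) + mink (du n1 p) (n2 p) = 0"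
    and rel_v: "mink (x p) (dv x p) + mink (dv x p) (x p) = 0" "mink (y p) (dv y p) + mink (dv y p) (y p) = 0"
      "mink (n1 p) (dv n1 p) + mink (dv n1 p) (n1 p) = 0" "mink (n2 p) (dv n2 p) + mink (dv n2 p) (n2 p) = 0"
      "mink (x p) (dv y p) + mink (dv x p) (y p) = 0" "mink (x p) (dv n1 p) + mink (dv x p) (n1 p) = 0"
      "mink (x p) (dv n2 p) + mink (dv x p) (n2 p) = 0" "mink (y p) (dv n1 p) + mink (dv y p) (n1 p) = 0"
      "mink (y p) (dv n2 p) + mink (dv y p) (n2 p) = 0" "mink (n1 p) (dv n2 p) + mink (dv n1 p) (n2 p) = 0"
    if p: "p \<in> D" for p
    by (rule mink_const_partials[OF open_D _ _ p], (rule smx sm)+, drule frD, elim conjE, assumption)+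
  \<comment> \<open>Differentiating <w_u, w_u> = 0 in v and <w_v, w_v> = 0 in u shows that w_uv is
    normal; its two expressions in \<open>w2\<close> then yield the tangential entries.\<close>
  have tang: "mink (du x p) (y p) = - (du f p / f p)" "mink (dv x p) (y p) = dv f p / f p" if p: "p \<in> D" for p
  proof -
    have "mink (du w q) (du w q) = 0" "mink (dv w q) (dv w q) = 0" if "q \<in> D" for q
      using isoat[OF that] by (auto simp: isotropic_at_def)
    note iso_const = this
    have "mink (du w p) (dv (du w) p) + mink (dv (du w) p) (du w p) = 0"
      "mink (dv w p) (du (dv w) p) + mink (du (dv w) p) (dv w p) = 0"
      by (rule mink_const_partials(2)[where g = "du w" and h = "du w", OF open_D _ _ p iso_const(1)]
          mink_const_partials(1)[where g = "dv w" and h = "dv w", OF open_D _ _ p iso_const(2)]; simp add: Cinf_on_du Cinf_on_dv w_smooth)+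
    then have "mink (dv (du w) p) (du w p) = 0" "mink (dv (du w) p) (dv w p) = 0"
      using dv_du_commute[OF open_D w_smooth p] mink_commute[of "dv (du w) p" "du w p"] mink_commute[of "dv (du w) p" "dv w p"] by auto
    then have "mink (f p *\<^sub>R du y p + du f p *\<^sub>R y p) (x p) = 0" "mink (f p *\<^sub>R dv x p + dv f p *\<^sub>R x p) (y p) = 0"
      using f_nz[OF p] w2(2,3)[OF p] by (simp_all add: du_w dv_w p mink_simps)
    then have "f p * mink (du y p) (x p) = du f p" "f p * mink (dv x p) (y p) = dv f p"
      using frD[OF p] mink_commute[of "y p" "x p"] by (simp_all add: mink_simps)
    moreover have "mink (du x p) (y p) = - mink (du y p) (x p)"
      using rel_u(5)[OF p] mink_commute[of "x p" "du y p"] by linarith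
    ultimately show "mink (du x p) (y p) = - (du f p / f p)" "mink (dv x p) (y p) = dv f p / f p"
      using f_nz[OF p] by (simp_all add: divide_simps mult.commute)
  qed
  define b1 where "b1 p = mink (du n1 p) (n2 p)" for p
  define b2 where "b2 p = mink (dv n1 p) (n2 p)" for p
  define F where "F p = vec4 (x p) (y p) (n1 p) (n2 p)" for p
  have F_smooth: "Cinf_on D F"
    unfolding F_def by (intro smooth_intros open_D smx sm)
  have F_u: "vec4 (du x p) (du y p) (du n1 p) (du n2 p) =
      skew (du f p / f p) (f p * lam1 p) (f p * mu1 p) (- (f p * nu p)) 0 (b1 p) ** F p"
    and F_v: "vec4 (dv x p) (dv y p) (dv n1 p) (dv n2 p) =
      skew (- (dv f p / f p)) (- (f p * nu p)) 0 (f p * lam2 p) 0 (b2 p) ** F p" if p: "p \<in> D" for p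
  proof -
    have "mink (du x p) (x p) = 0" "mink (du y p) (y p) = 0" "mink (du n1 p) (n1 p) = 0" "mink (du n2 p) (n2 p) = 0"
      "mink (dv x p) (x p) = 0" "mink (dv y p) (y p) = 0" "mink (dv n1 p) (n1 p) = 0" "mink (dv n2 p) (n2 p) = 0"
      using rel_u(1-4)[OF p] rel_v(1-4)[OF p]
      by (simp_all add: mink_commute[of "x p" "du x p"] mink_commute[of "y p" "du y p"]
          mink_commute[of "n1 p" "du n1 p"] mink_commute[of "n2 p" "du n2 p"]
          mink_commute[of "x p" "dv x p"] mink_commute[of "y p" "dv y p"]
          mink_commute[of "n1 p" "dv n1 p"] mink_commute[of "n2 p" "dv n2 p"])
    from skew_mult_frame[OF fr[OF p] this(1-4) rel_u(5-10)[OF p]]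
      skew_mult_frame[OF fr[OF p] this(5-8) rel_v(5-10)[OF p]]
    show "vec4 (du x p) (du y p) (du n1 p) (du n2 p) =
        skew (du f p / f p) (f p * lam1 p) (f p * mu1 p) (- (f p * nu p)) 0 (b1 p) ** F p"
      "vec4 (dv x p) (dv y p) (dv n1 p) (dv n2 p) =
        skew (- (dv f p / f p)) (- (f p * nu p)) 0 (f p * lam2 p) 0 (b2 p) ** F p"
      by (simp_all add: sff[OF p] tang[OF p] b1_def b2_def F_def)
  qed
  note rows_u = F_u[unfolded F_def skew_mult vec4_eq_iff] and rows_v = F_v[unfolded F_def skew_mult vec4_eq_iff]
  \<comment> \<open>Codazzi, n1-component for x: differentiate <x_u, n1> in v and <x_v, n1> in u and
    equate the mixed derivatives of x. The unknown carries the factor f mu1, hence the division by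
    \<open>mu1\<close>.\<close>
  have b2: "b2 p = normal_v p" if p: "p \<in> D" for p
  proof -
    have "dv (\<lambda>q. mink (du x q) (n1 q)) p = dv (\<lambda>q. f q * lam1 q) p"
      "du (\<lambda>q. mink (dv x q) (n1 q)) p = du (\<lambda>q. - (f q * nu q)) p"
      using sff by (auto intro: du_dv_cong[OF open_D p])
    then have "mink (du x p) (dv n1 p) + mink (dv (du x) p) (n1 p) = f p * dv lam1 p + dv f p * lam1 p"
      "mink (dv x p) (du n1 p) + mink (du (dv x) p) (n1 p) = - (f p * du nu p + du f p * nu p)"
      by (simp_all add: du_dv_mink[OF open_D _ _ p] du_dv_minus[OF open_D _ p] du_dv_mult[OF open_D _ _ p]
          Cinf_on_mult Cinf_on_du Cinf_on_dv smx sm smooth open_D)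
    moreover have "mink (du x p) (dv n1 p) = du f p * nu p + f p * mu1 p * b2 p"
      "mink (dv x p) (du n1 p) = dv f p * lam1 p"
      using rows_u[OF p] rows_v[OF p] frD[OF p] mink_commute[of "n1 p" "x p"] mink_commute[of "n1 p" "y p"]
        mink_commute[of "n2 p" "x p"] mink_commute[of "n2 p" "y p"] mink_commute[of "y p" "x p"]
        mink_commute[of "n2 p" "n1 p"] f_nz[OF p]
      by (simp_all add: mink_simps)
    ultimately have "f p * mu1 p * b2 p = f p * (du nu p + dv lam1 p) + 2 * dv f p * lam1 p"
      using dv_du_commute[OF open_D smx(1) p] by (simp add: algebra_simps)
    also have "\<dots> = f p * codazzi_term f nu lam1 p"
      using f_nz[OF p] by (simp add: codazzi_term_def field_simps)
    finally show ?thesis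
      using f_nz[OF p] mu1_nz[OF p] by (simp add: normal_v_def field_simps)
  qed
  \<comment> \<open>Codazzi, n2-component for y: both <y_u, n2> and <y_v, n2> vanish, which leaves
    nu b2 + lam2 b1 = 0, to be divided by \<open>lam2\<close>.\<close>
  have b1: "b1 p = normal_u p" if p: "p \<in> D" for p
  proof -
    have "dv (\<lambda>q. mink (du y q) (n2 q)) p = dv (\<lambda>_. 0) p" "du (\<lambda>q. mink (dv y q) (n2 q)) p = du (\<lambda>_. 0) p"
      using sff by (auto intro: du_dv_cong[OF open_D p])
    moreover have "dv (\<lambda>_. 0 :: real) p = 0" "du (\<lambda>_. 0 :: real) p = 0"
      by (auto intro: du_eqI dv_eqI)
    ultimately have "mink (du y p) (dv n2 p) + mink (dv (du y) p) (n2 p) = 0"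
      "mink (dv y p) (du n2 p) + mink (du (dv y) p) (n2 p) = 0"
      by (simp_all add: du_dv_mink[OF open_D _ _ p] Cinf_on_du Cinf_on_dv smx sm)
    moreover have "mink (du y p) (dv n2 p) = f p * nu p * b2 p" "mink (dv y p) (du n2 p) = - (f p * lam2 p * b1 p)"
      using rows_u[OF p] rows_v[OF p] frD[OF p] mink_commute[of "n1 p" "x p"] mink_commute[of "n1 p" "y p"]
        mink_commute[of "n2 p" "x p"] mink_commute[of "n2 p" "y p"] mink_commute[of "y p" "x p"]
        mink_commute[of "n2 p" "n1 p"] f_nz[OF p]
      by (simp_all add: mink_simps)
    ultimately have "f p * (nu p * b2 p + lam2 p * b1 p) = 0"
      using dv_du_commute[OF open_D smx(2) p] by (simp add: algebra_simps)
    then have "nu p * b2 p = - (lam2 p * b1 p)"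
      using f_nz[OF p] by (simp add: eq_neg_iff_add_eq_0)
    then show ?thesis
      using lam2_nz[OF p] mu1_nz[OF p] by (simp add: b2[OF p] normal_u_def normal_v_def field_simps)
  qed
  have "du F p = conn_u p ** F p" "dv F p = conn_v p ** F p" if p: "p \<in> D" for p
  proof -
    have "du F p = vec4 (du x p) (du y p) (du n1 p) (du n2 p)" "dv F p = vec4 (dv x p) (dv y p) (dv n1 p) (dv n2 p)"
      unfolding F_def
      by (rule du_eqI dv_eqI, intro has_vector_derivative_vec4 Cinf_on_partials[OF open_D _ p] smx sm)+
    then show "du F p = conn_u p ** F p" "dv F p = conn_v p ** F p"
      using F_u[OF p] F_v[OF p] b1[OF p] b2[OF p] by (simp_all add: conn_u_def conn_v_def)
  qed
  then show ?thesis
    by (intro that[of F] F_smooth w_smooth w0) (simp_all add: F_def init du_w dv_w)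
qed

end

section \<open>Gauss, Codazzi and Ricci equations as compatibility of the system\<close>

context second_type_data
begin

lemma smooth_ln_sq: "Cinf_on D (ln_sq f)"
proof (rule Cinf_on_I[OF open_D, where gu = "\<lambda>p. 2 * du f p / f p" and gv = "\<lambda>p. 2 * dv f p / f p"])
  show "((\<lambda>t. ln_sq f (t, snd p)) has_vector_derivative 2 * du f p / f p) (at (fst p))"
    "((\<lambda>t. ln_sq f (fst p, t)) has_vector_derivative 2 * dv f p / f p) (at (snd p))" if p: "p \<in> D" for p
    using has_real_derivative_ln_sq[OF has_derivative_slices_real(1)[OF open_D smooth(1) p]]
      has_real_derivative_ln_sq[OF has_derivative_slices_real(2)[OF open_D smooth(1) p]] f_nz[OF p]
    by (simp_all flip: has_real_derivative_iff_has_vector_derivative)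
qed (intro smooth_intros open_D smooth f_nz; simp)+

text \<open>Returns from the expanded quotient to ln(f^2) and orders the mixed derivatives as in
  condition (iv), whose first two brackets these derivatives are.\<close>

lemma codazzi_term_partials:
  assumes p: "p \<in> D"
  shows "du (codazzi_term f nu lam1) p = du (du nu) p + dv (du lam1) p
      + du lam1 p * dv (ln_sq f) p + lam1 p * dv (du (ln_sq f)) p"
    "dv (codazzi_term f nu lam1) p = dv (du nu) p + dv (dv lam1) p
      + dv lam1 p * dv (ln_sq f) p + lam1 p * dv (dv (ln_sq f)) p"
proof -
  have "codazzi_term f nu lam1 q = (du nu q + dv lam1 q) + dv (ln_sq f) q * lam1 q" if "q \<in> D" for q
    using du_dv_ln_sq[OF open_D smooth(1) that f_nz[OF that]] by (simp add: codazzi_term_def)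
  then have "du (codazzi_term f nu lam1) p = du (\<lambda>q. (du nu q + dv lam1 q) + dv (ln_sq f) q * lam1 q) p"
    "dv (codazzi_term f nu lam1) p = dv (\<lambda>q. (du nu q + dv lam1 q) + dv (ln_sq f) q * lam1 q) p"
    by (auto intro: du_dv_cong[OF open_D p])
  moreover have "du (\<lambda>q. (du nu q + dv lam1 q) + dv (ln_sq f) q * lam1 q) p =
      (du (du nu) p + du (dv lam1) p) + (dv (ln_sq f) p * du lam1 p + du (dv (ln_sq f)) p * lam1 p)"
    "dv (\<lambda>q. (du nu q + dv lam1 q) + dv (ln_sq f) q * lam1 q) p =
      (dv (du nu) p + dv (dv lam1) p) + (dv (ln_sq f) p * dv lam1 p + dv (dv (ln_sq f)) p * lam1 p)"
    by (simp_all add: du_dv_add[OF open_D _ _ p] du_dv_mult[OF open_D _ _ p] Cinf_on_add Cinf_on_mult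
        Cinf_on_du Cinf_on_dv smooth smooth_ln_sq open_D)
  ultimately show "du (codazzi_term f nu lam1) p = du (du nu) p + dv (du lam1) p
      + du lam1 p * dv (ln_sq f) p + lam1 p * dv (du (ln_sq f)) p"
    "dv (codazzi_term f nu lam1) p = dv (du nu) p + dv (dv lam1) p
      + dv lam1 p * dv (ln_sq f) p + lam1 p * dv (dv (ln_sq f)) p"
    using dv_du_commute[OF open_D smooth(3) p] dv_du_commute[OF open_D smooth_ln_sq p]
    by (simp_all add: algebra_simps)
qed

text \<open>Of the six equations of \<open>skew_compatible\<close>, the one for \<open>a\<close> is
  (iii), for \<open>m\<close> (ii), for \<open>k\<close> (i) and for \<open>b\<close> (iv); those
  for \<open>l\<close> and \<open>h\<close> are identities by the choice of \<open>normal_v\<close>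
  and \<open>normal_u\<close>.\<close>

lemma conn_compatible:
  assumes p: "p \<in> D"
    and i: "du lam2 p + dv nu p + du (ln_sq f) p * lam2 p = 0"
    and ii: "dv mu1 p + dv (ln_sq f) p * mu1 p
        - ((nu p)^2 - lam1 p * lam2 p) / (lam2 p * mu1 p)
            * (du nu p + dv lam1 p + dv (ln_sq f) p * lam1 p) = 0"
    and iii: "(2 * f p * dv (du f) p - 2 * du f p * dv f p) / (f p)^4
        - ((nu p)^2 - lam1 p * lam2 p) = 0"
    and iv: "lam2 p * (du (du nu) p + dv (du lam1) p
                + du lam1 p * dv (ln_sq f) p + lam1 p * dv (du (ln_sq f)) p)
        + nu p * (dv (du nu) p + dv (dv lam1) p
                + dv lam1 p * dv (ln_sq f) p + lam1 p * dv (dv (ln_sq f)) p)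
        + (f p)^2 * (mu1 p)^2 * (lam2 p)^2
        - (du nu p + dv lam1 p + lam1 p * dv (ln_sq f) p)
            * (lam2 p * du (ln_abs mu1) p - dv nu p
                + nu p * dv (ln_abs mu1) p + nu p * dv (ln_abs lam2) p) = 0"
  shows "dv conn_u p + conn_u p ** conn_v p = du conn_v p + conn_v p ** conn_u p"
proof -
  define A where "A = codazzi_term f nu lam1 p"
  note nz = f_nz[OF p] mu1_nz[OF p] lam2_nz[OF p]
  note lnf = du_dv_ln_sq[OF open_D smooth(1) p nz(1)]
  have A: "A = du nu p + dv lam1 p + 2 * dv f p / f p * lam1 p"
    by (simp add: A_def codazzi_term_def)
  have uv: "du (dv f) p = dv (du f) p" by (simp add: dv_du_commute[OF open_D smooth(1) p])
  have ii': "dv mu1 p + 2 * dv f p / f p * mu1 p - ((nu p)\<^sup>2 - lam1 p * lam2 p) / (lam2 p * mu1 p) * A = 0"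
    using ii by (simp add: A lnf)
  have iv': "lam2 p * du (codazzi_term f nu lam1) p + nu p * dv (codazzi_term f nu lam1) p
      + (f p)\<^sup>2 * (mu1 p)\<^sup>2 * (lam2 p)\<^sup>2
      - A * (lam2 p * (du mu1 p / mu1 p) - dv nu p + nu p * (dv mu1 p / mu1 p) + nu p * (dv lam2 p / lam2 p)) = 0"
    using iv du_dv_ln_abs[OF open_D smooth(4) p nz(2)] du_dv_ln_abs[OF open_D smooth(5) p nz(3)]
    by (simp add: codazzi_term_partials[OF p] A lnf mult.commute[of "lam1 p" "2 * dv f p / f p"])
  have z: "du (\<lambda>_. 0 :: real) p = 0" "dv (\<lambda>_. 0 :: real) p = 0"
    by (auto intro: du_eqI dv_eqI)
  have fm: "dv (\<lambda>q. f q * g q) p = f p * dv g p + dv f p * g p" "du (\<lambda>q. f q * g q) p = f p * du g p + du f p * g p"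
    if "Cinf_on D g" for g
    by (rule du_dv_mult[OF open_D smooth(1) that p])+
  have fnu: "dv (\<lambda>q. - (f q * nu q)) p = - (f p * dv nu p + dv f p * nu p)"
    "du (\<lambda>q. - (f q * nu q)) p = - (f p * du nu p + du f p * nu p)"
    by (simp_all add: du_dv_minus[OF open_D _ p] Cinf_on_mult open_D smooth fm)
  have lf: "dv (\<lambda>q. du f q / f q) p = (dv (du f) p * f p - du f p * dv f p) / (f p)\<^sup>2"
    "du (\<lambda>q. - (dv f q / f q)) p = - ((dv (du f) p * f p - dv f p * du f p) / (f p)\<^sup>2)"
    by (simp_all add: du_dv_minus[OF open_D _ p] du_dv_divide[OF open_D _ _ p] nz Cinf_on_divide
        Cinf_on_du Cinf_on_dv open_D smooth f_nz uv)
  have nv: "du normal_v p = (du (codazzi_term f nu lam1) p * mu1 p - A * du mu1 p) / (mu1 p)\<^sup>2"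
    unfolding normal_v_def[abs_def] A_def
    by (simp add: du_dv_divide[OF open_D smooth_codazzi_term smooth(4) p] nz)
  have nu: "dv normal_u p = - (((nu p * dv (codazzi_term f nu lam1) p + dv nu p * A) * (lam2 p * mu1 p)
      - nu p * A * (lam2 p * dv mu1 p + dv lam2 p * mu1 p)) / (lam2 p * mu1 p)\<^sup>2)"
    unfolding normal_u_def[abs_def] A_def using nz
    by (simp add: du_dv_minus[OF open_D _ p] du_dv_divide[OF open_D _ _ p] du_dv_mult[OF open_D _ _ p]
        Cinf_on_divide Cinf_on_mult smooth_codazzi_term open_D smooth mu1_nz lam2_nz)
  have du_conn: "dv conn_u p = skew (dv (\<lambda>q. du f q / f q) p) (dv (\<lambda>q. f q * lam1 q) p) (dv (\<lambda>q. f q * mu1 q) p)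
      (dv (\<lambda>q. - (f q * nu q)) p) (dv (\<lambda>_. 0) p) (dv normal_u p)"
    unfolding conn_u_def[abs_def]
    by (rule du_dv_skew(2)[OF open_D p]) (intro smooth_intros open_D smooth smooth_normal f_nz; simp)+
  have dv_conn: "du conn_v p = skew (du (\<lambda>q. - (dv f q / f q)) p) (du (\<lambda>q. - (f q * nu q)) p) (du (\<lambda>_. 0) p)
      (du (\<lambda>q. f q * lam2 q) p) (du (\<lambda>_. 0) p) (du normal_v p)"
    unfolding conn_v_def[abs_def]
    by (rule du_dv_skew(1)[OF open_D p]) (intro smooth_intros open_D smooth smooth_normal f_nz; simp)+
  have nN: "normal_u p = - (nu p * A / (lam2 p * mu1 p))" "normal_v p = A / mu1 p"
    by (simp_all add: normal_u_def normal_v_def A_def)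
  show ?thesis
    unfolding du_conn dv_conn unfolding conn_u_def conn_v_def fm[OF smooth(3)] fm[OF smooth(4)] fm[OF smooth(5)] fnu lf z
  proof (rule skew_compatible)
    \<comment> \<open>X / f^2 is the mixed derivative of ln f, so (iii) is the Gauss equation 2 (ln
      f)_uv = f^2 (nu^2 - lam1 lam2).\<close>
    define X where "X = dv (du f) p * f p - du f p * dv f p"
    have "2 * X / (f p)^4 = (nu p)\<^sup>2 - lam1 p * lam2 p"
      using iii by (simp add: X_def algebra_simps)
    then have "2 * X = (f p)^4 * ((nu p)\<^sup>2 - lam1 p * lam2 p)"
      using nz(1) by (simp add: field_simps)
    then have "2 * (X / (f p)\<^sup>2) = (f p)\<^sup>2 * ((nu p)\<^sup>2 - lam1 p * lam2 p)"
      using nz(1) by (simp add: field_simps power2_eq_square power4_eq_xxxx)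
    then show "(dv (du f) p * f p - du f p * dv f p) / (f p)\<^sup>2 + f p * lam1 p * (f p * lam2 p) + f p * mu1 p * 0 =
        - ((dv (du f) p * f p - dv f p * du f p) / (f p)\<^sup>2) + - (f p * nu p) * - (f p * nu p) + 0 * 0"
      unfolding X_def by (simp add: algebra_simps power2_eq_square)
    show "f p * dv lam1 p + dv f p * lam1 p + du f p / f p * - (f p * nu p) - f p * mu1 p * normal_v p =
        - (f p * du nu p + du f p * nu p) + - (dv f p / f p) * (f p * lam1 p) - 0 * normal_u p"
      using nz by (simp add: nN A field_simps)
    \<comment> \<open>The two sides of the \<open>m\<close>-equation differ by \<open>f p\<close>
      times the left-hand side of (ii).\<close>
    have "f p * dv mu1 p + dv f p * mu1 p + f p * lam1 p * normal_v p
        - (- (dv f p / f p) * (f p * mu1 p) + - (f p * nu p) * normal_u p) =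
        f p * (dv mu1 p + 2 * dv f p / f p * mu1 p - ((nu p)\<^sup>2 - lam1 p * lam2 p) / (lam2 p * mu1 p) * A)"
      using nz by (simp add: nN field_simps power2_eq_square)
    then show "f p * dv mu1 p + dv f p * mu1 p + du f p / f p * 0 + f p * lam1 p * normal_v p =
        0 + - (dv f p / f p) * (f p * mu1 p) + - (f p * nu p) * normal_u p"
      unfolding ii' by simp
    have "f p * (du lam2 p + dv nu p + 2 * du f p / f p * lam2 p) = 0"
      using i by (simp add: lnf)
    then have "f p * du lam2 p + f p * dv nu p + 2 * du f p * lam2 p = 0"
      using nz by (simp add: distrib_left)
    then show "- (f p * dv nu p + dv f p * nu p) - du f p / f p * (f p * lam2 p) - 0 * normal_v p =
        f p * du lam2 p + du f p * lam2 p - - (dv f p / f p) * - (f p * nu p) - 0 * normal_u p"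
      using nz by (simp add: field_simps)
    show "0 - du f p / f p * 0 + - (f p * nu p) * normal_v p = 0 - - (dv f p / f p) * 0 + f p * lam2 p * normal_u p"
      using nz by (simp add: nN)
    \<comment> \<open>The two sides of the Ricci equation differ by the left-hand side of (iv)
      divided by \<open>- (lam2 p * mu1 p)\<close>; the quotient rule for the normal connection
      produces the logarithmic derivatives.\<close>
    have "dv normal_u p - (du normal_v p + f p * lam2 p * (f p * mu1 p)) =
        - (lam2 p * du (codazzi_term f nu lam1) p + nu p * dv (codazzi_term f nu lam1) p
      + (f p)\<^sup>2 * (mu1 p)\<^sup>2 * (lam2 p)\<^sup>2
      - A * (lam2 p * (du mu1 p / mu1 p) - dv nu p + nu p * (dv mu1 p / mu1 p) + nu p * (dv lam2 p / lam2 p)))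
        / (lam2 p * mu1 p)"
      using nz unfolding nu nv by (simp add: field_simps power2_eq_square)
    then show "dv normal_u p + - (f p * nu p) * 0 + f p * lam1 p * 0 =
        du normal_v p + f p * lam2 p * (f p * mu1 p) + - (f p * nu p) * 0"
      unfolding iv' by simp
  qed
qed

end

(* The last factor in cond_iv has the signs forced by the Ricci equation: multiplying
   (A / mu1)_u + (nu A / (lambda2 mu1))_v + f^2 lambda2 mu1 = 0, A = nu_u + (lambda1)_v + lambda1 (ln f^2)_v,
   by lambda2 mu1. The printed source has the opposite sign on its three terms containing v-derivatives. *)
theorem theorem3p3:
  fixes D :: "(real \<times> real) set"
    and f nu lam1 mu1 lam2 :: "real \<times> real \<Rightarrow> real"
    and q0 :: "real \<times> real"
    and p0 x0 y0 n10 n20 :: "real^4"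
  assumes dom: "plane_domain D"
    and smooth: "Cinf_on D f" "Cinf_on D nu" "Cinf_on D lam1" "Cinf_on D mu1" "Cinf_on D lam2"
    and f_pos: "\<And>p. p \<in> D \<Longrightarrow> f p > 0"
    and nu_pos: "\<And>p. p \<in> D \<Longrightarrow> nu p > 0"
    and mu1_nz: "\<And>p. p \<in> D \<Longrightarrow> mu1 p \<noteq> 0"
    and lambda2_nz: "\<And>p. p \<in> D \<Longrightarrow> lam2 p \<noteq> 0"
    and cond_i: "\<And>p. p \<in> D \<Longrightarrow>
      du lam2 p + dv nu p + du (ln_sq f) p * lam2 p = 0"
    and cond_ii: "\<And>p. p \<in> D \<Longrightarrow>
      dv mu1 p + dv (ln_sq f) p * mu1 p
        - ((nu p)^2 - lam1 p * lam2 p) / (lam2 p * mu1 p)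
            * (du nu p + dv lam1 p + dv (ln_sq f) p * lam1 p) = 0"
    and cond_iii: "\<And>p. p \<in> D \<Longrightarrow>
      (2 * f p * dv (du f) p - 2 * du f p * dv f p) / (f p)^4
        - ((nu p)^2 - lam1 p * lam2 p) = 0"
    and cond_iv: "\<And>p. p \<in> D \<Longrightarrow>
      lam2 p * (du (du nu) p + dv (du lam1) p
                + du lam1 p * dv (ln_sq f) p + lam1 p * dv (du (ln_sq f)) p)
        + nu p * (dv (du nu) p + dv (dv lam1) p
                + dv lam1 p * dv (ln_sq f) p + lam1 p * dv (dv (ln_sq f)) p)
        + (f p)^2 * (mu1 p)^2 * (lam2 p)^2
        - (du nu p + dv lam1 p + lam1 p * dv (ln_sq f) p)
            * (lam2 p * du (ln_abs mu1) p - dv nu p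
                + nu p * dv (ln_abs mu1) p + nu p * dv (ln_abs lam2) p) = 0"
    and base: "q0 \<in> D"
    and frame: "pseudo_orthonormal_frame x0 y0 n10 n20"
  shows "\<exists>D0. plane_domain D0 \<and> D0 \<subseteq> D \<and> q0 \<in> D0 \<and>
      (\<exists>z. realizes_data D0 f nu lam1 mu1 lam2 q0 p0 x0 y0 n10 n20 z \<and>
           (\<forall>w. realizes_data D0 f nu lam1 mu1 lam2 q0 p0 x0 y0 n10 n20 w \<longrightarrow>
                (\<forall>p\<in>D0. w p = z p)))"
proof -
  interpret D: second_type_data D f nu lam1 mu1 lam2
    by unfold_locales (use dom smooth f_pos nu_pos mu1_nz lambda2_nz in \<open>auto simp: plane_domain_def\<close>)
  obtain u0 v0 where q0: "q0 = (u0, v0)" by (cases q0)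
  have compat: "dv D.conn_u p + D.conn_u p ** D.conn_v p = du D.conn_v p + D.conn_v p ** D.conn_u p"
    if "p \<in> D" for p
    by (rule D.conn_compatible[OF that cond_i[OF that] cond_ii[OF that] cond_iii[OF that] cond_iv[OF that]])
  obtain r F where r: "0 < r" "{u0 - r..u0 + r} \<times> {v0 - r..v0 + r} \<subseteq> D"
    and F_cont: "continuous_on ({u0 - r..u0 + r} \<times> {v0 - r..v0 + r}) F"
    and F_init: "F (u0, v0) = vec4 x0 y0 n10 n20"
    and F_u: "\<And>u v. u \<in> {u0 - r..u0 + r} \<Longrightarrow> v \<in> {v0 - r..v0 + r} \<Longrightarrow>
      ((\<lambda>u. F (u, v)) has_vector_derivative D.conn_u (u, v) ** F (u, v)) (at u within {u0 - r..u0 + r})"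
    and F_v: "\<And>u v. u \<in> {u0 - r..u0 + r} \<Longrightarrow> v \<in> {v0 - r..v0 + r} \<Longrightarrow>
      ((\<lambda>v. F (u, v)) has_vector_derivative D.conn_v (u, v) ** F (u, v)) (at v within {v0 - r..v0 + r})"
    using linear_total_system_local[OF D.open_D base[unfolded q0] D.smooth_conn compat] by blast
  define I where "I = {u0 - r..u0 + r}"
  define J where "J = {v0 - r..v0 + r}"
  \<comment> \<open>The solution lives on a closed square with one-sided derivatives at the edges;
    in the open interior they become two-sided, as \<open>du\<close> and \<open>dv\<close>
    require.\<close>
  define Q where "Q = interior I \<times> interior J"
  note F_u = F_u[folded I_def J_def] and F_v = F_v[folded I_def J_def]
  have S: "I \<times> J \<subseteq> D" using r by (simp add: I_def J_def)
  have QS: "Q \<subseteq> I \<times> J" using interior_subset by (auto simp: Q_def)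
  then have QD: "Q \<subseteq> D" using S by blast
  have Q: "open Q" "convex Q" "q0 \<in> Q" "plane_domain Q"
    using r(1) by (auto simp: Q_def I_def J_def q0 plane_domain_def interior_atLeastAtMost_real
        intro!: convex_Times open_Times convex_connected)
  have at_I: "at u within I = at u" if "u \<in> interior I" for u using that by (rule at_within_interior)
  have at_J: "at v within J = at v" if "v \<in> interior J" for v using that by (rule at_within_interior)
  \<comment> \<open>\<open>conn_u\<close> and \<open>conn_v\<close> depend on the functions and not
    on the domain, so both interpretations speak of the same matrices.\<close>
  interpret Q: second_type_data Q f nu lam1 mu1 lam2
    by (rule D.restrict[OF Q(1) QD])
  have FQ: "((\<lambda>t. F (t, snd p)) has_vector_derivative D.conn_u p ** F p) (at (fst p))"
    "((\<lambda>t. F (fst p, t)) has_vector_derivative D.conn_v p ** F p) (at (snd p))" if "p \<in> Q" for p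
    using F_u[of "fst p" "snd p"] F_v[of "fst p" "snd p"] that QS at_I[of "fst p"] at_J[of "snd p"]
    by (auto simp: Q_def)
  have F_contQ: "continuous_on Q F"
    using continuous_on_subset[OF F_cont[folded I_def J_def] QS] .
  have F_smooth: "Cinf_on Q F"
    by (rule Cinf_on_linear_system[OF Q(1) Q.smooth_conn F_contQ FQ])
  have dF: "du F p = D.conn_u p ** F p" "dv F p = D.conn_v p ** F p" if "p \<in> Q" for p
    using FQ[OF that] by (auto intro: du_eqI dv_eqI)
  have gram: "gram (F p) = null_gram" if "p \<in> Q" for p
  proof (rule gram_preserved[OF Q(1-3) Q.smooth_conn F_contQ FQ _ _ _ that])
    show "gram (F q0) = null_gram"
      using frame unfolding q0 F_init null_frame_iff_gram[symmetric]
      by (simp add: null_frame_def pseudo_orthonormal_frame_def)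
  qed (simp_all add: Q.conn_u_def Q.conn_v_def skew_null_gram)
  \<comment> \<open>Rows 1, 2, 3 of \<open>F\<close> are x, y, n1. The form is closed because (f
    x)_v and (f y)_u are both -f^2 nu n1: the derivatives of \<open>f\<close> cancel the tangential
    entries of the matrices.\<close>
  obtain z where z0: "z (u0, v0) = p0"
    and z_u: "\<And>u v. u \<in> I \<Longrightarrow> v \<in> J \<Longrightarrow>
      ((\<lambda>u. z (u, v)) has_vector_derivative f (u, v) *\<^sub>R F (u, v) $ 1) (at u within I)"
    and z_v: "\<And>u v. u \<in> I \<Longrightarrow> v \<in> J \<Longrightarrow>
      ((\<lambda>v. z (u, v)) has_vector_derivative f (u, v) *\<^sub>R F (u, v) $ 2) (at v within J)"
  proof (rule potential_on_rectangle[of u0 "u0 - r" "u0 + r" v0 "v0 - r" "v0 + r"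
        "\<lambda>p. f p *\<^sub>R F p $ 1" "\<lambda>p. f p *\<^sub>R F p $ 2" "\<lambda>p. (- ((f p)\<^sup>2 * nu p)) *\<^sub>R F p $ 3" p0,
        folded I_def J_def])
    show "u0 \<in> I" "v0 \<in> J" using r(1) by (auto simp: I_def J_def)
    have c: "continuous_on (I \<times> J) f" "continuous_on (I \<times> J) nu"
      by (auto intro: continuous_on_subset[OF Cinf_on_continuous S] smooth)
    show "continuous_on (I \<times> J) (\<lambda>p. f p *\<^sub>R F p $ 1)" "continuous_on (I \<times> J) (\<lambda>p. f p *\<^sub>R F p $ 2)"
      "continuous_on (I \<times> J) (\<lambda>p. (- ((f p)\<^sup>2 * nu p)) *\<^sub>R F p $ 3)"
      by (intro continuous_intros c F_cont[folded I_def J_def])+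
    fix u v assume uv: "u \<in> I" "v \<in> J"
    then have pD: "(u, v) \<in> D" using S by blast
    note fp = has_derivative_slices_real[OF D.open_D smooth(1) pD, unfolded fst_conv snd_conv]
    have row: "((\<lambda>t. F (t, v) $ i) has_vector_derivative (D.conn_u (u, v) ** F (u, v)) $ i) (at u within I)"
      "((\<lambda>t. F (u, t) $ i) has_vector_derivative (D.conn_v (u, v) ** F (u, v)) $ i) (at v within J)" for i
      by (rule bounded_linear.has_vector_derivative[OF bounded_linear_vec_nth] F_u F_v uv)+
    have "((\<lambda>t. f (u, t) *\<^sub>R F (u, t) $ 1) has_vector_derivative
        f (u, v) *\<^sub>R (D.conn_v (u, v) ** F (u, v)) $ 1 + dv f (u, v) *\<^sub>R F (u, v) $ 1) (at v within J)"
      using has_vector_derivative_scaleR[OF DERIV_subset[OF fp(2)] row(2)[of 1]] by simp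
    moreover have "f (u, v) *\<^sub>R (D.conn_v (u, v) ** F (u, v)) $ 1 + dv f (u, v) *\<^sub>R F (u, v) $ 1
        = (- ((f (u, v))\<^sup>2 * nu (u, v))) *\<^sub>R F (u, v) $ 3"
      using D.f_nz[OF pD]
      by (subst vec4_eta[of "F (u, v)", symmetric])
         (simp add: D.conn_v_def skew_mult vec_eq_iff field_simps power2_eq_square)
    ultimately show "((\<lambda>v. f (u, v) *\<^sub>R F (u, v) $ 1) has_vector_derivative
        (- ((f (u, v))\<^sup>2 * nu (u, v))) *\<^sub>R F (u, v) $ 3) (at v within J)" by simp
    have "((\<lambda>t. f (t, v) *\<^sub>R F (t, v) $ 2) has_vector_derivative
        f (u, v) *\<^sub>R (D.conn_u (u, v) ** F (u, v)) $ 2 + du f (u, v) *\<^sub>R F (u, v) $ 2) (at u within I)"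
      using has_vector_derivative_scaleR[OF DERIV_subset[OF fp(1)] row(1)[of 2]] by simp
    moreover have "f (u, v) *\<^sub>R (D.conn_u (u, v) ** F (u, v)) $ 2 + du f (u, v) *\<^sub>R F (u, v) $ 2
        = (- ((f (u, v))\<^sup>2 * nu (u, v))) *\<^sub>R F (u, v) $ 3"
      using D.f_nz[OF pD]
      by (subst vec4_eta[of "F (u, v)", symmetric])
         (simp add: D.conn_u_def skew_mult vec_eq_iff field_simps power2_eq_square)
    ultimately show "((\<lambda>u. f (u, v) *\<^sub>R F (u, v) $ 2) has_vector_derivative
        (- ((f (u, v))\<^sup>2 * nu (u, v))) *\<^sub>R F (u, v) $ 3) (at u within I)" by simp
  qed blast
  have zQ: "((\<lambda>t. z (t, snd p)) has_vector_derivative f p *\<^sub>R F p $ 1) (at (fst p))"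
    "((\<lambda>t. z (fst p, t)) has_vector_derivative f p *\<^sub>R F p $ 2) (at (snd p))" if "p \<in> Q" for p
    using z_u[of "fst p" "snd p"] z_v[of "fst p" "snd p"] that QS at_I[of "fst p"] at_J[of "snd p"]
    by (auto simp: Q_def)
  have row_smooth: "Cinf_on Q (\<lambda>p. F p $ i)" for i
    by (rule Cinf_on_bounded_linear[OF bounded_linear_vec_nth Q(1) F_smooth])
  have rows: "vec4 (du (\<lambda>p. F p $ 1) p) (du (\<lambda>p. F p $ 2) p) (du (\<lambda>p. F p $ 3) p) (du (\<lambda>p. F p $ 4) p)
      = D.conn_u p ** vec4 (F p $ 1) (F p $ 2) (F p $ 3) (F p $ 4)"
    "vec4 (dv (\<lambda>p. F p $ 1) p) (dv (\<lambda>p. F p $ 2) p) (dv (\<lambda>p. F p $ 3) p) (dv (\<lambda>p. F p $ 4) p)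
      = D.conn_v p ** vec4 (F p $ 1) (F p $ 2) (F p $ 3) (F p $ 4)" if p: "p \<in> Q" for p
  proof -
    have "du (\<lambda>p. F p $ i) p = (D.conn_u p ** F p) $ i" "dv (\<lambda>p. F p $ i) p = (D.conn_v p ** F p) $ i" for i
      by (rule du_eqI dv_eqI, rule bounded_linear.has_vector_derivative[OF bounded_linear_vec_nth], rule FQ[OF p])+
    then show "vec4 (du (\<lambda>p. F p $ 1) p) (du (\<lambda>p. F p $ 2) p) (du (\<lambda>p. F p $ 3) p) (du (\<lambda>p. F p $ 4) p)
        = D.conn_u p ** vec4 (F p $ 1) (F p $ 2) (F p $ 3) (F p $ 4)"
      "vec4 (dv (\<lambda>p. F p $ 1) p) (dv (\<lambda>p. F p $ 2) p) (dv (\<lambda>p. F p $ 3) p) (dv (\<lambda>p. F p $ 4) p)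
        = D.conn_v p ** vec4 (F p $ 1) (F p $ 2) (F p $ 3) (F p $ 4)"
      by (simp_all add: vec4_eta)
  qed
  note rows = rows[unfolded D.conn_u_def D.conn_v_def skew_mult vec4_eq_iff]
  have real: "realizes_data Q f nu lam1 mu1 lam2 q0 p0 x0 y0 n10 n20 z"
  proof (rule Q.realizes_data_of_frame[OF Q(4,3) row_smooth[of 1] row_smooth[of 2] row_smooth[of 3]
        row_smooth[of 4] zQ])
    show "null_frame (F p $ 1) (F p $ 2) (F p $ 3) (F p $ 4)" if "p \<in> Q" for p
      using gram[OF that] by (simp add: null_frame_iff_gram vec4_eta)
  qed (simp_all add: rows q0 z0 F_init)
  have "w p = z p" if w: "realizes_data Q f nu lam1 mu1 lam2 q0 p0 x0 y0 n10 n20 w" and p: "p \<in> Q" for w p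
  proof -
    obtain G where G: "Cinf_on Q G" "G q0 = vec4 x0 y0 n10 n20"
      "\<And>p. p \<in> Q \<Longrightarrow> du G p = D.conn_u p ** G p" "\<And>p. p \<in> Q \<Longrightarrow> dv G p = D.conn_v p ** G p"
      "\<And>p. p \<in> Q \<Longrightarrow> du w p = f p *\<^sub>R G p $ 1" "\<And>p. p \<in> Q \<Longrightarrow> dv w p = f p *\<^sub>R G p $ 2"
      "Cinf_on Q w" "w q0 = p0"
      using Q.frame_of_realizes_data[OF w Q(3)] by blast
    \<comment> \<open>The prescribed initial frame makes the frame of \<open>w\<close> equal to
      \<open>F\<close>; hence \<open>w\<close> and \<open>z\<close> have the same partial
      derivatives, and the common value \<open>p0\<close> at \<open>q0\<close> identifies
      them.\<close>
    have GF: "G q = F q" if "q \<in> Q" for q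
      by (rule linear_system_unique[OF Q(1-3) Q.smooth_conn G(1) F_smooth G(3,4) dF _ that])
         (simp_all add: G(2)[unfolded q0] F_init q0)
    have z_smooth: "Cinf_on Q z"
      using real by (auto simp: realizes_data_def timelike_surface_def immersed_surface_def)
    have "du z q = f q *\<^sub>R F q $ 1" "dv z q = f q *\<^sub>R F q $ 2" if "q \<in> Q" for q
      using zQ[OF that] by (auto intro: du_eqI dv_eqI)
    then show ?thesis
      using G(5,6) GF G(8) z0 q0
      by (intro equal_of_equal_partials[OF Q(1-3) G(7) z_smooth _ _ _ p]) auto
  qed
  with real Q QD show ?thesis by blast
qed

end
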